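(* Let $\Sigma=((\Phi^{(i)})_{i\in I},(\mathbf{p}_i)_{i\in I},\mathbb{P})$ be a non-trivial Bernoulli model satisfying the strong separation condition. Then there exists a non-trivial $S$-ergodic distribution $Q$ on $\mathcal{M}^{\square}$ such that for $\mathbb{P}$-a.e. $\omega$ the measure $\eta^{(\omega)}$ generates $Q$.
   Context: Model: Let $I$ be a finite set and for each $i\in I$ let $\Phi^{(i)}=(f^{(i)}_1,\dots,f^{(i)}_{k_i})$ be a homogeneous IFS: there is $r_i\in(-1,0)\cup(0,1)$ with $f^{(i)}_j(x)=r_i x+t^{(i)}_j$, $t^{(i)}_j\in\mathbb{R}$ ($k_i=1$ is allowed). Let $\Omega=I^{\mathbb{N}}$ with left shift $\sigma$. For $\omega\in\Omega$ let $X^{(\omega)}_\infty=\prod_{j\ge1}\{1,\dots,k_{\omega_j}\}$, and define $\Pi_\omega(u)=\sum_{n\ge1}\big(\prod_{j=1}^{n-1}r_{\omega_j}\big)t^{(\omega_n)}_{u_n}$ for $u\in X^{(\omega)}_\infty$, with image $Y^{(\omega)}$. Then $Y^{(\omega)}=\bigcup_{u=1}^{k_{\omega_1}} f^{(\omega_1)}_u(Y^{(\sigma\omega)})$; the strong separation condition means this union is disjoint for every $\omega\in\Omega$ (a single set counts as disjoint). For each $i$ let $\mathbf{p}_i$ be a strictly positive probability vector on $\{1,\dots,k_i\}$; $\bar\eta^{(\omega)}=\prod_n\mathbf{p}_{\omega_n}$ and $\eta^{(\omega)}=\Pi_\omega\bar\eta^{(\omega)}$. $\mathbb{P}$ is a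 $\sigma$-invariant probability on $\Omega$; the model is Bernoulli if $\mathbb{P}$ is a Bernoulli measure, non-trivial if $\eta^{(\omega)}$ is non-atomic for $\mathbb{P}$-a.e. $\omega$. Scenery flow: $\mathcal{M}^{\square}=\{\mu\in\mathcal{P}([-1,1]):0\in\operatorname{supp}\mu\}$. For $\mu\in\mathcal{P}(\mathbb{R})$ and $x\in\operatorname{supp}\mu$, $\mu_x(E)=\mu(E+x)/\mu([x-1,x+1])$ for Borel $E\subset[-1,1]$. For $\nu\in\mathcal{M}^{\square}$ and $t\ge0$, $S_t\nu(E)=\nu(e^{-t}E)/\nu([-e^{-t},e^{-t}])$ for Borel $E\subset[-1,1]$; $S=(S_t)_{t\ge0}$ is the scaling flow. A measure $\mu$ generates a distribution $P\in\mathcal{P}(\mathcal{P}([-1,1]))$ at $x$ if $\frac1T\int_0^T f(S_t\mu_x)\,dt\to\int f\,dP$ for all $f\in C(\mathcal{P}([-1,1]))$ (weak topology), and generates $P$ if this holds for $\mu$-a.e. $x$. A distribution is trivial if it is the point mass at $\delta_0\in\mathcal{M}^{\square}$; it is $S$-ergodic if it is $S$-invariant and ergodic for the flow $S$. *)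

theory Defs
  imports "HOL-Probability.Probability"
begin

text \<open>Index convention: a sequence \<open>\<omega> = (\<omega>_1, \<omega>_2, ...)\<close> of the paper is
  represented as \<open>\<omega> :: nat \<Rightarrow> 'i\<close> with \<open>\<omega>_n = \<omega> (n-1)\<close>.
  Data of the model: \<open>k i\<close> (number of maps), \<open>r i\<close> (common contraction ratio),
  \<open>t i j\<close> (translation of map \<open>j \<in> {1..k i}\<close>), \<open>p i j\<close> (probability weights).\<close>

definition ifs_map :: "('i \<Rightarrow> real) \<Rightarrow> ('i \<Rightarrow> nat \<Rightarrow> real) \<Rightarrow> 'i \<Rightarrow> nat \<Rightarrow> real \<Rightarrow> real" where
  "ifs_map r t i j x = r i * x + t i j"

definition shift :: "(nat \<Rightarrow> 'i) \<Rightarrow> (nat \<Rightarrow> 'i)" where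
  "shift \<omega> = (\<lambda>n. \<omega> (Suc n))"

definition code_space :: "('i \<Rightarrow> nat) \<Rightarrow> (nat \<Rightarrow> 'i) \<Rightarrow> (nat \<Rightarrow> nat) set" where
  "code_space k \<omega> = {u. \<forall>n. u n \<in> {1..k (\<omega> n)}}"

definition coding :: "('i \<Rightarrow> real) \<Rightarrow> ('i \<Rightarrow> nat \<Rightarrow> real) \<Rightarrow> (nat \<Rightarrow> 'i) \<Rightarrow> (nat \<Rightarrow> nat) \<Rightarrow> real" where
  "coding r t \<omega> u = (\<Sum>n. (\<Prod>j<n. r (\<omega> j)) * t (\<omega> n) (u n))"

definition attractor :: "('i \<Rightarrow> nat) \<Rightarrow> ('i \<Rightarrow> real) \<Rightarrow> ('i \<Rightarrow> nat \<Rightarrow> real) \<Rightarrow> (nat \<Rightarrow> 'i) \<Rightarrow> real set" where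
  "attractor k r t \<omega> = coding r t \<omega> ` code_space k \<omega>"

definition strong_separation :: "('i \<Rightarrow> nat) \<Rightarrow> ('i \<Rightarrow> real) \<Rightarrow> ('i \<Rightarrow> nat \<Rightarrow> real) \<Rightarrow> bool" where
  "strong_separation k r t \<longleftrightarrow>
     (\<forall>\<omega> :: nat \<Rightarrow> 'i. \<forall>u \<in> {1..k (\<omega> 0)}. \<forall>v \<in> {1..k (\<omega> 0)}. u \<noteq> v \<longrightarrow>
        ifs_map r t (\<omega> 0) u ` attractor k r t (shift \<omega>) \<inter>
        ifs_map r t (\<omega> 0) v ` attractor k r t (shift \<omega>) = {})"

definition digit_measure :: "('i \<Rightarrow> nat) \<Rightarrow> ('i \<Rightarrow> nat \<Rightarrow> real) \<Rightarrow> 'i \<Rightarrow> nat measure" where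
  "digit_measure k p i = density (count_space UNIV) (\<lambda>j. if j \<in> {1..k i} then ennreal (p i j) else 0)"

definition sym_measure :: "('i \<Rightarrow> nat) \<Rightarrow> ('i \<Rightarrow> nat \<Rightarrow> real) \<Rightarrow> (nat \<Rightarrow> 'i) \<Rightarrow> (nat \<Rightarrow> nat) measure" where
  "sym_measure k p \<omega> = PiM UNIV (\<lambda>n. digit_measure k p (\<omega> n))"

definition proj_measure :: "('i \<Rightarrow> nat) \<Rightarrow> ('i \<Rightarrow> real) \<Rightarrow> ('i \<Rightarrow> nat \<Rightarrow> real) \<Rightarrow> ('i \<Rightarrow> nat \<Rightarrow> real)
    \<Rightarrow> (nat \<Rightarrow> 'i) \<Rightarrow> real measure" where
  "proj_measure k r t p \<omega> = distr (sym_measure k p \<omega>) borel (coding r t \<omega>)"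

text \<open>Measures on \<open>[-1,1]\<close> are measures whose measurable space is \<open>[-1,1]\<close>
  with its Borel sets.\<close>
definition Kbox :: "real measure" where
  "Kbox = restrict_space borel {-1..1}"

definition PK :: "real measure set" where
  "PK = space (prob_algebra Kbox)"

definition weak_top :: "real measure topology" where
  "weak_top = topology_generated_by
     {{N \<in> PK. (\<integral>y. g y \<partial>N) \<in> U} | (g :: real \<Rightarrow> real) (U :: real set). continuous_on {-1..1} g \<and> open U}"

definition msupp :: "real measure \<Rightarrow> real set" where
  "msupp \<mu> = {x \<in> space \<mu>. \<forall>e>0. emeasure \<mu> (ball x e \<inter> space \<mu>) > 0}"

definition Mbox :: "real measure set" where
  "Mbox = {\<nu> \<in> PK. 0 \<in> msupp \<nu>}"

definition blowup :: "real measure \<Rightarrow> real \<Rightarrow> real measure" where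
  "blowup \<mu> x = measure_of {-1..1} (sets Kbox)
     (\<lambda>E. emeasure \<mu> ((\<lambda>y. y + x) ` E) / emeasure \<mu> {x-1..x+1})"

definition scaling :: "real \<Rightarrow> real measure \<Rightarrow> real measure" where
  "scaling s \<nu> = measure_of {-1..1} (sets Kbox)
     (\<lambda>E. emeasure \<nu> ((\<lambda>y. exp (-s) * y) ` E) / emeasure \<nu> {-exp (-s)..exp (-s)})"

definition generates_at :: "real measure \<Rightarrow> real \<Rightarrow> real measure measure \<Rightarrow> bool" where
  "generates_at \<mu> x Q \<longleftrightarrow> x \<in> msupp \<mu> \<and>
     (\<forall>f. continuous_map weak_top euclideanreal f \<longrightarrow>
        ((\<lambda>T. (1 / T) * integral {0..T} (\<lambda>s. f (scaling s (blowup \<mu> x)))) \<longlongrightarrow> (\<integral>\<nu>. f \<nu> \<partial>Q)) at_top)"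

definition generates :: "real measure \<Rightarrow> real measure measure \<Rightarrow> bool" where
  "generates \<mu> Q \<longleftrightarrow> (AE x in \<mu>. generates_at \<mu> x Q)"

definition distribution_on_Mbox :: "real measure measure \<Rightarrow> bool" where
  "distribution_on_Mbox Q \<longleftrightarrow> prob_space Q \<and> sets Q = sets (prob_algebra Kbox) \<and>
     (AE \<nu> in Q. \<nu> \<in> Mbox)"

definition trivial_distribution :: "real measure measure" where
  "trivial_distribution = return (prob_algebra Kbox) (return Kbox 0)"

definition S_invariant :: "real measure measure \<Rightarrow> bool" where
  "S_invariant Q \<longleftrightarrow> (\<forall>s\<ge>0. \<forall>A \<in> sets Q.
     emeasure Q {\<nu> \<in> Mbox. scaling s \<nu> \<in> A} = emeasure Q A)"

definition S_ergodic :: "real measure measure \<Rightarrow> bool" where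
  "S_ergodic Q \<longleftrightarrow> S_invariant Q \<and>
     (\<forall>A \<in> sets Q. (\<forall>s\<ge>0. {\<nu> \<in> Mbox. scaling s \<nu> \<in> A} = A \<inter> Mbox) \<longrightarrow>
        emeasure Q A = 0 \<or> emeasure Q A = 1)"

end

theory Submission
  imports Defs
begin

text \<open>Let \<open>\<eta>\<close> be the random measure and \<open>x\<close> a point with random digits. By compactness the first-level
  cylinders are uniformly \<open>\<delta>\<close>-separated, so a window of radius less than \<open>\<delta>\<close> around \<open>x\<close> only sees
  the first-level cylinder of \<open>x\<close>, which is an affine copy of the measure of the shifted environment.
  Hence the scenery at \<open>x\<close>, started at scale \<open>\<delta>\<close>, is a factor of a suspension flow with roof
  \<open>- ln \<bar>r\<bar>\<close> over the Bernoulli shift of letters (map system, digit), extended by a sign recording the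
  orientation. A function with \<open>g x = h (x 0) * g (shift x)\<close> and mean zero is orthogonal
  to all cylinder functions, so this sign extension is ergodic (on a single sign if
  negative ratios have probability zero). The image of the suspension measure is the required distribution,
  and Birkhoff's theorem applied to the countably many monomials in the moments
  yields generation, because these monomials span a dense set of weakly continuous functions.\<close>

section \<open>Birkhoff's ergodic theorem\<close>

text \<open>The orientation bit is there because a negative ratio reflects the window: shifting the
  letters and rescaling by the modulus of the ratio alone would not give back the same measure.
  Almost sure statements on the skew product descend to the unreflected start because
  \<open>sign_pmf\<close> always charges \<open>False\<close>. The suspension flow is not built on a
  quotient. Sceneries are functions of a base point and an unrestricted real time, tied to the base
  only by an identity at the roof. A scaling-invariant set of measures then pulls back to a set of
  base points, and ergodicity of the base decides its probability. The roof identity holds for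
  admissible digits only, that is, off a null set; hence ergodicity is stated for almost invariant
  sets. Scales between 1 and \<delta> take up a bounded stretch of time and do not influence
  averages. The last obstacle is to pass from random letters to almost every environment and then to
  almost every point of the line. This needs the good points to form a Borel set, so generation is
  first reduced to countably many conditions.\<close>

locale ergodic_mpt = prob_space M for M :: "'a measure" +
  fixes T :: "'a \<Rightarrow> 'a"
  assumes measurable_T [measurable]: "T \<in> M \<rightarrow>\<^sub>M M"
    and distr_T: "distr M M T = M"
    and ergodic: "\<And>A. A \<in> sets M \<Longrightarrow> (AE x in M. x \<in> A \<longleftrightarrow> T x \<in> A) \<Longrightarrow> prob A = 0 \<or> prob A = 1"
begin

lemma integral_T:
  fixes f :: "'a \<Rightarrow> real"
  assumes [measurable]: "f \<in> borel_measurable M"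
  shows "(\<integral>x. f (T x) \<partial>M) = (\<integral>x. f x \<partial>M)"
  by (subst (2) distr_T[symmetric], subst integral_distr) auto

lemma nn_integral_T:
  assumes [measurable]: "f \<in> borel_measurable M"
  shows "(\<integral>\<^sup>+x. f (T x) \<partial>M) = (\<integral>\<^sup>+x. f x \<partial>M)"
  by (subst (2) distr_T[symmetric], subst nn_integral_distr) auto

lemma AE_T:
  assumes "AE x in M. P x"
  shows "AE x in M. P (T x)"
proof (rule AE_distrD[OF measurable_T])
  show "AE x in distr M M T. P x"
    unfolding distr_T by (rule assms)
qed

lemma AE_funpow:
  assumes "AE x in M. P x"
  shows "AE x in M. \<forall>n. P ((T ^^ n) x)"
  unfolding AE_all_countable
proof
  fix n show "AE x in M. P ((T ^^ n) x)"
  proof (induction n)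
    case (Suc n)
    from AE_T[OF this] show ?case
      by (simp add: funpow_swap1)
  qed (use assms in simp)
qed

lemma measurable_funpow [measurable]: "T ^^ n \<in> M \<rightarrow>\<^sub>M M"
  by (induction n) (auto simp: id_def intro: measurable_comp)

definition birkhoff_sum :: "('a \<Rightarrow> real) \<Rightarrow> nat \<Rightarrow> 'a \<Rightarrow> real" where
  "birkhoff_sum f n x = (\<Sum>i<n. f ((T ^^ i) x))"

lemma birkhoff_sum_Suc: "birkhoff_sum f (Suc n) x = f x + birkhoff_sum f n (T x)"
  unfolding birkhoff_sum_def
  by (subst sum.lessThan_Suc_shift) (simp add: funpow_swap1)

lemma measurable_birkhoff_sum [measurable]:
  "f \<in> borel_measurable M \<Longrightarrow> birkhoff_sum f n \<in> borel_measurable M"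
  unfolding birkhoff_sum_def
  by (intro borel_measurable_sum measurable_compose[OF measurable_funpow])

text \<open>The auxiliary function \<open>g n\<close> is the maximum of the first \<open>n\<close> Birkhoff sums and \<open>0\<close>.\<close>
lemma maximal_ergodic:
  fixes f :: "'a \<Rightarrow> real"
  assumes [measurable]: "f \<in> borel_measurable M"
    and bounded: "\<And>x. \<bar>f x\<bar> \<le> B"
    and pos: "AE x in M. \<exists>n. 0 < birkhoff_sum f n x"
  shows "0 \<le> (\<integral>x. f x \<partial>M)"
proof -
  define g where "g = rec_nat (\<lambda>_. 0) (\<lambda>n h x. max 0 (f x + h (T x)))"
  have g0: "g 0 x = 0" and gS: "g (Suc n) x = max 0 (f x + g n (T x))" for n x
    by (simp_all add: g_def)
  have gm [measurable]: "g n \<in> borel_measurable M" for n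
  proof (induction n)
    case (Suc n)
    have "g (Suc n) = (\<lambda>x. max 0 (f x + g n (T x)))" by (auto simp: gS)
    with Suc show ?case by (simp; measurable)
  qed (simp add: g_def)
  have g_nonneg: "0 \<le> g n x" for n x
    by (cases n) (auto simp: g0 gS)
  have "0 \<le> B" using bounded[of undefined] by linarith
  have g_bound: "g n x \<le> n * B" for n x
  proof (induction n arbitrary: x)
    case (Suc n)
    show ?case using Suc[of "T x"] bounded[of x] \<open>0 \<le> B\<close> by (auto simp: gS algebra_simps abs_le_iff)
  qed (simp add: g0)
  have g_mono: "g n x \<le> g (Suc n) x" for n x
  proof (induction n arbitrary: x)
    case (Suc n)
    show ?case using Suc[of "T x"] unfolding gS[of "Suc n"] gS[of n x] by linarith
  qed (simp add: g0 gS)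
  have g_ge: "birkhoff_sum f n x \<le> g n x" for n x
  proof (induction n arbitrary: x)
    case (Suc n)
    show ?case using Suc[of "T x"] unfolding gS birkhoff_sum_Suc by linarith
  qed (simp add: g0 birkhoff_sum_def)
  have int_g: "integrable M (g n)" for n
    by (rule integrable_const_bound[where B="n * B"]) (use g_bound g_nonneg in auto)
  have int_gT: "integrable M (\<lambda>x. g n (T x))" for n
    by (rule integrable_const_bound[where B="n * B"]) (use g_bound g_nonneg in auto)
  have int_f: "integrable M (\<lambda>x. f x * indicator {x. 0 < g n x} x)" for n
    by (rule integrable_const_bound[where B=B]) (use bounded \<open>0 \<le> B\<close> in \<open>auto simp: indicator_def\<close>)
  \<comment> \<open>The coboundary of \<open>g (Suc n)\<close> has mean zero. Where
    \<open>g (Suc n)\<close> is positive it is at most \<open>f\<close>, because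
    \<open>g n \<le> g (Suc n)\<close> at \<open>T x\<close>; elsewhere it is at most 0.\<close>
  have step: "0 \<le> (\<integral>x. f x * indicator {x. 0 < g (Suc n) x} x \<partial>M)" for n
  proof -
    have "0 = (\<integral>x. g (Suc n) x - g (Suc n) (T x) \<partial>M)"
      by (subst Bochner_Integration.integral_diff) (auto simp: int_g int_gT integral_T)
    also have "\<dots> \<le> (\<integral>x. f x * indicator {x. 0 < g (Suc n) x} x \<partial>M)"
    proof (rule integral_mono)
      show "integrable M (\<lambda>x. g (Suc n) x - g (Suc n) (T x))"
        using int_g int_gT by auto
      fix x
      show "g (Suc n) x - g (Suc n) (T x) \<le> f x * indicator {x. 0 < g (Suc n) x} x"
      proof (cases "0 < g (Suc n) x")
        case True
        then have "g (Suc n) x = f x + g n (T x)" by (auto simp: gS)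
        then show ?thesis using True g_mono[of n "T x"] by simp
      qed (use g_nonneg[of "Suc n" "T x"] in auto)
    qed (rule int_f)
    finally show ?thesis .
  qed
  \<comment> \<open>By \<open>pos\<close> the sets where \<open>g (Suc n)\<close> is positive
    increase to almost the whole space, so \<open>f\<close> itself is left in the limit.\<close>
  have "(\<lambda>n. \<integral>x. f x * indicator {x. 0 < g (Suc n) x} x \<partial>M) \<longlonglongrightarrow> (\<integral>x. f x \<partial>M)"
  proof (rule integral_dominated_convergence[where w="\<lambda>_. B"])
    show "AE x in M. (\<lambda>n. f x * indicator {x. 0 < g (Suc n) x} x) \<longlonglongrightarrow> f x"
      using pos
    proof eventually_elim
      case (elim x)
      then obtain n where "0 < birkhoff_sum f n x" by auto
      with g_ge[of n x] have "0 < g n x" by linarith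
      moreover have "g n x \<le> g m x" if "n \<le> m" for m
        using that g_mono[of _ x] by (rule lift_Suc_mono_le[rotated])
      ultimately have "0 < g (Suc m) x" if "n \<le> m" for m
        using that by (meson le_Suc_eq less_le_trans)
      then have "eventually (\<lambda>m. f x * indicator {x. 0 < g (Suc m) x} x = f x) sequentially"
        by (intro eventually_sequentiallyI[of n]) auto
      then show ?case by (rule tendsto_eventually)
    qed
    show "AE x in M. norm (f x * indicator {x. 0 < g (Suc n) x} x) \<le> B" for n
      using bounded \<open>0 \<le> B\<close> by (auto simp: indicator_def)
  qed auto
  then show ?thesis
    by (rule LIMSEQ_le_const) (use step in auto)
qed

text \<open>The set where the Birkhoff sums of \<open>f - c\<close> are unbounded above is
  invariant, because passing from \<open>x\<close> to \<open>T x\<close> changes them by one term.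
  If it had probability 1, the maximal inequality would make the mean of \<open>f - c\<close>
  nonnegative, against the choice of \<open>c\<close>.\<close>

lemma birkhoff_sum_upper:
  fixes f :: "'a \<Rightarrow> real"
  assumes [measurable]: "f \<in> borel_measurable M"
    and bounded: "\<And>x. \<bar>f x\<bar> \<le> B"
    and c: "(\<integral>x. f x \<partial>M) < c"
  shows "AE x in M. \<exists>b. \<forall>n. birkhoff_sum f n x \<le> b + n * c"
proof -
  define h where "h x = f x - c" for x
  have h_meas [measurable]: "h \<in> borel_measurable M" unfolding h_def by measurable
  have bh: "\<bar>h x\<bar> \<le> B + \<bar>c\<bar>" for x
    using bounded[of x] by (auto simp: h_def)
  have hsum: "birkhoff_sum h n x = birkhoff_sum f n x - n * c" for n x
    by (simp add: birkhoff_sum_def h_def sum_subtractf)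
  \<comment> \<open>Natural bounds \<open>b\<close> make \<open>A\<close> measurable;
    \<open>unb\<close> returns to real bounds.\<close>
  define A where "A = {x \<in> space M. \<forall>b::nat. \<exists>n. real b < birkhoff_sum h n x}"
  have [measurable]: "A \<in> sets M" unfolding A_def by measurable
  have unb: "(\<forall>b::nat. \<exists>n. real b < u n) \<longleftrightarrow> (\<forall>b::real. \<exists>n. b < u n)" for u :: "nat \<Rightarrow> real"
    by (meson less_trans reals_Archimedean2)
  have "x \<in> A \<longleftrightarrow> T x \<in> A" if "x \<in> space M" for x
  proof -
    have "(\<exists>n. b < birkhoff_sum h n (T x))" if *: "\<forall>b::real. \<exists>n. b < birkhoff_sum h n x" for b
    proof -
      obtain n where n: "\<bar>b\<bar> + \<bar>h x\<bar> < birkhoff_sum h n x" using * by blast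
      \<comment> \<open>Only a nonempty sum can lose its first term, so index 0 has to be
        excluded.\<close>
      have "\<not> 0 < birkhoff_sum h 0 x" by (simp add: birkhoff_sum_def)
      with n have "n \<noteq> 0" by (metis abs_ge_zero add_nonneg_nonneg le_less_trans)
      then obtain m where "n = Suc m" using not0_implies_Suc by blast
      with n show ?thesis by (intro exI[of _ m]) (auto simp: birkhoff_sum_Suc)
    qed
    moreover have "(\<exists>n. b < birkhoff_sum h n x)" if *: "\<forall>b::real. \<exists>n. b < birkhoff_sum h n (T x)" for b
    proof -
      obtain n where n: "b - h x < birkhoff_sum h n (T x)" using * by blast
      then show ?thesis by (intro exI[of _ "Suc n"]) (auto simp: birkhoff_sum_Suc)
    qed
    ultimately show ?thesis
      using \<open>x \<in> space M\<close> measurable_space[OF measurable_T] by (auto simp: A_def unb)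
  qed
  then have "prob A = 0 \<or> prob A = 1"
    by (intro ergodic) auto
  moreover have "prob A \<noteq> 1"
  proof
    assume "prob A = 1"
    then have "AE x in M. x \<in> A" by (simp add: prob_eq_1)
    then have "AE x in M. \<exists>n. 0 < birkhoff_sum h n x"
      by eventually_elim (auto simp: A_def unb)
    then have "0 \<le> (\<integral>x. h x \<partial>M)"
      by (rule maximal_ergodic[OF h_meas bh])
    moreover have "integrable M f"
      by (rule integrable_const_bound[where B=B]) (use bounded in auto)
    ultimately show False
      using c by (simp add: h_def prob_space)
  qed
  ultimately have "prob A = 0" by blast
  then have "AE x in M. x \<notin> A"
    by (simp add: prob_eq_0)
  then show ?thesis
    using AE_space
  proof eventually_elim
    case (elim x)
    then obtain b :: nat where "\<And>n. birkhoff_sum h n x \<le> b"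
      by (auto simp: A_def not_less)
    then show ?case
      by (intro exI[of _ "real b"]) (simp add: hsum algebra_simps)
  qed
qed

text \<open>The upper bound is used for \<open>f\<close> and for \<open>- f\<close>, with slopes
  \<open>1 / Suc m\<close> above their means. After division by \<open>n\<close> the additive
  constants disappear.\<close>

theorem birkhoff:
  fixes f :: "'a \<Rightarrow> real"
  assumes [measurable]: "f \<in> borel_measurable M"
    and bounded: "\<And>x. \<bar>f x\<bar> \<le> B"
  shows "AE x in M. (\<lambda>n. birkhoff_sum f n x / n) \<longlonglongrightarrow> (\<integral>x. f x \<partial>M)"
proof -
  define I where "I = (\<integral>x. f x \<partial>M)"
  have up: "AE x in M. \<exists>b. \<forall>n. birkhoff_sum f n x \<le> b + n * (I + 1 / Suc m)" for m
    by (rule birkhoff_sum_upper[OF assms]) (simp add: I_def)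
  have "AE x in M. \<exists>b. \<forall>n. birkhoff_sum (\<lambda>x. - f x) n x \<le> b + n * (- I + 1 / Suc m)" for m
    by (rule birkhoff_sum_upper[where B=B]) (use bounded in \<open>auto simp: I_def\<close>)
  then have "AE x in M. \<forall>m. (\<exists>b. \<forall>n. birkhoff_sum (\<lambda>x. - f x) n x \<le> b + n * (- I + 1 / Suc m)) \<and>
      (\<exists>b. \<forall>n. birkhoff_sum f n x \<le> b + n * (I + 1 / Suc m))"
    using up unfolding AE_all_countable by auto
  then show ?thesis
    unfolding I_def[symmetric]
  proof eventually_elim
    case (elim x)
    show ?case
    proof (rule LIMSEQ_I)
      fix e :: real assume "0 < e"
      obtain m where m: "1 / Suc m < e / 2"
        using \<open>0 < e\<close> nat_approx_posE[of "e/2"] by auto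
      from elim obtain b1 b2
        where b1: "\<And>n. birkhoff_sum (\<lambda>x. - f x) n x \<le> b1 + n * (- I + 1 / Suc m)"
          and b2: "\<And>n. birkhoff_sum f n x \<le> b2 + n * (I + 1 / Suc m)"
        by blast
      \<comment> \<open>Beyond \<open>N\<close> the additive constants contribute less than half of
        \<open>e\<close>; the slope error \<open>1 / Suc m\<close> contributes less than the other
        half.\<close>
      obtain N :: nat where N: "max 1 (2 * (\<bar>b1\<bar> + \<bar>b2\<bar>) / e) < N"
        using reals_Archimedean2 by blast
      show "\<exists>N. \<forall>n\<ge>N. norm (birkhoff_sum f n x / n - I) < e"
      proof (intro exI allI impI)
        fix n assume "N \<le> n"
        with N have n: "0 < real n" "2 * (\<bar>b1\<bar> + \<bar>b2\<bar>) / e < n"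
          by linarith+
        then have bn: "\<bar>b1\<bar> + \<bar>b2\<bar> < n * (e / 2)"
          using \<open>0 < e\<close> by (simp add: field_simps)
        have me: "n * (1 / Suc m) < n * (e / 2)"
          using m n by (intro mult_strict_left_mono) auto
        have neg: "birkhoff_sum (\<lambda>x. - f x) n x = - birkhoff_sum f n x"
          by (simp add: birkhoff_sum_def sum_negf)
        have "\<bar>birkhoff_sum f n x - n * I\<bar> < n * e"
          using b1[of n] b2[of n] bn me unfolding neg by (simp only: ring_distribs abs_less_iff) linarith
        then have "\<bar>birkhoff_sum f n x - n * I\<bar> / n < e"
          using n by (simp add: field_simps)
        moreover have "birkhoff_sum f n x / n - I = (birkhoff_sum f n x - n * I) / n"
          using n by (simp add: field_simps)
        ultimately show "norm (birkhoff_sum f n x / n - I) < e"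
          using n by simp
      qed
    qed
  qed
qed

end

section \<open>Suspension flows\<close>

text \<open>Bridge between two integrals: the time averages in the definition of generation are
  gauge integrals, whereas measurability and Fubini arguments run on Lebesgue integrals.\<close>

lemma integrable_on_bounded_borel:
  fixes f :: "real \<Rightarrow> real"
  assumes [measurable]: "f \<in> borel_measurable borel" and bounded: "\<And>x. \<bar>f x\<bar> \<le> B"
  shows "f integrable_on {a..b}"
    and "integral {a..b} f = (\<integral>x. indicator {a..b} x * f x \<partial>lborel)"
proof -
  have "set_integrable lborel {a..b} f"
    unfolding set_integrable_def
    by (rule integrableI_bounded_set_indicator[where B=B])
       (use bounded in \<open>auto simp: emeasure_lborel_Icc_eq\<close>)
  from set_borel_integral_eq_integral[OF this]
  show "f integrable_on {a..b}" "integral {a..b} f = (\<integral>x. indicator {a..b} x * f x \<partial>lborel)"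
    by (auto simp: set_lebesgue_integral_def)
qed

lemma integral_bounded_le:
  fixes f :: "real \<Rightarrow> real"
  assumes "f \<in> borel_measurable borel" and "\<And>x. \<bar>f x\<bar> \<le> B" and "a \<le> b"
  shows "\<bar>integral {a..b} f\<bar> \<le> B * (b - a)"
proof -
  have "\<bar>integral {a..b} f\<bar> \<le> integral {a..b} (\<lambda>_. B)"
    using integral_norm_bound_integral[of f "{a..b}" "\<lambda>_. B"] assms
    by (auto simp: integrable_on_bounded_borel[OF assms(1,2)])
  then show ?thesis using assms(3) by (simp add: mult.commute)
qed

lemma integral_translate:
  fixes f :: "real \<Rightarrow> real"
  shows "integral {a..b} (\<lambda>x. f (x + c)) = integral {a + c..b + c} f"
  using integral_shift_Icc_real[of a b f c] by (simp add: o_def add.commute)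

lemma integral_from_0_diff:
  fixes f :: "real \<Rightarrow> real"
  assumes f: "f \<in> borel_measurable borel" "\<And>x. \<bar>f x\<bar> \<le> B" and "0 \<le> s" "0 \<le> t"
  shows "\<bar>integral {b..b + t} f - integral {0..s} f\<bar> \<le> B * (\<bar>t - s\<bar> + 2 * \<bar>b\<bar>)"
proof -
  \<comment> \<open>Primitives start at the smaller of the two left endpoints, so a negative start
    is covered; the start will be \<open>ln \<delta>\<close>.\<close>
  define m where "m = min b 0"
  have B: "0 \<le> B" using f(2)[of 0] by linarith
  have split: "integral {m..y} f = integral {m..x} f + integral {x..y} f" if "m \<le> x" "x \<le> y" for x y
    using Henstock_Kurzweil_Integration.integral_combine[OF that integrable_on_bounded_borel(1)[OF f]] by simp
  have lip: "\<bar>integral {m..x} f - integral {m..y} f\<bar> \<le> B * \<bar>x - y\<bar>" if "m \<le> x" "m \<le> y" for x y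
  proof (cases "x \<le> y")
    case True
    then show ?thesis using split[of x y] integral_bounded_le[OF f, of x y] that by auto
  next
    case False
    then show ?thesis using split[of y x] integral_bounded_le[OF f, of y x] that by auto
  qed
  have "integral {b..b + t} f - integral {0..s} f
    = (integral {m..b + t} f - integral {m..s} f) - (integral {m..b} f - integral {m..0} f)"
    using split[of b "b + t"] split[of 0 s] assms(3,4) by (simp add: m_def)
  moreover have "\<bar>integral {m..b + t} f - integral {m..s} f\<bar> \<le> B * \<bar>b + t - s\<bar>"
    by (rule lip) (use assms(3,4) in \<open>auto simp: m_def\<close>)
  moreover have "\<bar>integral {m..b} f - integral {m..0} f\<bar> \<le> B * \<bar>b - 0\<bar>"
    by (rule lip) (auto simp: m_def)
  moreover have "B * \<bar>b + t - s\<bar> \<le> B * (\<bar>t - s\<bar> + \<bar>b\<bar>)"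
    using B by (intro mult_left_mono) auto
  ultimately have "\<bar>integral {b..b + t} f - integral {0..s} f\<bar> \<le> B * (\<bar>t - s\<bar> + \<bar>b\<bar>) + B * \<bar>b - 0\<bar>"
    by (smt (verit, ccfv_threshold))
  also have "\<dots> = B * (\<bar>t - s\<bar> + 2 * \<bar>b\<bar>)"
    by (simp add: algebra_simps)
  finally show ?thesis .
qed

text \<open>For bounded \<open>h\<close>, an error of at most \<open>C\<close> in the time is
  negligible after division by \<open>t\<close>, and so is the choice of the starting time
  \<open>b\<close>. The times \<open>a n\<close> will be the successive roof times of an orbit, and
  in another use the integers.\<close>

lemma time_average_subsequence:
  fixes h :: "real \<Rightarrow> real"
  assumes h: "h \<in> borel_measurable borel" "\<And>x. \<bar>h x\<bar> \<le> B"
    and a_nonneg: "\<And>n. 0 \<le> a n"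
    and a_dense: "\<And>t. 0 \<le> t \<Longrightarrow> \<exists>n. \<bar>a n - t\<bar> \<le> C"
    and lim: "(\<lambda>n. integral {0..a n} h / a n) \<longlonglongrightarrow> L"
  shows "((\<lambda>t. 1 / t * integral {b..b + t} h) \<longlongrightarrow> L) at_top"
proof -
  have "\<forall>t. \<exists>n. 0 \<le> t \<longrightarrow> \<bar>a n - t\<bar> \<le> C" using a_dense by blast
  then obtain n where n: "\<And>t. 0 \<le> t \<Longrightarrow> \<bar>a (n t) - t\<bar> \<le> C" by metis
  have B: "0 \<le> B" using h(2)[of 0] by linarith
  have n_lim: "filterlim n sequentially at_top"
    unfolding filterlim_at_top
  proof
    fix m :: nat
    \<comment> \<open>Beyond \<open>t0\<close> the time \<open>t\<close> lies more than
      \<open>C\<close> above each of \<open>a 0, ..., a m\<close>, so the index \<open>n t\<close>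
      has to exceed \<open>m\<close>.\<close>
    define t0 where "t0 = Max (insert 0 (a ` {..m})) + C + 1"
    have "C \<ge> 0" using n[of 0] by linarith
    show "eventually (\<lambda>t. m \<le> n t) at_top"
      using eventually_ge_at_top[of "max 0 t0"]
    proof eventually_elim
      case (elim t)
      show ?case
      proof (rule ccontr)
        assume "\<not> m \<le> n t"
        then have "a (n t) \<le> Max (insert 0 (a ` {..m}))" by (intro Max_ge) auto
        with n[of t] elim show False unfolding t0_def by linarith
      qed
    qed
  qed
  have l1: "((\<lambda>t. integral {0..a (n t)} h / a (n t)) \<longlongrightarrow> L) at_top"
    using filterlim_compose[OF lim n_lim] by simp
  have l2: "((\<lambda>t. a (n t) / t) \<longlongrightarrow> 1) at_top"
  proof -
    have "((\<lambda>t. (a (n t) - t) / t) \<longlongrightarrow> 0) at_top"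
    proof (rule Lim_null_comparison)
      show "eventually (\<lambda>t. norm ((a (n t) - t) / t) \<le> C / t) at_top"
        using eventually_gt_at_top[of 0]
        by eventually_elim (use n in \<open>auto simp: divide_simps\<close>)
      show "((\<lambda>t. C / t) \<longlongrightarrow> 0) at_top"
        by (rule real_tendsto_divide_at_top[OF tendsto_const filterlim_ident])
    qed
    then have "((\<lambda>t. 1 + (a (n t) - t) / t) \<longlongrightarrow> 1 + 0) at_top"
      by (intro tendsto_add tendsto_const)
    moreover have "eventually (\<lambda>t. 1 + (a (n t) - t) / t = a (n t) / t) at_top"
      using eventually_gt_at_top[of 0] by eventually_elim (simp add: field_simps)
    ultimately show ?thesis
      by (simp add: tendsto_cong)
  qed
  have l3: "((\<lambda>t. (integral {b..b + t} h - integral {0..a (n t)} h) / t) \<longlongrightarrow> 0) at_top"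
  proof (rule Lim_null_comparison)
    show "eventually (\<lambda>t. norm ((integral {b..b + t} h - integral {0..a (n t)} h) / t)
        \<le> (B * (C + 2 * \<bar>b\<bar>)) / t) at_top"
      using eventually_gt_at_top[of 0]
    proof eventually_elim
      case (elim t)
      have "\<bar>integral {b..b + t} h - integral {0..a (n t)} h\<bar> \<le> B * (\<bar>t - a (n t)\<bar> + 2 * \<bar>b\<bar>)"
        using elim by (intro integral_from_0_diff h a_nonneg) auto
      also have "\<dots> \<le> B * (C + 2 * \<bar>b\<bar>)"
        using n[of t] elim B by (intro mult_left_mono) auto
      finally show ?case using elim by (simp add: divide_right_mono)
    qed
    show "((\<lambda>t. (B * (C + 2 * \<bar>b\<bar>)) / t) \<longlongrightarrow> 0) at_top"
      by (rule real_tendsto_divide_at_top[OF tendsto_const filterlim_ident])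
  qed
  have "((\<lambda>t. integral {0..a (n t)} h / a (n t) * (a (n t) / t)
      + (integral {b..b + t} h - integral {0..a (n t)} h) / t) \<longlongrightarrow> L) at_top"
    using tendsto_add[OF tendsto_mult[OF l1 l2] l3] by simp
  then show ?thesis
  proof (rule Lim_transform_eventually)
    show "eventually (\<lambda>t. integral {0..a (n t)} h / a (n t) * (a (n t) / t)
      + (integral {b..b + t} h - integral {0..a (n t)} h) / t = 1 / t * integral {b..b + t} h) at_top"
      using eventually_gt_at_top[of 0]
    proof eventually_elim
      case (elim t)
      then show ?case by (cases "a (n t) = 0") (auto simp: field_simps)
    qed
  qed
qed

text \<open>The lower bound on the roof drives the roof times to infinity; the upper bound keeps
  their gaps bounded.\<close>

locale suspension = ergodic_mpt +
  fixes R :: "'a \<Rightarrow> real" and R0 R1 :: real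
  assumes measurable_R [measurable]: "R \<in> borel_measurable M"
    and R0: "0 < R0" and R_ge: "\<And>x. R0 \<le> R x" and R_le: "\<And>x. R x \<le> R1"
begin

abbreviation mean_roof :: real where "mean_roof \<equiv> expectation R"

lemma R_pos: "0 < R x"
  using R0 R_ge[of x] by linarith

lemma abs_R_le: "\<bar>R x\<bar> \<le> R1"
  using R_pos[of x] R_le[of x] by linarith

lemma integrable_R: "integrable M R"
  by (rule integrable_const_bound[where B=R1]) (use abs_R_le in auto)

lemma mean_roof_pos: "0 < mean_roof"
proof -
  have "expectation (\<lambda>_. R0) \<le> mean_roof"
    by (intro integral_mono integrable_R) (auto simp: R_ge)
  then show ?thesis using R0 by (simp add: prob_space)
qed

lemma integral_roof_eq:
  fixes h :: "'a \<Rightarrow> real \<Rightarrow> real"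
  assumes h [measurable]: "case_prod h \<in> borel_measurable (M \<Otimes>\<^sub>M borel)"
    and x: "x \<in> space M" and bounded: "\<And>x \<tau>. \<bar>h x \<tau>\<bar> \<le> B"
  shows "integral {0..R x} (h x) = (\<integral>\<tau>. indicator {0..R x} \<tau> * h x \<tau> \<partial>lborel)"
proof (rule integrable_on_bounded_borel(2))
  show "h x \<in> borel_measurable borel"
    using measurable_compose[OF measurable_Pair1'[OF x] h] by simp
qed (rule bounded)

text \<open>A function along the flow is given as \<open>h x \<tau>\<close> for every real
  \<open>\<tau>\<close>, and \<open>equi\<close> is the gluing rule at the roof. Cutting an orbit at
  its roof times turns the time integral into a Birkhoff sum of the block integrals
  \<open>G\<close>, while the elapsed time is the Birkhoff sum of the roof. The limit is the
  quotient of the two Birkhoff limits.\<close>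

theorem time_average:
  fixes h :: "'a \<Rightarrow> real \<Rightarrow> real"
  assumes h [measurable]: "case_prod h \<in> borel_measurable (M \<Otimes>\<^sub>M borel)"
    and bounded: "\<And>x \<tau>. \<bar>h x \<tau>\<bar> \<le> B"
    and equi: "AE x in M. \<forall>\<tau>\<ge>0. h x (\<tau> + R x) = h (T x) \<tau>"
  shows "AE x in M. ((\<lambda>t. 1 / t * integral {b..b + t} (h x)) \<longlongrightarrow>
    (\<integral>x. integral {0..R x} (h x) \<partial>M) / mean_roof) at_top"
proof -
  define G where "G x = integral {0..R x} (h x)" for x
  have hm: "h x \<in> borel_measurable borel" if "x \<in> space M" for x
    using measurable_compose[OF measurable_Pair1'[OF that] h] by simp
  have hm2 [measurable (raw)]: "(\<lambda>y. h (f y) (g y)) \<in> borel_measurable N"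
    if "f \<in> N \<rightarrow>\<^sub>M M" "g \<in> borel_measurable N" for N :: "'b measure" and f g
    using measurable_compose[OF measurable_Pair[OF that] h] by simp
  have [measurable]: "(\<lambda>x. (\<integral>\<tau>. indicator {0..R x} \<tau> * h x \<tau> \<partial>lborel)) \<in> borel_measurable M"
    unfolding indicator_def atLeastAtMost_iff by measurable
  have G_meas: "G \<in> borel_measurable M"
    by (subst measurable_cong[where g="\<lambda>x. (\<integral>\<tau>. indicator {0..R x} \<tau> * h x \<tau> \<partial>lborel)"])
       (auto simp: G_def integral_roof_eq[OF h _ bounded])
  have "0 \<le> B" using bounded[of undefined undefined] by linarith
  \<comment> \<open>\<open>birkhoff\<close> asks for a bound on the whole type, but
    \<open>h x\<close> is known to be Borel only for \<open>x\<close> in the space; the indicator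
    removes all other points.\<close>
  have G_bd: "\<bar>G x * indicator (space M) x\<bar> \<le> B * R1" for x
  proof (cases "x \<in> space M")
    case True
    have "\<bar>G x\<bar> \<le> B * (R x - 0)"
      unfolding G_def using hm[OF True] bounded R_pos[of x] by (intro integral_bounded_le) auto
    also have "\<dots> \<le> B * R1" using R_le[of x] \<open>0 \<le> B\<close> by (intro mult_left_mono) auto
    finally show ?thesis using True by simp
  qed (use \<open>0 \<le> B\<close> abs_R_le[of undefined] in auto)
  have bG: "AE x in M. (\<lambda>n. birkhoff_sum (\<lambda>x. G x * indicator (space M) x) n x / n) \<longlonglongrightarrow>
      (\<integral>x. G x * indicator (space M) x \<partial>M)"
    by (rule birkhoff[OF _ G_bd]) (use G_meas in measurable)
  have bR: "AE x in M. (\<lambda>n. birkhoff_sum R n x / n) \<longlonglongrightarrow> mean_roof"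
    by (rule birkhoff[OF _ abs_R_le]) measurable
  have intG: "(\<integral>x. G x * indicator (space M) x \<partial>M) = (\<integral>x. G x \<partial>M)"
    by (rule Bochner_Integration.integral_cong) auto
  have sum_R_ge: "n * R0 \<le> birkhoff_sum R n x" for n x
    unfolding birkhoff_sum_def using sum_mono[of "{..<n}" "\<lambda>_. R0"] R_ge by fastforce
  have sums: "birkhoff_sum (\<lambda>x. G x * indicator (space M) x) n x = integral {0..birkhoff_sum R n x} (h x)"
    if "x \<in> space M" and "\<forall>n. \<forall>\<tau>\<ge>0. h ((T ^^ n) x) (\<tau> + R ((T ^^ n) x)) = h (T ((T ^^ n) x)) \<tau>" for n x
    using that
  proof (induction n arbitrary: x)
    case 0 then show ?case by (simp add: birkhoff_sum_def)
  next
    case (Suc n)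
    let ?S = "birkhoff_sum R n (T x)"
    have S: "0 \<le> ?S" using sum_R_ge[of n "T x"] R0 by (meson le_less less_le_trans mult_nonneg_nonneg of_nat_0_le_iff order_trans)
    have eq: "h x (\<tau> + R x) = h (T x) \<tau>" if "0 \<le> \<tau>" for \<tau>
      using Suc.prems(2)[THEN spec, of 0] that by simp
    have Tx: "T x \<in> space M" using Suc.prems(1) measurable_space[OF measurable_T] by blast
    have "birkhoff_sum (\<lambda>x. G x * indicator (space M) x) n (T x) = integral {0..?S} (h (T x))"
    proof (rule Suc.IH[OF Tx], intro allI impI)
      fix m \<tau> assume "0 \<le> (\<tau>::real)"
      then show "h ((T ^^ m) (T x)) (\<tau> + R ((T ^^ m) (T x))) = h (T ((T ^^ m) (T x))) \<tau>"
        using Suc.prems(2)[THEN spec, of "Suc m"] by (simp add: funpow_swap1)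
    qed
    also have "\<dots> = integral {0..?S} (\<lambda>\<tau>. h x (\<tau> + R x))"
      by (rule Henstock_Kurzweil_Integration.integral_cong) (simp add: eq)
    also have "\<dots> = integral {R x..R x + ?S} (h x)"
      by (subst integral_translate) (simp add: add.commute)
    finally have IH: "birkhoff_sum (\<lambda>x. G x * indicator (space M) x) n (T x) = integral {R x..R x + ?S} (h x)" .
    have "integral {0..R x + ?S} (h x) = integral {0..R x} (h x) + integral {R x..R x + ?S} (h x)"
      using R_pos[of x] S
      by (intro Henstock_Kurzweil_Integration.integral_combine[symmetric]
            integrable_on_bounded_borel(1)[OF hm[OF Suc.prems(1)] bounded]) auto
    then show ?case
      using Suc.prems(1) by (simp add: birkhoff_sum_Suc IH[unfolded G_def] G_def)
  qed
  show ?thesis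
    using bG bR AE_funpow[OF equi] AE_space
  proof eventually_elim
    case (elim x)
    let ?a = "\<lambda>n. birkhoff_sum R n x"
    show ?case
      unfolding G_def[symmetric]
    proof (rule time_average_subsequence[where a="?a" and C=R1])
      show "h x \<in> borel_measurable borel" using hm elim by simp
      show "0 \<le> ?a n" for n
        using sum_R_ge[of n x] R0 by (meson le_less less_le_trans mult_nonneg_nonneg of_nat_0_le_iff order_trans)
      show "\<exists>n. \<bar>?a n - t\<bar> \<le> R1" if "0 \<le> t" for t
      proof -
        obtain m :: nat where "t < m * R0" using R0 reals_Archimedean3 by blast
        with sum_R_ge[of m x] have "t < ?a m" by linarith
        \<comment> \<open>The first roof time beyond \<open>t\<close> overshoots it by at most one
          roof height.\<close>
        define n where "n = (LEAST n. t < ?a n)"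
        have n: "t < ?a n" unfolding n_def by (rule LeastI) fact
        have "n \<noteq> 0" using n that by (intro notI) (simp add: birkhoff_sum_def)
        then obtain l where l: "n = Suc l" using not0_implies_Suc by blast
        have "?a l \<le> t" using not_less_Least[of l "\<lambda>n. t < ?a n"] l unfolding n_def by linarith
        moreover have "?a (Suc l) = ?a l + R ((T ^^ l) x)" by (simp add: birkhoff_sum_def)
        ultimately show ?thesis using n l R_le[of "(T ^^ l) x"] by (intro exI[of _ n]) auto
      qed
      have "(\<lambda>n. (birkhoff_sum (\<lambda>x. G x * indicator (space M) x) n x / n) / (?a n / n)) \<longlonglongrightarrow> (\<integral>x. G x \<partial>M) / mean_roof"
        using mean_roof_pos elim(1,2) by (intro tendsto_divide) (auto simp: intG)
      then show "(\<lambda>n. integral {0..?a n} (h x) / ?a n) \<longlonglongrightarrow> (\<integral>x. G x \<partial>M) / mean_roof"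
      proof (rule Lim_transform_eventually, intro eventually_sequentiallyI[of 1])
        fix n :: nat assume "1 \<le> n"
        then show "(birkhoff_sum (\<lambda>x. G x * indicator (space M) x) n x / n) / (?a n / n) =
          integral {0..?a n} (h x) / ?a n"
          using sums elim(3,4) by simp
      qed
    qed (rule bounded)
  qed
qed

section \<open>Normalised area under the roof and its invariance under time translation\<close>

definition suspension_measure :: "('a \<times> real) measure" where
  "suspension_measure = density (M \<Otimes>\<^sub>M lborel) (\<lambda>(x, \<tau>). ennreal (indicator {0..<R x} \<tau> / mean_roof))"

lemma sets_suspension [measurable_cong]: "sets suspension_measure = sets (M \<Otimes>\<^sub>M borel)"
  unfolding suspension_measure_def sets_density by (intro sets_pair_measure_cong) auto

lemma measurable_roof_indicator [measurable]:
  "(\<lambda>(x, \<tau>). indicator {0..<R x} \<tau> :: real) \<in> borel_measurable (M \<Otimes>\<^sub>M borel)"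
  "(\<lambda>(x, \<tau>). indicator {0..<R x} \<tau> :: real) \<in> borel_measurable (M \<Otimes>\<^sub>M lborel)"
  unfolding indicator_def atLeastLessThan_iff by measurable

lemma nn_integral_suspension:
  assumes f: "case_prod f \<in> borel_measurable (M \<Otimes>\<^sub>M borel)"
  shows "(\<integral>\<^sup>+y. case_prod f y \<partial>suspension_measure)
    = (\<integral>\<^sup>+x. (\<integral>\<^sup>+\<tau>. f x \<tau> * indicator {0..<R x} \<tau> \<partial>lborel) \<partial>M) / ennreal mean_roof"
proof -
  have f' [measurable]: "(\<lambda>(x, \<tau>). f x \<tau>) \<in> borel_measurable (M \<Otimes>\<^sub>M lborel)"
    using f by (subst measurable_cong_sets[OF sets_pair_measure_cong[OF refl sets_lborel] refl])
  have ind [measurable]: "(\<lambda>(x, \<tau>). indicator {0..<R x} \<tau> :: ennreal) \<in> borel_measurable (M \<Otimes>\<^sub>M lborel)"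
    unfolding indicator_def atLeastLessThan_iff by measurable
  have "(\<integral>\<^sup>+y. case_prod f y \<partial>suspension_measure)
    = (\<integral>\<^sup>+y. (case y of (x, \<tau>) \<Rightarrow> ennreal (indicator {0..<R x} \<tau> / mean_roof)) * case_prod f y \<partial>(M \<Otimes>\<^sub>M lborel))"
    unfolding suspension_measure_def
    by (rule nn_integral_density) auto
  also have "\<dots> = (\<integral>\<^sup>+y. (case y of (x, \<tau>) \<Rightarrow> f x \<tau> * indicator {0..<R x} \<tau>) / ennreal mean_roof \<partial>(M \<Otimes>\<^sub>M lborel))"
    using mean_roof_pos
    by (intro nn_integral_cong)
       (auto simp: indicator_def ennreal_divide_times divide_ennreal[symmetric] divide_ennreal_def mult.commute split: prod.splits)
  also have "\<dots> = (\<integral>\<^sup>+y. (case y of (x, \<tau>) \<Rightarrow> f x \<tau> * indicator {0..<R x} \<tau>) \<partial>(M \<Otimes>\<^sub>M lborel)) / ennreal mean_roof"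
    using f' ind by (intro nn_integral_divide) (simp add: split_beta')
  also have "(\<integral>\<^sup>+y. (case y of (x, \<tau>) \<Rightarrow> f x \<tau> * indicator {0..<R x} \<tau>) \<partial>(M \<Otimes>\<^sub>M lborel))
    = (\<integral>\<^sup>+x. (\<integral>\<^sup>+\<tau>. f x \<tau> * indicator {0..<R x} \<tau> \<partial>lborel) \<partial>M)"
    using f' ind by (subst lborel.nn_integral_fst[symmetric]) (simp_all add: split_beta')
  finally show ?thesis .
qed

lemma nn_integral_roof: "(\<integral>\<^sup>+x. c * ennreal (R x) \<partial>M) = c * ennreal mean_roof"
  by (subst nn_integral_cmult)
     (use integrable_R R_pos in \<open>auto simp: nn_integral_eq_integral less_imp_le\<close>)

lemma prob_space_suspension: "prob_space suspension_measure"
proof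
  have "emeasure suspension_measure (space suspension_measure)
    = (\<integral>\<^sup>+y. (case y of (x, \<tau>) \<Rightarrow> 1) \<partial>suspension_measure)"
    by (simp add: split_beta')
  also have "\<dots> = (\<integral>\<^sup>+x. 1 * ennreal (R x) \<partial>M) / ennreal mean_roof"
    by (subst nn_integral_suspension) (use R_pos in \<open>auto simp: less_imp_le\<close>)
  also have "\<dots> = 1"
    using mean_roof_pos by (subst nn_integral_roof) (simp add: ennreal_divide_self)
  finally show "emeasure suspension_measure (space suspension_measure) = 1" .
qed

lemma AE_suspension:
  assumes "AE x in M. \<forall>\<tau>. P x \<tau>" and [measurable]: "Measurable.pred (M \<Otimes>\<^sub>M borel) (case_prod P)"
  shows "AE y in suspension_measure. case_prod P y"
proof -
  interpret pair_sigma_finite M lborel ..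
  have "AE y in M \<Otimes>\<^sub>M lborel. case_prod P y"
  proof (rule AE_pair_measure)
    show "{x \<in> space (M \<Otimes>\<^sub>M lborel). case x of (a, b) \<Rightarrow> P a b} \<in> sets (M \<Otimes>\<^sub>M lborel)"
      using assms(2) unfolding pred_def sets_pair_measure_cong[OF refl sets_lborel]
      by (simp add: space_pair_measure)
    show "AE x in M. AE y in lborel. case (x, y) of (a, b) \<Rightarrow> P a b"
      using assms(1) by eventually_elim auto
  qed
  then show ?thesis
    unfolding suspension_measure_def
    by (subst AE_density) (auto simp: split_beta' simp del: measurable_roof_indicator intro!: measurable_compose[OF measurable_roof_indicator(2)[unfolded split_beta']])
qed

lemma integral_suspension:
  fixes h :: "'a \<Rightarrow> real \<Rightarrow> real"
  assumes h: "case_prod h \<in> borel_measurable (M \<Otimes>\<^sub>M borel)" and bounded: "\<And>x \<tau>. \<bar>h x \<tau>\<bar> \<le> B"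
  shows "(\<integral>y. case_prod h y \<partial>suspension_measure) = (\<integral>x. integral {0..R x} (h x) \<partial>M) / mean_roof"
proof -
  have h' [measurable (raw)]: "(\<lambda>y. h (f y) (g y)) \<in> borel_measurable N"
    if "f \<in> N \<rightarrow>\<^sub>M M" "g \<in> borel_measurable N" for N :: "'b measure" and f g
    using measurable_compose[OF measurable_Pair[OF that] h] by simp
  have B: "0 \<le> B" using bounded[of undefined undefined] by linarith
  interpret S: prob_space suspension_measure by (rule prob_space_suspension)
  interpret pair_sigma_finite M lborel ..
  have hL [measurable]: "case_prod h \<in> borel_measurable (M \<Otimes>\<^sub>M lborel)"
    using h by (subst measurable_cong_sets[OF sets_pair_measure_cong[OF refl sets_lborel] refl])
  have wL [measurable]: "(\<lambda>(x, \<tau>). indicator {0..<R x} \<tau> / mean_roof) \<in> borel_measurable (M \<Otimes>\<^sub>M lborel)"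
    unfolding indicator_def atLeastLessThan_iff by measurable
  have dens: "suspension_measure = density (M \<Otimes>\<^sub>M lborel) (\<lambda>y. ennreal (case y of (x, \<tau>) \<Rightarrow> indicator {0..<R x} \<tau> / mean_roof))"
    by (simp add: suspension_measure_def split_beta')
  have nonneg: "AE y in M \<Otimes>\<^sub>M lborel. 0 \<le> (case y of (x, \<tau>) \<Rightarrow> indicator {0..<R x} \<tau> / mean_roof)"
    using mean_roof_pos by (auto split: prod.splits)
  have "integrable suspension_measure (case_prod h)"
    by (rule S.integrable_const_bound[where B=B]) (use bounded h in auto)
  then have int: "integrable (M \<Otimes>\<^sub>M lborel) (\<lambda>(x, \<tau>). indicator {0..<R x} \<tau> / mean_roof * h x \<tau>)"
    unfolding dens using integrable_density[OF hL wL nonneg] by (simp add: split_beta')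
  have "(\<integral>y. case_prod h y \<partial>suspension_measure)
      = (\<integral>y. (case y of (x, \<tau>) \<Rightarrow> indicator {0..<R x} \<tau> / mean_roof * h x \<tau>) \<partial>(M \<Otimes>\<^sub>M lborel))"
    unfolding dens using integral_density[OF hL wL nonneg] by (simp add: split_beta')
  also have "\<dots> = (\<integral>x. (\<integral>\<tau>. indicator {0..<R x} \<tau> / mean_roof * h x \<tau> \<partial>lborel) \<partial>M)"
    using integral_fst'[OF int] by simp
  also have "\<dots> = (\<integral>x. integral {0..R x} (h x) / mean_roof \<partial>M)"
  proof (rule Bochner_Integration.integral_cong[OF refl])
    fix x assume x: "x \<in> space M"
    have hx: "h x \<in> borel_measurable borel"
      using measurable_compose[OF measurable_Pair1'[OF x] h] by simp
    have "(\<integral>\<tau>. indicator {0..<R x} \<tau> / mean_roof * h x \<tau> \<partial>lborel)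
        = (\<integral>\<tau>. (indicator {0..R x} \<tau> * h x \<tau>) / mean_roof \<partial>lborel)"
    proof (rule integral_cong_AE)
      \<comment> \<open>The density lives on half-open intervals and the gauge integral on closed
        ones; they differ in a single null point.\<close>
      show "AE \<tau> in lborel. indicator {0..<R x} \<tau> / mean_roof * h x \<tau> = indicator {0..R x} \<tau> * h x \<tau> / mean_roof"
        using AE_lborel_singleton[of "R x"] by eventually_elim (auto simp: indicator_def)
    qed (use hx in measurable)
    also have "\<dots> = (\<integral>\<tau>. indicator {0..R x} \<tau> * h x \<tau> \<partial>lborel) / mean_roof"
      by simp
    also have "\<dots> = integral {0..R x} (h x) / mean_roof"
      by (simp only: integral_roof_eq[OF h x bounded])
    finally show "(\<integral>\<tau>. indicator {0..<R x} \<tau> / mean_roof * h x \<tau> \<partial>lborel) = integral {0..R x} (h x) / mean_roof" .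
  qed
  finally show ?thesis by simp
qed

text \<open>Cut the integral over \<open>{0..<R x + s}\<close> in two ways: after the initial piece
  of length \<open>s\<close>, or at the roof. By \<open>equi\<close> the piece beyond the roof is
  the initial piece of \<open>T x\<close>, which has the same mean as that of \<open>x\<close> since
  \<open>T\<close> preserves the measure. Cancelling it leaves the shifted and the unshifted
  integral.\<close>

lemma nn_integral_suspension_shift:
  fixes h :: "'a \<Rightarrow> real \<Rightarrow> ennreal"
  assumes h: "case_prod h \<in> borel_measurable (M \<Otimes>\<^sub>M borel)" and bounded: "\<And>x \<tau>. h x \<tau> \<le> 1"
    and equi: "AE x in M. \<forall>\<tau>\<ge>0. h x (\<tau> + R x) = h (T x) \<tau>"
    and s: "0 \<le> s"
  shows "(\<integral>\<^sup>+(x, \<tau>). h x (\<tau> + s) \<partial>suspension_measure) = (\<integral>\<^sup>+(x, \<tau>). h x \<tau> \<partial>suspension_measure)"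
proof -
  have h' [measurable (raw)]: "(\<lambda>y. h (f y) (g y)) \<in> borel_measurable N"
    if "f \<in> N \<rightarrow>\<^sub>M M" "g \<in> borel_measurable N" for N :: "'b measure" and f g
    using measurable_compose[OF measurable_Pair[OF that] h] by simp
  have hx [measurable]: "h x \<in> borel_measurable borel" if "x \<in> space M" for x
    using measurable_compose[OF measurable_Pair1'[OF that] h] by simp
  define J where "J x a b = (\<integral>\<^sup>+\<tau>. h x \<tau> * indicator {a..<b} \<tau> \<partial>lborel)" for x a b
  have J_meas [measurable]: "(\<lambda>x. J x (f x) (g x)) \<in> borel_measurable M"
    if [measurable]: "f \<in> borel_measurable M" "g \<in> borel_measurable M" for f g
    unfolding J_def indicator_def atLeastLessThan_iff by measurable
  have J_add: "J x a c = J x a b + J x b c" if "x \<in> space M" "a \<le> b" "b \<le> c" for x a b c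
    unfolding J_def using that hx[OF that(1)]
    by (subst nn_integral_add[symmetric])
       (auto intro!: nn_integral_cong simp: indicator_def split: if_splits)
  have J_shift: "(\<integral>\<^sup>+\<tau>. h x (\<tau> + c) * indicator {a..<b} \<tau> \<partial>lborel) = J x (a + c) (b + c)"
    if "x \<in> space M" for x a b c
    unfolding J_def using hx[OF that]
    by (subst nn_integral_real_affine[where c=1 and t=c])
       (auto intro!: nn_integral_cong simp: indicator_def add.commute)
  have J_le: "J x 0 s \<le> ennreal s" for x
  proof -
    have "J x 0 s \<le> (\<integral>\<^sup>+\<tau>. indicator {0..<s} \<tau> \<partial>lborel)"
      unfolding J_def using bounded by (intro nn_integral_mono) (auto simp: indicator_def)
    then show ?thesis using s by simp
  qed
  \<comment> \<open>Cancellation in \<open>ennreal\<close> is sound only for a finite common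
    term.\<close>
  have fin: "(\<integral>\<^sup>+x. J x 0 s \<partial>M) \<noteq> \<top>"
  proof -
    have "(\<integral>\<^sup>+x. J x 0 s \<partial>M) \<le> (\<integral>\<^sup>+x. ennreal s \<partial>M)"
      by (intro nn_integral_mono J_le)
    also have "\<dots> < \<top>" by (simp add: emeasure_space_1)
    finally show ?thesis by simp
  qed
  have "(\<integral>\<^sup>+x. J x 0 s \<partial>M) + (\<integral>\<^sup>+x. J x s (R x + s) \<partial>M) = (\<integral>\<^sup>+x. J x 0 (R x + s) \<partial>M)"
    using s R_pos by (subst nn_integral_add[symmetric]) (auto intro!: nn_integral_cong simp: J_add[of x 0 s "R x + s" for x] less_imp_le)
  also have "\<dots> = (\<integral>\<^sup>+x. J x 0 (R x) \<partial>M) + (\<integral>\<^sup>+x. J x (R x) (R x + s) \<partial>M)"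
    using s R_pos by (subst nn_integral_add[symmetric]) (auto intro!: nn_integral_cong simp: J_add[of x 0 "R x" "R x + s" for x] less_imp_le)
  also have "(\<integral>\<^sup>+x. J x (R x) (R x + s) \<partial>M) = (\<integral>\<^sup>+x. J (T x) 0 s \<partial>M)"
  proof (rule nn_integral_cong_AE)
    show "AE x in M. J x (R x) (R x + s) = J (T x) 0 s"
      using equi AE_space
    proof eventually_elim
      case (elim x)
      have "J x (R x) (R x + s) = (\<integral>\<^sup>+\<tau>. h x (\<tau> + R x) * indicator {0..<s} \<tau> \<partial>lborel)"
        using J_shift[of x "R x" 0 s] elim by (simp add: add.commute)
      also have "\<dots> = J (T x) 0 s"
        unfolding J_def using elim by (intro nn_integral_cong) (auto simp: indicator_def)
      finally show ?case .
    qed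
  qed
  also have "(\<integral>\<^sup>+x. J (T x) 0 s \<partial>M) = (\<integral>\<^sup>+x. J x 0 s \<partial>M)"
    by (rule nn_integral_T) measurable
  finally have eq: "(\<integral>\<^sup>+x. J x s (R x + s) \<partial>M) = (\<integral>\<^sup>+x. J x 0 (R x) \<partial>M)"
    using fin by (simp add: add.commute ennreal_add_left_cancel)
  have "(\<integral>\<^sup>+(x, \<tau>). h x (\<tau> + s) \<partial>suspension_measure) = (\<integral>\<^sup>+x. J x s (R x + s) \<partial>M) / ennreal mean_roof"
    by (subst nn_integral_suspension)
       (auto intro!: arg_cong2[where f="(/)"] nn_integral_cong simp: J_shift)
  also have "\<dots> = (\<integral>\<^sup>+(x, \<tau>). h x \<tau> \<partial>suspension_measure)"
    unfolding eq by (subst nn_integral_suspension[OF h]) (simp add: J_def)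
  finally show ?thesis .
qed

end

section \<open>Independent sequences\<close>

text \<open>The factors may vary with the place, so that one lemma serves both the iid letters and
  the digits over a fixed environment. Both sides are compared on cylinders.\<close>

lemma distr_case_nat_PiM:
  fixes M :: "nat \<Rightarrow> 'a measure"
  assumes M: "\<And>n. prob_space (M n)"
  shows "distr (M 0 \<Otimes>\<^sub>M PiM UNIV (\<lambda>n. M (Suc n))) (PiM UNIV M) (\<lambda>(a, w). case_nat a w) = PiM UNIV M"
    (is "distr ?P _ ?f = _")
proof (rule measure_eqI_PiM_infinite[symmetric, OF refl])
  interpret S: prob_space "PiM UNIV (\<lambda>n. M (Suc n))" by (intro prob_space_PiM M)
  interpret U: prob_space "PiM UNIV M" by (intro prob_space_PiM M)
  show "finite_measure (PiM UNIV M)" by (rule U.finite_measure_axioms)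
  have f: "?f \<in> ?P \<rightarrow>\<^sub>M PiM UNIV M"
  proof (rule measurable_PiM_single')
    show "(\<lambda>x. ?f x n) \<in> ?P \<rightarrow>\<^sub>M M n" for n
      by (cases n) (auto simp: split_beta')
    show "?f \<in> space ?P \<rightarrow> (\<Pi>\<^sub>E i\<in>UNIV. space (M i))"
      by (auto simp: space_pair_measure space_PiM PiE_iff split: nat.split)
  qed
  fix A and J :: "nat set" assume J: "finite J" and A: "\<And>j. j \<in> J \<Longrightarrow> A j \<in> sets (M j)"
  define X where "X = prod_emb UNIV M J (Pi\<^sub>E J A)"
  \<comment> \<open>A cylinder that leaves place 0 free puts no condition on the head.\<close>
  define A0 where "A0 = (if 0 \<in> J then A 0 else space (M 0))"
  define Y where "Y = prod_emb UNIV (\<lambda>n. M (Suc n)) (Suc -` J) (\<Pi>\<^sub>E j\<in>Suc -` J. A (Suc j))"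
  have sub: "\<And>j x. j \<in> J \<Longrightarrow> x \<in> A j \<Longrightarrow> x \<in> space (M j)"
    using A[THEN sets.sets_into_space] by blast
  have fin: "finite (Suc -` J)" using J by (intro finite_vimageI) auto
  have "?f -` X \<inter> space ?P = A0 \<times> Y"
    using sub unfolding X_def Y_def A0_def
    by (auto simp: space_pair_measure space_PiM PiE_iff prod_emb_def all_conj_distrib
        split: nat.split nat.split_asm)
  then have "emeasure (distr ?P (PiM UNIV M) ?f) X = emeasure ?P (A0 \<times> Y)"
    using J A by (subst emeasure_distr[OF f]) (auto simp: X_def intro!: sets_PiM_I)
  also have "\<dots> = emeasure (M 0) A0 * emeasure (PiM UNIV (\<lambda>n. M (Suc n))) Y"
    using J A fin by (intro S.emeasure_pair_measure_Times) (auto simp: A0_def Y_def intro!: sets_PiM_I)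
  also have "emeasure (PiM UNIV (\<lambda>n. M (Suc n))) Y = (\<Prod>j\<in>Suc -` J. emeasure (M (Suc j)) (A (Suc j)))"
    unfolding Y_def using A fin by (intro emeasure_PiM_emb M) auto
  also have "\<dots> = (\<Prod>j\<in>J - {0}. emeasure (M j) (A j))"
    by (rule prod.reindex_bij_witness[where i="\<lambda>j. j - 1" and j=Suc]) auto
  also have "emeasure (M 0) A0 * (\<Prod>j\<in>J - {0}. emeasure (M j) (A j)) = (\<Prod>j\<in>J. emeasure (M j) (A j))"
    using J by (auto simp: A0_def prod.remove prob_space.emeasure_space_1[OF M])
  also have "\<dots> = emeasure (PiM UNIV M) X"
    unfolding X_def using J A by (intro emeasure_PiM_emb[symmetric] M) auto
  finally show "emeasure (PiM UNIV M) (prod_emb UNIV M J (Pi\<^sub>E J A))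
      = emeasure (distr ?P (PiM UNIV M) ?f) (prod_emb UNIV M J (Pi\<^sub>E J A))"
    by (simp add: X_def)
qed simp_all

lemma measurable_case_nat_PiM:
  fixes M :: "nat \<Rightarrow> 'a measure"
  shows "(\<lambda>(a, w). case_nat a w) \<in> M 0 \<Otimes>\<^sub>M PiM UNIV (\<lambda>n. M (Suc n)) \<rightarrow>\<^sub>M PiM UNIV M"
proof (rule measurable_PiM_single')
  show "(\<lambda>x. (case x of (a, w) \<Rightarrow> case_nat a w) n) \<in> M 0 \<Otimes>\<^sub>M PiM UNIV (\<lambda>n. M (Suc n)) \<rightarrow>\<^sub>M M n" for n
    by (cases n) (auto simp: split_beta')
qed (auto simp: space_pair_measure space_PiM PiE_iff split: nat.split)

locale iid_sequence =
  fixes q :: "'a pmf"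
begin

abbreviation iid :: "(nat \<Rightarrow> 'a) measure" where
  "iid \<equiv> PiM UNIV (\<lambda>_::nat. measure_pmf q)"

sublocale iid: prob_space iid
  by (intro prob_space_PiM) (rule prob_space_measure_pmf)

lemma measurable_tail [measurable]: "(\<lambda>x n. x (Suc n)) \<in> iid \<rightarrow>\<^sub>M iid"
  by (rule measurable_PiM_single') (auto simp: space_PiM)

lemma measurable_coordinate:
  fixes f :: "'a \<Rightarrow> real"
  shows "(\<lambda>x. f (x n)) \<in> borel_measurable iid"
  by (rule measurable_compose[of "\<lambda>x. x n" _ "measure_pmf q"]) auto

lemma measurable_case_nat: "(\<lambda>(a, w). case_nat a w) \<in> measure_pmf q \<Otimes>\<^sub>M iid \<rightarrow>\<^sub>M iid"
  by (rule measurable_case_nat_PiM)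

lemma distr_case_nat: "distr (measure_pmf q \<Otimes>\<^sub>M iid) iid (\<lambda>(a, w). case_nat a w) = iid"
  by (rule distr_case_nat_PiM) (rule prob_space_measure_pmf)

lemma nn_integral_head_tail:
  assumes f: "case_prod f \<in> borel_measurable (measure_pmf q \<Otimes>\<^sub>M iid)"
  shows "(\<integral>\<^sup>+x. f (x 0) (\<lambda>n. x (Suc n)) \<partial>iid) = (\<integral>\<^sup>+a. (\<integral>\<^sup>+w. f a w \<partial>iid) \<partial>measure_pmf q)"
proof -
  have [measurable]: "(\<lambda>x. f (x 0) (\<lambda>n. x (Suc n))) \<in> borel_measurable iid"
    using measurable_compose[OF measurable_Pair[OF _ measurable_tail] f, of "\<lambda>x. x 0"] by simp
  have "(\<integral>\<^sup>+x. f (x 0) (\<lambda>n. x (Suc n)) \<partial>iid)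
      = (\<integral>\<^sup>+x. f (x 0) (\<lambda>n. x (Suc n)) \<partial>distr (measure_pmf q \<Otimes>\<^sub>M iid) iid (\<lambda>(a, w). case_nat a w))"
    by (simp only: distr_case_nat)
  also have "\<dots> = (\<integral>\<^sup>+y. case_prod f y \<partial>(measure_pmf q \<Otimes>\<^sub>M iid))"
    by (subst nn_integral_distr)
       (auto simp: split_beta' intro!: measurable_case_nat[unfolded split_beta'])
  also have "\<dots> = (\<integral>\<^sup>+a. (\<integral>\<^sup>+w. f a w \<partial>iid) \<partial>measure_pmf q)"
    using f by (subst iid.nn_integral_fst[symmetric]) auto
  finally show ?thesis .
qed

lemma integral_head_tail:
  fixes f :: "'a \<Rightarrow> real" and g :: "(nat \<Rightarrow> 'a) \<Rightarrow> real"
  assumes f: "\<And>a. \<bar>f a\<bar> \<le> C" and [measurable]: "g \<in> borel_measurable iid" and g: "\<And>x. \<bar>g x\<bar> \<le> B"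
  shows "(\<integral>x. f (x 0) * g (\<lambda>n. x (Suc n)) \<partial>iid) = (\<integral>a. f a \<partial>measure_pmf q) * (\<integral>x. g x \<partial>iid)"
proof -
  interpret P: pair_prob_space "measure_pmf q" iid ..
  have [measurable]: "f \<in> borel_measurable (measure_pmf q)" by simp
  note measurable_coordinate[of f 0, measurable]
  have "(\<integral>x. f (x 0) * g (\<lambda>n. x (Suc n)) \<partial>iid)
      = (\<integral>x. f (x 0) * g (\<lambda>n. x (Suc n)) \<partial>distr (measure_pmf q \<Otimes>\<^sub>M iid) iid (\<lambda>(a, w). case_nat a w))"
    by (simp only: distr_case_nat)
  also have "\<dots> = (\<integral>y. f (fst y) * g (snd y) \<partial>(measure_pmf q \<Otimes>\<^sub>M iid))"
    by (subst integral_distr)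
       (auto simp: split_beta' intro!: measurable_case_nat[unfolded split_beta'])
  also have "\<dots> = (\<integral>a. (\<integral>w. f a * g w \<partial>iid) \<partial>measure_pmf q)"
  proof (subst P.integral_fst'[symmetric])
    have "0 \<le> C" using f[of undefined] by linarith
    then have "\<bar>f a * g w\<bar> \<le> C * B" for a w
      unfolding abs_mult using f g by (intro mult_mono) auto
    moreover have "(\<lambda>y. f (fst y) * g (snd y)) \<in> borel_measurable (measure_pmf q \<Otimes>\<^sub>M iid)"
      by measurable
    ultimately show "integrable (measure_pmf q \<Otimes>\<^sub>M iid) (\<lambda>y. f (fst y) * g (snd y))"
      by (intro P.integrable_const_bound[where B="C * B"]) auto
  qed simp
  finally show ?thesis by simp
qed

text \<open>The first letter is independent of the tail. Replacing \<open>g x\<close> by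
  \<open>h (x 0)\<close> times \<open>g\<close> of the tail therefore splits the integral against a
  cylinder into a product, one factor being the integral of \<open>g\<close> against a cylinder one
  place shorter. The induction ends at the mean of \<open>g\<close>, which is zero.\<close>

lemma cocycle_zero:
  fixes g :: "(nat \<Rightarrow> 'a) \<Rightarrow> real" and h :: "'a \<Rightarrow> real"
  assumes g_meas [measurable]: "g \<in> borel_measurable iid" and g: "\<And>x. \<bar>g x\<bar> \<le> B" and h: "\<And>a. \<bar>h a\<bar> \<le> 1"
    and cocycle: "AE x in iid. g x = h (x 0) * g (\<lambda>n. x (Suc n))"
    and zero: "(\<integral>x. g x \<partial>iid) = 0"
  shows "AE x in iid. g x = 0"
proof -
  have B: "0 \<le> B" using g[of undefined] by linarith
  have cyl: "(\<integral>x. g x * (\<Prod>j<n. indicator (A j) (x j)) \<partial>iid) = 0" for n and A :: "nat \<Rightarrow> 'a set"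
  proof (induction n arbitrary: A)
    case 0 then show ?case by (simp add: zero)
  next
    case (Suc n)
    have [measurable]: "(\<lambda>x. indicator (A j) (x i) :: real) \<in> borel_measurable iid" for i j
      by (rule measurable_coordinate)
    note measurable_coordinate[of h 0, measurable]
    define k where "k x = g x * (\<Prod>j<n. indicator (A (Suc j)) (x j))" for x
    have [measurable]: "k \<in> borel_measurable iid" unfolding k_def by measurable
    have "\<bar>k x\<bar> \<le> B" for x
    proof -
      have "\<bar>k x\<bar> = \<bar>g x\<bar> * (\<Prod>j<n. indicator (A (Suc j)) (x j))"
        by (simp add: k_def abs_mult abs_prod)
      also have "\<dots> \<le> B * 1"
        using g B by (intro mult_mono prod_le_1 prod_nonneg) auto
      finally show ?thesis by simp
    qed
    moreover have "\<bar>h a * indicator (A 0) a\<bar> \<le> 1" for a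
      using h[of a] by (auto simp: indicator_def)
    ultimately have "(\<integral>x. h (x 0) * indicator (A 0) (x 0) * k (\<lambda>n. x (Suc n)) \<partial>iid)
        = (\<integral>a. h a * indicator (A 0) a \<partial>measure_pmf q) * (\<integral>x. k x \<partial>iid)"
      by (intro integral_head_tail) auto
    also have "\<dots> = 0" using Suc[of "\<lambda>j. A (Suc j)"] by (simp add: k_def)
    also have "(\<integral>x. h (x 0) * indicator (A 0) (x 0) * k (\<lambda>n. x (Suc n)) \<partial>iid)
        = (\<integral>x. g x * (\<Prod>j<Suc n. indicator (A j) (x j)) \<partial>iid)"
    proof (rule integral_cong_AE)
      show "AE x in iid. h (x 0) * indicator (A 0) (x 0) * k (\<lambda>n. x (Suc n))
          = g x * (\<Prod>j<Suc n. indicator (A j) (x j))"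
        using cocycle
      proof eventually_elim
        case (elim x)
        have "(\<Prod>j<Suc n. indicator (A j) (x j) :: real)
            = indicator (A 0) (x 0) * (\<Prod>j<n. indicator (A (Suc j)) (x (Suc j)))"
          by (rule prod.lessThan_Suc_shift)
        then show ?case by (subst elim) (simp add: k_def del: prod.lessThan_Suc)
      qed
      show "(\<lambda>x. h (x 0) * indicator (A 0) (x 0) * k (\<lambda>n. x (Suc n))) \<in> borel_measurable iid"
        by measurable
    qed measurable
    finally show ?case .
  qed
  \<comment> \<open>Adding \<open>B\<close> makes the density nonnegative, so orthogonality to
    cylinders becomes the equality of two finite measures on cylinders, and these determine the
    measures.\<close>
  have eq: "density iid (\<lambda>x. ennreal (g x + B)) = density iid (\<lambda>x. ennreal B)" (is "?D1 = ?D2")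
  proof (rule measure_eqI_PiM_infinite)
    show "sets ?D1 = sets iid" "sets ?D2 = sets iid" by auto
    show "finite_measure ?D1"
    proof (rule finite_measureI)
      have "g x + B \<le> 2 * B" for x using g[of x] by linarith
      then have "(\<integral>\<^sup>+x. ennreal (g x + B) \<partial>iid) \<le> (\<integral>\<^sup>+x. ennreal (2 * B) \<partial>iid)"
        by (intro nn_integral_mono ennreal_leI)
      also have "(\<integral>\<^sup>+x. ennreal (g x + B) \<partial>iid) = emeasure ?D1 (space ?D1)"
        by (subst emeasure_density) (auto intro!: nn_integral_cong)
      finally have "emeasure ?D1 (space ?D1) \<le> (\<integral>\<^sup>+x. ennreal (2 * B) \<partial>iid)" .
      then show "emeasure ?D1 (space ?D1) \<noteq> \<infinity>"
        by (simp add: iid.emeasure_space_1 top_unique) (metis ennreal_neq_top neq_top_trans)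
    qed
    fix A and J :: "nat set" assume J: "finite J"
    define X where "X = prod_emb UNIV (\<lambda>_. measure_pmf q) J (Pi\<^sub>E J A)"
    have X [measurable]: "X \<in> sets iid" unfolding X_def using J by (intro sets_PiM_I) auto
    obtain n where n: "J \<subseteq> {..<n}" using J finite_nat_iff_bounded by blast
    \<comment> \<open>\<open>cyl\<close> constrains every place below \<open>n\<close>; places
      outside \<open>J\<close> receive the full set.\<close>
    have ind: "indicator X x = (\<Prod>j<n. indicator (if j \<in> J then A j else UNIV) (x j) :: real)" for x
    proof (cases "x \<in> X")
      case True
      then have "\<forall>j<n. x j \<in> (if j \<in> J then A j else UNIV)"
        by (auto simp: X_def prod_emb_def PiE_iff)
      then show ?thesis using True by (simp add: prod.neutral)
    next
      case False
      then obtain j where "j \<in> J" "x j \<notin> A j" by (auto simp: X_def prod_emb_def PiE_iff)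
      then have "j \<in> {..<n}" "indicator (if j \<in> J then A j else UNIV) (x j) = (0::real)" using n by auto
      then have "(\<Prod>j<n. indicator (if j \<in> J then A j else UNIV) (x j) :: real) = 0"
        by (metis (no_types, lifting) finite_lessThan prod_zero)
      then show ?thesis using False by simp
    qed
    have int: "integrable iid (\<lambda>x. (g x + B) * indicator X x)"
      by (rule iid.integrable_const_bound[where B="2 * B"])
         (use g B in \<open>auto simp: indicator_def abs_mult intro!: AE_I2 split: if_splits\<close>, smt (verit))
    have int2: "integrable iid (\<lambda>x. B * indicator X x)" "integrable iid (\<lambda>x. g x * indicator X x)"
      by (rule iid.integrable_const_bound[where B=B]; use g B in \<open>auto simp: indicator_def\<close>)+
    have "emeasure ?D1 X = (\<integral>\<^sup>+x. ennreal ((g x + B) * indicator X x) \<partial>iid)"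
      by (auto simp: emeasure_density indicator_def intro!: nn_integral_cong)
    also have "\<dots> = ennreal (\<integral>x. (g x + B) * indicator X x \<partial>iid)"
      using g by (intro nn_integral_eq_integral int AE_I2) (auto simp: indicator_def abs_le_iff, smt (verit))
    also have "(\<integral>x. (g x + B) * indicator X x \<partial>iid) = (\<integral>x. g x * indicator X x \<partial>iid) + (\<integral>x. B * indicator X x \<partial>iid)"
      by (simp add: ring_distribs Bochner_Integration.integral_add[OF int2(2,1)])
    also have "(\<integral>x. g x * indicator X x \<partial>iid) = 0"
      unfolding ind by (rule cyl)
    also have "ennreal (0 + (\<integral>x. B * indicator X x \<partial>iid)) = (\<integral>\<^sup>+x. ennreal (B * indicator X x) \<partial>iid)"
      using B by (subst nn_integral_eq_integral[OF int2(1)]) auto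
    also have "\<dots> = emeasure ?D2 X"
      by (auto simp: emeasure_density indicator_def intro!: nn_integral_cong)
    finally show "emeasure ?D1 (prod_emb UNIV (\<lambda>_. measure_pmf q) J (Pi\<^sub>E J A))
      = emeasure ?D2 (prod_emb UNIV (\<lambda>_. measure_pmf q) J (Pi\<^sub>E J A))"
      by (simp add: X_def)
  qed
  have "AE x in iid. ennreal (g x + B) = ennreal B"
    using eq by (subst (asm) iid.density_unique_iff) auto
  then show ?thesis
  proof eventually_elim
    case (elim x)
    moreover have "0 \<le> g x + B" using g[of x] by linarith
    ultimately show ?case using B by (simp add: ennreal_inj)
  qed
qed

end

section \<open>The skew product of orientations\<close>

text \<open>Both laws are discrete, so the exchange goes through \<open>pair_pmf\<close> for
  arbitrary \<open>f\<close>, with no joint measurability to establish.\<close>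

lemma nn_integral_pmf_swap:
  "(\<integral>\<^sup>+x. (\<integral>\<^sup>+y. f x y \<partial>measure_pmf q) \<partial>measure_pmf p)
    = (\<integral>\<^sup>+y. (\<integral>\<^sup>+x. f x y \<partial>measure_pmf p) \<partial>measure_pmf q)"
proof -
  have "(\<integral>\<^sup>+x. (\<integral>\<^sup>+y. f x y \<partial>measure_pmf q) \<partial>measure_pmf p) = (\<integral>\<^sup>+(x, y). f x y \<partial>pair_pmf p q)"
    by (simp add: nn_integral_pair_pmf')
  also have "\<dots> = (\<integral>\<^sup>+(y, x). f x y \<partial>pair_pmf q p)"
    by (subst pair_commute_pmf) (simp add: split_beta')
  also have "\<dots> = (\<integral>\<^sup>+y. (\<integral>\<^sup>+x. f x y \<partial>measure_pmf p) \<partial>measure_pmf q)"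
    by (simp add: nn_integral_pair_pmf')
  finally show ?thesis .
qed

locale signed_iid = iid_sequence q for q :: "'a pmf" +
  fixes neg :: "'a \<Rightarrow> bool"
begin

definition neg_prob :: real where
  "neg_prob = measure (measure_pmf q) {a. neg a}"

text \<open>If negative symbols have probability zero, the orientation never changes, and only a point mass on the
  orientations gives an ergodic skew product.\<close>
definition sign_pmf :: "bool pmf" where
  "sign_pmf = (if neg_prob = 0 then return_pmf False else pmf_of_set UNIV)"

definition skew_measure :: "(bool \<times> (nat \<Rightarrow> 'a)) measure" where
  "skew_measure = measure_pmf sign_pmf \<Otimes>\<^sub>M iid"

text \<open>The disequality is an exclusive or: the bit counts, modulo 2, the negative letters
  shifted out so far. This is an extension of the Bernoulli shift by the group of order 2.\<close>

definition skew :: "bool \<times> (nat \<Rightarrow> 'a) \<Rightarrow> bool \<times> (nat \<Rightarrow> 'a)" where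
  "skew = (\<lambda>(b, x). (b \<noteq> neg (x 0), \<lambda>n. x (Suc n)))"

lemma sets_skew_measure [measurable_cong]: "sets skew_measure = sets (measure_pmf sign_pmf \<Otimes>\<^sub>M iid)"
  by (simp add: skew_measure_def)

sublocale skew: pair_prob_space "measure_pmf sign_pmf" iid ..

sublocale skew: prob_space skew_measure
  unfolding skew_measure_def by (rule skew.prob_space_axioms)

lemma measurable_neg [measurable]: "Measurable.pred iid (\<lambda>x. neg (x n))"
  by (rule measurable_compose[of "\<lambda>x. x n" _ "measure_pmf q"]) auto

lemma measurable_skew [measurable]: "skew \<in> skew_measure \<rightarrow>\<^sub>M skew_measure"
  unfolding skew_def skew_measure_def split_beta'
proof (rule measurable_Pair)
  have "(\<lambda>y. fst y \<noteq> neg (snd y 0)) \<in> measure_pmf sign_pmf \<Otimes>\<^sub>M iid \<rightarrow>\<^sub>M count_space UNIV"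
    by measurable
  then show "(\<lambda>y. fst y \<noteq> neg (snd y 0)) \<in> measure_pmf sign_pmf \<Otimes>\<^sub>M iid \<rightarrow>\<^sub>M measure_pmf sign_pmf"
    by (simp cong: measurable_cong_sets)
qed measurable

text \<open>The law of the bit is discrete, so a product null set has null sections at every bit of
  positive mass. This is how the results reach the particular bit \<open>False\<close>.\<close>

lemma AE_skew:
  assumes "AE y in skew_measure. P y" and "b \<in> set_pmf sign_pmf"
  shows "AE x in iid. P (b, x)"
proof -
  have "AE b in sign_pmf. AE x in iid. P (b, x)"
    using assms(1) unfolding skew_measure_def by (rule skew.AE_pair)
  then show ?thesis using assms(2) by (simp add: AE_measure_pmf_iff)
qed

lemma False_in_sign_pmf: "False \<in> set_pmf sign_pmf"
  by (simp add: sign_pmf_def)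

lemma AE_not_neg:
  assumes "neg_prob = 0"
  shows "AE x in iid. \<not> neg (x 0)"
proof -
  have "AE a in q. \<not> neg a"
    using assms by (simp add: neg_prob_def AE_measure_pmf_iff measure_pmf_zero_iff disjoint_iff)
  then show ?thesis
    by (intro AE_PiM_component[of UNIV "\<lambda>_. measure_pmf q" 0 "\<lambda>a. \<not> neg a", simplified]) (auto simp: prob_space_measure_pmf)
qed

text \<open>If negative letters have mass zero, no letter in the support flips the bit; otherwise
  the bit is uniform, and a flip permutes its two values.\<close>

lemma nn_integral_sign:
  assumes "a \<in> set_pmf q"
  shows "(\<integral>\<^sup>+b. f (b \<noteq> neg a) \<partial>measure_pmf sign_pmf) = (\<integral>\<^sup>+b. f b \<partial>measure_pmf sign_pmf)"
proof (cases "neg_prob = 0")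
  case True
  then have "\<not> neg a"
    using assms by (auto simp: neg_prob_def measure_pmf_zero_iff)
  then show ?thesis by simp
next
  case False
  have "bij (\<lambda>b. b \<noteq> neg a)" by (rule bijI) (auto simp: inj_def)
  then have "map_pmf (\<lambda>b. b \<noteq> neg a) sign_pmf = sign_pmf"
    using False by (simp add: sign_pmf_def map_pmf_of_set_inj bij_def)
  then show ?thesis
    by (metis nn_integral_map_pmf)
qed

text \<open>Splitting off the first letter leaves an independent tail with the same law. Once the
  sums over the bit and that letter are exchanged, each letter acts on the bit by a map preserving
  \<open>sign_pmf\<close>.\<close>

lemma distr_skew: "distr skew_measure skew_measure skew = skew_measure"
proof (rule measure_eqI)
  fix A assume "A \<in> sets (distr skew_measure skew_measure skew)"
  then have A: "A \<in> sets (measure_pmf sign_pmf \<Otimes>\<^sub>M iid)" by (simp add: sets_skew_measure)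
  have ind [measurable]: "(\<lambda>(b, x). indicator A (b, x) :: ennreal) \<in> borel_measurable (measure_pmf sign_pmf \<Otimes>\<^sub>M iid)"
    using A by simp
  have Ab [measurable]: "(\<lambda>x. indicator A (b, x) :: ennreal) \<in> borel_measurable iid" for b
    using measurable_compose[OF measurable_Pair1' ind, of b] by simp
  have "emeasure (distr skew_measure skew_measure skew) A = (\<integral>\<^sup>+y. indicator A (skew y) \<partial>skew_measure)"
    using A by (subst nn_integral_indicator[symmetric], simp add: sets_skew_measure, subst nn_integral_distr)
      (auto simp: sets_skew_measure)
  also have "\<dots> = (\<integral>\<^sup>+b. (\<integral>\<^sup>+x. indicator A (b \<noteq> neg (x 0), \<lambda>n. x (Suc n)) \<partial>iid) \<partial>measure_pmf sign_pmf)"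
    unfolding skew_measure_def
  proof (subst iid.nn_integral_fst[symmetric])
    show "(\<lambda>x. indicator A (skew x) :: ennreal) \<in> borel_measurable (measure_pmf sign_pmf \<Otimes>\<^sub>M iid)"
      using A measurable_skew unfolding skew_measure_def by measurable
  qed (simp add: skew_def)
  also have "\<dots> = (\<integral>\<^sup>+b. (\<integral>\<^sup>+a. (\<integral>\<^sup>+w. indicator A (b \<noteq> neg a, w) \<partial>iid) \<partial>measure_pmf q) \<partial>measure_pmf sign_pmf)"
  proof (rule nn_integral_cong)
    fix b
    have "(\<lambda>y. b \<noteq> neg (fst y)) \<in> measure_pmf q \<Otimes>\<^sub>M iid \<rightarrow>\<^sub>M measure_pmf sign_pmf"
      by (rule measurable_compose[OF measurable_fst]) simp
    then have "(\<lambda>y. (b \<noteq> neg (fst y), snd y)) \<in> measure_pmf q \<Otimes>\<^sub>M iid \<rightarrow>\<^sub>M measure_pmf sign_pmf \<Otimes>\<^sub>M iid"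
      by (rule measurable_Pair) (rule measurable_snd)
    then have "(\<lambda>y. indicator A (b \<noteq> neg (fst y), snd y) :: ennreal) \<in> borel_measurable (measure_pmf q \<Otimes>\<^sub>M iid)"
      by (rule measurable_compose) (use A in \<open>rule borel_measurable_indicator\<close>)
    then have "(\<lambda>(a, w). indicator A (b \<noteq> neg a, w) :: ennreal) \<in> borel_measurable (measure_pmf q \<Otimes>\<^sub>M iid)"
      unfolding split_beta' .
    then show "(\<integral>\<^sup>+x. indicator A (b \<noteq> neg (x 0), \<lambda>n. x (Suc n)) \<partial>iid)
      = (\<integral>\<^sup>+a. (\<integral>\<^sup>+w. indicator A (b \<noteq> neg a, w) \<partial>iid) \<partial>measure_pmf q)"
      by (rule nn_integral_head_tail[of "\<lambda>a w. indicator A (b \<noteq> neg a, w)"])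
  qed
  also have "\<dots> = (\<integral>\<^sup>+a. (\<integral>\<^sup>+b. (\<integral>\<^sup>+w. indicator A (b \<noteq> neg a, w) \<partial>iid) \<partial>measure_pmf sign_pmf) \<partial>measure_pmf q)"
    by (rule nn_integral_pmf_swap)
  also have "\<dots> = (\<integral>\<^sup>+a. (\<integral>\<^sup>+b. (\<integral>\<^sup>+w. indicator A (b, w) \<partial>iid) \<partial>measure_pmf sign_pmf) \<partial>measure_pmf q)"
    by (intro nn_integral_cong_AE AE_pmfI nn_integral_sign)
  also have "\<dots> = (\<integral>\<^sup>+b. (\<integral>\<^sup>+w. indicator A (b, w) \<partial>iid) \<partial>measure_pmf sign_pmf)"
    by (simp add: measure_pmf.emeasure_space_1)
  also have "\<dots> = emeasure skew_measure A"
    using ind A unfolding skew_measure_def by (subst iid.nn_integral_fst) (auto simp: split_beta')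
  finally show "emeasure (distr skew_measure skew_measure skew) A = emeasure skew_measure A" .
qed simp

lemma AE_skewI:
  assumes [measurable]: "Measurable.pred skew_measure P" and "\<And>b. b \<in> set_pmf sign_pmf \<Longrightarrow> AE x in iid. P (b, x)"
  shows "AE y in skew_measure. P y"
  unfolding skew_measure_def
proof (rule skew.AE_pair_measure)
  show "{x \<in> space (measure_pmf sign_pmf \<Otimes>\<^sub>M iid). P x} \<in> sets (measure_pmf sign_pmf \<Otimes>\<^sub>M iid)"
    using assms(1) unfolding skew_measure_def pred_def .
  show "AE b in sign_pmf. AE x in iid. P (b, x)"
    using assms(2) by (simp add: AE_measure_pmf_iff)
qed

lemma measurable_snd_skew: "snd \<in> skew_measure \<rightarrow>\<^sub>M iid"
  by (subst measurable_cong_sets[OF sets_skew_measure refl]) (rule measurable_snd)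

text \<open>\<open>P\<close> may fail to be measurable, so its exceptional set is first enlarged to
  a measurable null set.\<close>

lemma AE_skew_snd:
  assumes "AE x in iid. P x"
  shows "AE y in skew_measure. P (snd y)"
proof -
  obtain N where N: "N \<in> null_sets iid" "{x \<in> space iid. \<not> P x} \<subseteq> N"
    using assms by (auto elim: AE_E simp: null_sets_def)
  have "Measurable.pred iid (\<lambda>x. x \<notin> N)" using N(1) by auto
  then have "Measurable.pred skew_measure (\<lambda>y. snd y \<notin> N)"
    by (rule measurable_compose[OF measurable_snd_skew])
  moreover have "AE x in iid. snd (b, x) \<notin> N" for b :: bool
    using AE_not_in[OF N(1)] by simp
  ultimately have "AE y in skew_measure. snd y \<notin> N" by (rule AE_skewI)
  then show ?thesis
    by eventually_elim (use N(2) in \<open>auto simp: space_PiM\<close>)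
qed

text \<open>The indicators of the two fibres of \<open>A\<close> are split into their sum and their
  difference. The sum is shift-invariant, hence constant. The difference changes sign with each
  negative letter, so its mean equals \<open>1 - 2 * neg_prob\<close> times itself and vanishes
  unless \<open>neg_prob\<close> is 0. Both parts fall under \<open>cocycle_zero\<close>, so both
  fibres have the same constant indicator. If \<open>neg_prob\<close> is 0, only the fibre over
  \<open>False\<close> carries mass, and it is itself shift-invariant.\<close>

lemma skew_trivial:
  assumes A: "A \<in> sets skew_measure" and inv: "AE y in skew_measure. y \<in> A \<longleftrightarrow> skew y \<in> A"
  shows "(AE y in skew_measure. y \<in> A) \<or> (AE y in skew_measure. y \<notin> A)"
proof -
  define g where "g b x = (indicator A (b, x) :: real)" for b x
  have ind: "(\<lambda>(b, x). indicator A (b, x) :: real) \<in> borel_measurable (measure_pmf sign_pmf \<Otimes>\<^sub>M iid)"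
    using A by (simp add: sets_skew_measure)
  have g_meas [measurable]: "g b \<in> borel_measurable iid" for b
    unfolding g_def using measurable_compose[OF measurable_Pair1' ind, of b] by simp
  have g01: "0 \<le> g b x" "g b x \<le> 1" for b x by (auto simp: g_def)
  have g_int: "integrable iid (g b)" for b
    by (rule iid.integrable_const_bound[where B=1]) (use g01 in auto)
  have g_inv: "AE x in iid. g b x = g (b \<noteq> neg (x 0)) (\<lambda>n. x (Suc n))" if "b \<in> set_pmf sign_pmf" for b
    using AE_skew[OF inv that] by eventually_elim (auto simp: g_def skew_def indicator_def)
  have P: "Measurable.pred skew_measure (\<lambda>y. y \<in> A)" using A by simp
  \<comment> \<open>An indicator that is almost surely constant on all charged fibres decides
    \<open>A\<close>: value 0 gives the complement, and any other constant gives
    \<open>A\<close>.\<close>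
  have fin: "(AE y in skew_measure. y \<in> A) \<or> (AE y in skew_measure. y \<notin> A)"
    if c: "\<And>b. b \<in> set_pmf sign_pmf \<Longrightarrow> AE x in iid. g b x = c" for c
  proof (cases "c = 0")
    case True
    have "AE y in skew_measure. y \<notin> A"
      by (rule AE_skewI) (use P c True in \<open>auto simp: g_def indicator_def split: if_splits\<close>)
    then show ?thesis by simp
  next
    case False
    have "AE x in iid. (b, x) \<in> A" if "b \<in> set_pmf sign_pmf" for b
      using c[OF that] by eventually_elim (use False in \<open>auto simp: g_def indicator_def split: if_splits\<close>)
    then have "AE y in skew_measure. y \<in> A"
      by (rule AE_skewI[OF P])
    then show ?thesis by simp
  qed
  show ?thesis
  proof (cases "neg_prob = 0")
    case True
    then have sign: "set_pmf sign_pmf = {False}" by (simp add: sign_pmf_def)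
    define c where "c = (\<integral>x. g False x \<partial>iid)"
    have c: "0 \<le> c" "c \<le> 1"
      unfolding c_def using g01 by (auto intro!: integral_nonneg_AE iid.integral_le_const g_int)
    have "AE x in iid. g False x - c = 0"
    proof (rule cocycle_zero[where h="\<lambda>_. 1" and B=1])
      show "AE x in iid. g False x - c = 1 * (g False (\<lambda>n. x (Suc n)) - c)"
        using g_inv[of False] AE_not_neg[OF True] by (auto simp: sign)
      show "\<bar>g False x - c\<bar> \<le> 1" for x using g01[of False x] c by linarith
      show "(\<integral>x. g False x - c \<partial>iid) = 0"
        using g_int by (simp add: c_def iid.prob_space)
    qed auto
    then show ?thesis by (intro fin[of c]) (auto simp: sign)
  next
    case False
    then have sign: "set_pmf sign_pmf = UNIV" by (simp add: sign_pmf_def)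
    define c where "c = (\<integral>x. g True x + g False x \<partial>iid)"
    have c: "0 \<le> c" "c \<le> 2"
      unfolding c_def using g01
      by (auto intro!: integral_nonneg_AE iid.integral_le_const Bochner_Integration.integrable_add g_int AE_I2 add_nonneg_nonneg) (smt (verit))
    have "AE x in iid. g True x + g False x - c = 0"
    proof (rule cocycle_zero[where h="\<lambda>_. 1" and B=2])
      show "AE x in iid. g True x + g False x - c = 1 * (g True (\<lambda>n. x (Suc n)) + g False (\<lambda>n. x (Suc n)) - c)"
        using g_inv[of False, unfolded sign, OF UNIV_I] g_inv[of True, unfolded sign, OF UNIV_I]
      proof eventually_elim
        case (elim x)
        then show ?case by (cases "neg (x 0)") auto
      qed
      show "\<bar>g True x + g False x - c\<bar> \<le> 2" for x using g01[of _ x] c by (smt (verit))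
      show "(\<integral>x. g True x + g False x - c \<partial>iid) = 0"
        using g_int by (simp add: c_def iid.prob_space)
    qed auto
    moreover have "AE x in iid. g True x - g False x = 0"
    proof (rule cocycle_zero[where h="\<lambda>a. if neg a then -1 else 1" and B=1])
      have eq: "AE x in iid. g True x - g False x
          = (if neg (x 0) then -1 else 1) * (g True (\<lambda>n. x (Suc n)) - g False (\<lambda>n. x (Suc n)))"
        using g_inv[of False] g_inv[of True] unfolding sign
        by (auto elim!: eventually_elim2)
      then show "AE x in iid. g True x - g False x
          = (if neg (x 0) then -1 else 1) * (g True (\<lambda>n. x (Suc n)) - g False (\<lambda>n. x (Suc n)))" .
      show bd: "\<bar>g True x - g False x\<bar> \<le> 1" for x using g01[of _ x] by (smt (verit))
      have "(\<integral>a. (if neg a then -1 else 1 :: real) \<partial>measure_pmf q) = (\<integral>a. 1 - 2 * indicator {a. neg a} a \<partial>measure_pmf q)"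
        by (intro Bochner_Integration.integral_cong) auto
      also have "\<dots> = 1 - 2 * neg_prob"
        by (subst Bochner_Integration.integral_diff) (auto simp: neg_prob_def intro!: measure_pmf.integrable_const_bound[where B=1])
      finally have mean: "(\<integral>a. (if neg a then -1 else 1 :: real) \<partial>measure_pmf q) = 1 - 2 * neg_prob" .
      \<comment> \<open>Integrating the cocycle identity and using independence of the first letter
        gives a linear equation for the mean, with factor different from 1 as
        \<open>neg_prob\<close> is not 0.\<close>
      have "(\<integral>x. g True x - g False x \<partial>iid) = (\<integral>x. (if neg (x 0) then -1 else 1)
          * (g True (\<lambda>n. x (Suc n)) - g False (\<lambda>n. x (Suc n))) \<partial>iid)"
        using eq by (intro integral_cong_AE) auto
      also have "\<dots> = (1 - 2 * neg_prob) * (\<integral>x. g True x - g False x \<partial>iid)"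
        by (subst integral_head_tail[where f="\<lambda>a. if neg a then -1 else 1" and C=1 and B=1 and g="\<lambda>x. g True x - g False x"])
          (use bd in \<open>auto simp: mean\<close>)
      finally show "(\<integral>x. g True x - g False x \<partial>iid) = 0"
        using False by (simp add: algebra_simps)
    qed auto
    ultimately have "AE x in iid. g b x = c / 2" for b
      by eventually_elim (cases b; simp)
    then show ?thesis by (rule fin)
  qed
qed

sublocale skew: ergodic_mpt skew_measure skew
proof
  show "distr skew_measure skew_measure skew = skew_measure" by (rule distr_skew)
  show "skew.prob A = 0 \<or> skew.prob A = 1"
    if "A \<in> sets skew_measure" "AE y in skew_measure. y \<in> A \<longleftrightarrow> skew y \<in> A" for A
    using skew_trivial[OF that] that(1) skew.prob_eq_1 skew.prob_eq_0 by blast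
qed measurable

end

section \<open>The weak topology through moments\<close>

lemma space_Kbox [simp]: "space Kbox = {-1..1}"
  by (simp add: Kbox_def space_restrict_space)

lemma PK_iff: "\<nu> \<in> PK \<longleftrightarrow> prob_space \<nu> \<and> sets \<nu> = sets Kbox"
  by (auto simp: PK_def space_prob_algebra)

lemma PK_D:
  assumes "\<nu> \<in> PK"
  shows "prob_space \<nu>" "sets \<nu> = sets Kbox" "space \<nu> = {-1..1}"
  using assms sets_eq_imp_space_eq[of \<nu> Kbox] by (auto simp: PK_iff)

lemma topspace_weak_top: "topspace weak_top = PK"
proof
  show "topspace weak_top \<subseteq> PK"
    by (auto simp: weak_top_def topology_generated_by_topspace)
  have "PK = {N \<in> PK. (\<integral>y. 0 \<partial>N) \<in> (UNIV::real set)}" by auto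
  then show "PK \<subseteq> topspace weak_top"
    unfolding weak_top_def topology_generated_by_topspace
    by (intro Union_upper) (auto intro!: exI[of _ "\<lambda>_. 0"] exI[of _ UNIV])
qed

lemma continuous_on_measurable_Kbox:
  fixes g :: "real \<Rightarrow> real"
  assumes "continuous_on {-1..1} g"
  shows "g \<in> borel_measurable Kbox"
  unfolding Kbox_def by (rule borel_measurable_continuous_on_restrict[OF assms])

lemma PK_integral_diff_le:
  fixes f g :: "real \<Rightarrow> real"
  assumes \<nu>: "\<nu> \<in> PK" and f: "continuous_on {-1..1} f" and g: "continuous_on {-1..1} g"
    and e: "\<And>y. y \<in> {-1..1} \<Longrightarrow> \<bar>f y - g y\<bar> \<le> e"
  shows "\<bar>(\<integral>y. f y \<partial>\<nu>) - (\<integral>y. g y \<partial>\<nu>)\<bar> \<le> e"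
proof -
  interpret prob_space \<nu> by (rule PK_D[OF \<nu>])
  note PK_D(2)[OF \<nu>, measurable_cong] and sp = PK_D(3)[OF \<nu>]
  have int: "integrable \<nu> h" if h: "continuous_on {-1..1} h" for h :: "real \<Rightarrow> real"
  proof -
    have "compact (h ` {-1..1})" by (intro compact_continuous_image h) auto
    then obtain B where "\<And>y. y \<in> {-1..1} \<Longrightarrow> norm (h y) \<le> B"
      by (meson bounded_iff compact_imp_bounded imageI)
    then show ?thesis
      using continuous_on_measurable_Kbox[OF h]
      by (intro integrable_const_bound[where B=B]) (auto simp: sp)
  qed
  have "\<bar>(\<integral>y. f y \<partial>\<nu>) - (\<integral>y. g y \<partial>\<nu>)\<bar> = \<bar>\<integral>y. f y - g y \<partial>\<nu>\<bar>"
    by (simp add: int f g)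
  also have "\<dots> \<le> (\<integral>y. \<bar>f y - g y\<bar> \<partial>\<nu>)" by (rule integral_abs_bound)
  also have "\<dots> \<le> (\<integral>y. e \<partial>\<nu>)"
    using e by (intro integral_mono_AE) (auto simp: int f g sp)
  finally show ?thesis by (simp add: prob_space)
qed

lemma continuous_on_coordinate: "continuous_on S (\<lambda>x :: 'a \<Rightarrow> 'b::topological_space. x i)"
  by (rule continuous_on_subset[OF continuous_on_product_coordinates subset_UNIV])

definition moments :: "real measure \<Rightarrow> nat \<Rightarrow> real" where
  "moments \<nu> n = (\<integral>y. y ^ n \<partial>\<nu>)"

lemma PK_integral_polynomial:
  assumes \<nu>: "\<nu> \<in> PK"
  shows "(\<integral>y. (\<Sum>i\<le>n. a i * y ^ i) \<partial>\<nu>) = (\<Sum>i\<le>n. a i * moments \<nu> i)"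
proof -
  interpret prob_space \<nu> by (rule PK_D[OF \<nu>])
  note PK_D(2)[OF \<nu>, measurable_cong] and sp = PK_D(3)[OF \<nu>]
  have "(\<lambda>y. y ^ i) \<in> borel_measurable Kbox" for i
    by (intro continuous_on_measurable_Kbox continuous_intros)
  then have "integrable \<nu> (\<lambda>y. y ^ i)" for i
    by (intro integrable_const_bound[where B=1]) (auto simp: sp power_abs abs_le_iff intro!: power_le_one)
  then show ?thesis by (simp add: moments_def)
qed

lemma abs_moments_le:
  assumes "\<nu> \<in> PK"
  shows "\<bar>moments \<nu> n\<bar> \<le> 1"
proof -
  have "\<bar>(\<integral>y. y ^ n \<partial>\<nu>) - (\<integral>y. 0 \<partial>\<nu>)\<bar> \<le> 1"
    by (rule PK_integral_diff_le[OF assms])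
       (auto intro!: continuous_intros simp: power_abs abs_le_iff power_le_one)
  then show ?thesis by (simp add: moments_def)
qed

text \<open>A Weierstrass polynomial for \<open>g\<close> works for all measures at once: its
  coefficients depend on \<open>g\<close> and \<open>e\<close> only, and the error passes to
  integrals because the masses are 1.\<close>

lemma PK_moments_approx:
  fixes g :: "real \<Rightarrow> real"
  assumes g: "continuous_on {-1..1} g" and e: "0 < e"
  obtains a :: "nat \<Rightarrow> real" and n where "\<And>\<nu>. \<nu> \<in> PK \<Longrightarrow> \<bar>(\<integral>y. g y \<partial>\<nu>) - (\<Sum>i\<le>n. a i * moments \<nu> i)\<bar> \<le> e"
proof -
  obtain p where "real_polynomial_function p" and p: "\<And>y. y \<in> {-1..1} \<Longrightarrow> \<bar>g y - p y\<bar> < e"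
    using Stone_Weierstrass_real_polynomial_function[of "{-1..1::real}" g e] g e by auto
  then obtain a n where a: "p = (\<lambda>y. \<Sum>i\<le>n. a i * y ^ i)"
    using real_polynomial_function_iff_sum by blast
  show ?thesis
  proof
    fix \<nu> assume \<nu>: "\<nu> \<in> PK"
    have "\<bar>(\<integral>y. g y \<partial>\<nu>) - (\<integral>y. p y \<partial>\<nu>)\<bar> \<le> e"
      using p by (intro PK_integral_diff_le[OF \<nu> g]) (auto simp: a intro!: continuous_intros less_imp_le)
    then show "\<bar>(\<integral>y. g y \<partial>\<nu>) - (\<Sum>i\<le>n. a i * moments \<nu> i)\<bar> \<le> e"
      by (simp add: a PK_integral_polynomial[OF \<nu>])
  qed
qed

text \<open>Equal moments give equal integrals of all continuous functions, so the two measures lie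
  in the same weakly open sets. If \<open>f\<close> told them apart, the preimage of the complement
  of one value would be an open set separating them.\<close>

lemma moments_determine_weak_limits:
  assumes \<nu>: "\<nu> \<in> PK" "\<nu>' \<in> PK" and eq: "moments \<nu> = moments \<nu>'"
    and f: "continuous_map weak_top euclideanreal f"
  shows "f \<nu> = f \<nu>'"
proof -
  have int: "(\<integral>y. g y \<partial>\<nu>) = (\<integral>y. g y \<partial>\<nu>')" if g: "continuous_on {-1..1} g" for g :: "real \<Rightarrow> real"
  proof (rule ccontr)
    assume "\<not> ?thesis"
    then have d: "0 < \<bar>(\<integral>y. g y \<partial>\<nu>) - (\<integral>y. g y \<partial>\<nu>')\<bar> / 3" by simp
    from PK_moments_approx[OF g d] obtain a n where
      a: "\<And>\<mu>. \<mu> \<in> PK \<Longrightarrow> \<bar>(\<integral>y. g y \<partial>\<mu>) - (\<Sum>i\<le>n. a i * moments \<mu> i)\<bar> \<le> \<bar>(\<integral>y. g y \<partial>\<nu>) - (\<integral>y. g y \<partial>\<nu>')\<bar> / 3"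
      by blast
    have False if "\<bar>A - S\<bar> \<le> d" "\<bar>B - S\<bar> \<le> d" "0 < d" "d = \<bar>A - B\<bar> / 3" for A B S d :: real
    proof -
      have "\<bar>A - B\<bar> \<le> 2 * d" using that(1,2) by linarith
      with that(3,4) show False by simp
    qed
    from this[OF a[OF \<nu>(1), unfolded eq] a[OF \<nu>(2)] d refl] show False .
  qed
  have "\<nu> \<in> U \<longleftrightarrow> \<nu>' \<in> U" if "openin weak_top U" for U
    using that unfolding weak_top_def openin_topology_generated_by_iff
    by (induction rule: generate_topology_on.induct) (use \<nu> int in auto)
  moreover have "openin weak_top {\<mu> \<in> topspace weak_top. f \<mu> \<in> - {f \<nu>}}"
    by (rule openin_continuous_map_preimage[OF f iffD1[OF open_openin open_Compl[OF closed_singleton]]])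
  ultimately show ?thesis
    using \<nu> by (force simp: topspace_weak_top)
qed

text \<open>Retraction of the line onto \<open>[-1,1]\<close>. It makes push-forwards to
  \<open>Kbox\<close> meaningful for every measure on the line.\<close>

definition clamp1 :: "real \<Rightarrow> real" where
  "clamp1 y = max (-1) (min 1 y)"

lemma clamp1_in: "clamp1 y \<in> {-1..1}" "\<bar>clamp1 y\<bar> \<le> 1"
  by (auto simp: clamp1_def)

lemma clamp1_id: "y \<in> {-1..1} \<Longrightarrow> clamp1 y = y"
  by (auto simp: clamp1_def)

lemma measurable_clamp1 [measurable]: "clamp1 \<in> borel \<rightarrow>\<^sub>M Kbox"
  unfolding Kbox_def by (intro measurable_restrict_space2) (auto simp: clamp1_in(1) simp del: atLeastAtMost_iff, simp add: clamp1_def[abs_def])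

lemma measurable_id_Kbox [measurable]: "(\<lambda>y. y) \<in> Kbox \<rightarrow>\<^sub>M borel"
  unfolding Kbox_def by (simp add: measurable_restrict_space1)

lemma isCont_clamp1: "isCont (\<lambda>y. clamp1 y ^ n) y"
  unfolding clamp1_def by (intro continuous_intros)

text \<open>A sequence in \<open>PK\<close>, moved to the line, is tight and has a weakly convergent
  subsequence. The powers \<open>y ^ i\<close> are unbounded on the line, but on
  \<open>[-1,1]\<close> they agree with the bounded continuous functions
  \<open>clamp1 y ^ i\<close>. Moments thus converge one by one, which is convergence in the product
  topology.\<close>

lemma compact_moments: "compact (moments ` PK)"
  unfolding compact_eq_seq_compact_metric seq_compact_def
proof (intro allI impI)
  fix \<kappa> :: "nat \<Rightarrow> nat \<Rightarrow> real" assume "\<forall>n. \<kappa> n \<in> moments ` PK"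
  then have "\<forall>n. \<exists>\<nu>. \<nu> \<in> PK \<and> \<kappa> n = moments \<nu>" by blast
  then obtain \<nu> where \<nu>: "\<And>n. \<nu> n \<in> PK" "\<And>n. \<kappa> n = moments (\<nu> n)" by metis
  define \<mu> where "\<mu> n = distr (\<nu> n) borel (\<lambda>y. y)" for n
  note prob = PK_D(1)[OF \<nu>(1)] and PK_D(2)[OF \<nu>(1), measurable_cong] and sp = PK_D(3)[OF \<nu>(1)]
  have rd: "real_distribution (\<mu> n)" for n
    unfolding \<mu>_def by (intro prob_space.real_distribution_distr prob) measurable
  have "tight \<mu>"
    unfolding tight_def
  proof (intro conjI allI impI)
    fix e :: real assume e: "0 < e"
    \<comment> \<open>Tightness uses intervals open on the left; with left end -1 an atom there
      would be lost.\<close>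
    have "measure (\<mu> n) {-2<..2} = 1" for n
    proof -
      interpret prob_space "\<nu> n" by (rule prob)
      have "{-2<..2} \<inter> {-1..1::real} = space (\<nu> n)" by (auto simp: sp)
      then show ?thesis
        unfolding \<mu>_def by (subst measure_distr) (use prob_space in \<open>auto simp: sp\<close>)
    qed
    with e show "\<exists>a b. a < b \<and> (\<forall>n. 1 - e < measure (\<mu> n) {a<..b})"
      by (intro exI[of _ "-2"] exI[of _ 2]) auto
  qed (rule rd)
  then obtain s M where s: "strict_mono (s :: nat \<Rightarrow> nat)" and M: "real_distribution M"
    and conv: "weak_conv_m (\<mu> \<circ> id \<circ> s) M"
    using tight_imp_convergent_subsubsequence[of \<mu> id] by (auto simp: strict_mono_id id_def strict_mono_def)
  interpret M: real_distribution M by (rule M)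
  have [measurable]: "clamp1 \<in> M \<rightarrow>\<^sub>M Kbox"
    by (subst measurable_cong_sets[OF M.events_eq_borel refl]) (rule measurable_clamp1)
  \<comment> \<open>Clamping puts the limit into \<open>PK\<close> directly, and its moments are
    exactly the limits of the integrals of \<open>clamp1 y ^ i\<close>.\<close>
  define \<nu>' where "\<nu>' = distr M Kbox clamp1"
  have \<nu>': "\<nu>' \<in> PK"
    unfolding PK_iff \<nu>'_def
    by (auto intro!: M.prob_space_distr)
  have mom: "(\<lambda>n. moments (\<nu> (s n)) i) \<longlonglongrightarrow> moments \<nu>' i" for i
  proof -
    have "(\<lambda>n. \<integral>y. clamp1 y ^ i \<partial>((\<mu> \<circ> s) n)) \<longlonglongrightarrow> (\<integral>y. clamp1 y ^ i \<partial>M)"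
    proof (rule weak_conv_imp_integral_bdd_continuous_conv)
      show "isCont (\<lambda>y. clamp1 y ^ i) x" for x by (rule isCont_clamp1)
      show "norm (clamp1 x ^ i) \<le> 1" for x
        using clamp1_in[of x] by (simp add: power_abs power_le_one)
    qed (use rd M conv in \<open>auto simp: o_def\<close>)
    moreover have "(\<integral>y. clamp1 y ^ i \<partial>((\<mu> \<circ> s) n)) = moments (\<nu> (s n)) i" for n
    proof -
      have "(\<integral>y. clamp1 y ^ i \<partial>((\<mu> \<circ> s) n)) = (\<integral>y. clamp1 y ^ i \<partial>\<nu> (s n))"
        unfolding \<mu>_def o_def by (subst integral_distr) (auto intro!: borel_measurable_continuous_onI continuous_at_imp_continuous_on isCont_clamp1)
      also have "\<dots> = moments (\<nu> (s n)) i"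
        unfolding moments_def by (intro Bochner_Integration.integral_cong) (auto simp: sp clamp1_id)
      finally show ?thesis .
    qed
    moreover have "(\<integral>y. clamp1 y ^ i \<partial>M) = moments \<nu>' i"
      unfolding moments_def \<nu>'_def
      using continuous_on_measurable_Kbox[of "\<lambda>y. y ^ i"]
      by (subst integral_distr) (auto intro!: continuous_intros)
    ultimately show ?thesis by simp
  qed
  have "(\<kappa> \<circ> s) \<longlonglongrightarrow> moments \<nu>'"
    using mom limitin_componentwise[of "\<lambda>_. euclideanreal" UNIV "\<kappa> \<circ> s" "moments \<nu>'" sequentially]
    by (simp add: euclidean_product_topology \<nu>(2) o_def)
  with s \<nu>' show "\<exists>l\<in>moments ` PK. \<exists>r. strict_mono r \<and> (\<kappa> \<circ> r) \<longlonglongrightarrow> l" by blast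
qed

text \<open>Products are built into the monomials and the closure rules are linear only. Convergence
  of time averages survives sums and scalar multiples but not products, so an induction over this
  set needs convergence for monomials alone.\<close>

inductive_set moment_algebra :: "((nat \<Rightarrow> real) \<Rightarrow> real) set" where
  monomial: "(\<lambda>\<kappa>. prod_list (map \<kappa> l)) \<in> moment_algebra"
| scale: "F \<in> moment_algebra \<Longrightarrow> (\<lambda>\<kappa>. c * F \<kappa>) \<in> moment_algebra"
| add: "F \<in> moment_algebra \<Longrightarrow> G \<in> moment_algebra \<Longrightarrow> (\<lambda>\<kappa>. F \<kappa> + G \<kappa>) \<in> moment_algebra"

lemma moment_algebra_const: "(\<lambda>\<kappa>. c) \<in> moment_algebra"
  using moment_algebra.scale[OF moment_algebra.monomial[of "[]"], of c] by simp

lemma moment_algebra_coordinate: "(\<lambda>\<kappa>. \<kappa> n) \<in> moment_algebra"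
  using moment_algebra.monomial[of "[n]"] by simp

lemma moment_algebra_mult:
  assumes "F \<in> moment_algebra" "G \<in> moment_algebra"
  shows "(\<lambda>\<kappa>. F \<kappa> * G \<kappa>) \<in> moment_algebra"
  using assms(1)
proof induction
  case (monomial l)
  show ?case using assms(2)
  proof induction
    case (monomial m)
    show ?case using moment_algebra.monomial[of "l @ m"] by simp
  next
    case (scale G c)
    from moment_algebra.scale[OF this(2), of c] show ?case by (simp add: ac_simps)
  next
    case (add G H)
    from moment_algebra.add[OF this(3,4)] show ?case by (simp add: ring_distribs)
  qed
next
  case (scale F c)
  from moment_algebra.scale[OF this(2), of c] show ?case by (simp add: ac_simps)
next
  case (add F H)
  from moment_algebra.add[OF this(3,4)] show ?case by (simp add: ring_distribs)
qed

lemma continuous_on_moment_algebra: "F \<in> moment_algebra \<Longrightarrow> continuous_on S F"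
proof (induction rule: moment_algebra.induct)
  case (monomial l)
  show ?case
    by (induction l) (auto intro!: continuous_intros continuous_on_coordinate)
qed (auto intro!: continuous_intros)

text \<open>Moment sequences form a compact set on which the coordinates separate points. A weakly
  continuous \<open>f\<close> factors through the moments as a continuous function, to which
  Stone-Weierstrass applies.\<close>

theorem weak_top_approx:
  assumes f: "continuous_map weak_top euclideanreal f" and e: "0 < e"
  obtains F where "F \<in> moment_algebra" "\<And>\<nu>. \<nu> \<in> PK \<Longrightarrow> \<bar>f \<nu> - F (moments \<nu>)\<bar> < e"
proof -
  \<comment> \<open>One measure is chosen for each moment sequence; by
    \<open>moments_determine_weak_limits\<close> the value of \<open>f\<close> does not depend on
    the choice.\<close>
  define inv where "inv = inv_into PK moments"
  have inv: "inv \<kappa> \<in> PK" "moments (inv \<kappa>) = \<kappa>" if "\<kappa> \<in> moments ` PK" for \<kappa>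
    using that by (auto simp: inv_def inv_into_into f_inv_into_f)
  \<comment> \<open>Along the chosen measures the integral of \<open>g\<close> is a uniform limit of
    linear combinations of moments. Such integrals generate the weak topology, so \<open>inv\<close>
    is continuous.\<close>
  have cont: "continuous_on (moments ` PK) (\<lambda>\<kappa>. \<integral>y. g y \<partial>inv \<kappa>)" if g: "continuous_on {-1..1} g" for g :: "real \<Rightarrow> real"
  proof -
    have "\<exists>a n. \<forall>\<nu>. \<nu> \<in> PK \<longrightarrow> \<bar>(\<integral>y. g y \<partial>\<nu>) - (\<Sum>i\<le>n. a i * moments \<nu> i)\<bar> \<le> 1 / Suc m" for m
      using PK_moments_approx[OF g, of "1 / Suc m"] by (metis zero_less_divide_1_iff of_nat_0_less_iff zero_less_Suc)
    then obtain a n where a: "\<And>\<nu> m. \<nu> \<in> PK \<Longrightarrow> \<bar>(\<integral>y. g y \<partial>\<nu>) - (\<Sum>i\<le>n m. a m i * moments \<nu> i)\<bar> \<le> 1 / Suc m"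
      by metis
    show ?thesis
    proof (rule uniform_limit_theorem[where F=sequentially and f="\<lambda>m \<kappa>. \<Sum>i\<le>n m. a m i * \<kappa> i"])
      show "\<forall>\<^sub>F m in sequentially. continuous_on (moments ` PK) (\<lambda>\<kappa>. \<Sum>i\<le>n m. a m i * \<kappa> i)"
        by (intro always_eventually allI continuous_intros continuous_on_coordinate)
      show "uniform_limit (moments ` PK) (\<lambda>m \<kappa>. \<Sum>i\<le>n m. a m i * \<kappa> i) (\<lambda>\<kappa>. \<integral>y. g y \<partial>inv \<kappa>) sequentially"
      proof (rule uniform_limitI)
        fix d :: real assume "0 < d"
        then obtain N where N: "1 / Suc N < d" using nat_approx_posE by blast
        show "\<forall>\<^sub>F m in sequentially. \<forall>\<kappa>\<in>moments ` PK. dist (\<Sum>i\<le>n m. a m i * \<kappa> i) (\<integral>y. g y \<partial>inv \<kappa>) < d"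
        proof (rule eventually_sequentiallyI[of N], intro ballI)
          fix m \<kappa> assume "N \<le> m" and \<kappa>: "\<kappa> \<in> moments ` PK"
          have "1 / Suc m \<le> 1 / Suc N" using \<open>N \<le> m\<close> by (simp add: frac_le)
          with a[OF inv(1)[OF \<kappa>], of m] N
          show "dist (\<Sum>i\<le>n m. a m i * \<kappa> i) (\<integral>y. g y \<partial>inv \<kappa>) < d"
            by (simp add: inv(2)[OF \<kappa>] dist_real_def abs_minus_commute)
        qed
      qed
    qed simp
  qed
  have "continuous_map (top_of_set (moments ` PK)) weak_top inv"
    unfolding weak_top_def
  proof (rule continuous_on_generated_topo)
    fix U assume "U \<in> {{N \<in> PK. (\<integral>y. g y \<partial>N) \<in> U} | (g :: real \<Rightarrow> real) (U :: real set). continuous_on {-1..1} g \<and> open U}"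
    then obtain g :: "real \<Rightarrow> real" and V where V: "U = {N \<in> PK. (\<integral>y. g y \<partial>N) \<in> V}" "continuous_on {-1..1} g" "open V"
      by blast
    have "inv -` U \<inter> topspace (top_of_set (moments ` PK)) = moments ` PK \<inter> (\<lambda>\<kappa>. \<integral>y. g y \<partial>inv \<kappa>) -` V"
      using inv by (auto simp: V)
    then show "openin (top_of_set (moments ` PK)) (inv -` U \<inter> topspace (top_of_set (moments ` PK)))"
      using continuous_openin_preimage_gen[OF cont[OF V(2)] V(3)] by simp
  next
    show "inv ` topspace (top_of_set (moments ` PK))
      \<subseteq> \<Union> {{N \<in> PK. (\<integral>y. g y \<partial>N) \<in> U} | (g :: real \<Rightarrow> real) (U :: real set). continuous_on {-1..1} g \<and> open U}"
      using topspace_weak_top inv by (auto simp: weak_top_def topology_generated_by_topspace)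
  qed
  from continuous_map_compose[OF this f] have F: "continuous_on (moments ` PK) (f \<circ> inv)"
    by (simp add: continuous_map_iff_continuous)
  interpret function_ring_on moment_algebra "moments ` PK"
  proof
    show "\<exists>F\<in>moment_algebra. F \<kappa> \<noteq> F \<kappa>'" if "\<kappa> \<noteq> \<kappa>'" for \<kappa> \<kappa>'
      using that moment_algebra_coordinate by (metis ext)
  qed (auto intro: compact_moments continuous_on_moment_algebra moment_algebra.add moment_algebra_mult moment_algebra_const)
  obtain G where G: "G \<in> moment_algebra" "\<And>\<kappa>. \<kappa> \<in> moments ` PK \<Longrightarrow> \<bar>(f \<circ> inv) \<kappa> - G \<kappa>\<bar> < e"
    using Stone_Weierstrass_basic[OF F e] by blast
  show ?thesis
  proof
    fix \<nu> assume \<nu>: "\<nu> \<in> PK"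
    then have "f (inv (moments \<nu>)) = f \<nu>"
      using inv by (intro moments_determine_weak_limits f) auto
    with G(2)[of "moments \<nu>"] \<nu> show "\<bar>f \<nu> - G (moments \<nu>)\<bar> < e" by simp
  qed fact
qed

section \<open>Zooming into a measure\<close>

text \<open>The scale \<open>s\<close> carries a sign: a negative scale also reflects the window,
  and only its modulus is the radius. As a push-forward with a default value for windows of mass
  zero, \<open>zoom\<close> is a probability measure on \<open>[-1,1]\<close> for every centre and
  scale, which keeps side conditions out of measurability proofs.\<close>

definition zoom :: "real measure \<Rightarrow> real \<Rightarrow> real \<Rightarrow> real measure" where
  "zoom \<mu> x s = (if emeasure \<mu> (cball x \<bar>s\<bar>) = 0 then return Kbox 0
    else distr (uniform_measure \<mu> (cball x \<bar>s\<bar>)) Kbox (\<lambda>y. clamp1 ((y - x) / s)))"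

abbreviation zoom_window :: "real \<Rightarrow> real \<Rightarrow> real set \<Rightarrow> real set" where
  "zoom_window x s E \<equiv> {y \<in> cball x \<bar>s\<bar>. clamp1 ((y - x) / s) \<in> E}"

text \<open>\<open>blowup\<close> and \<open>scaling\<close> are given by set functions under
  \<open>measure_of\<close>; this turns them into genuine measures once the set function agrees with
  one.\<close>

lemma measure_of_Kbox_eq:
  assumes "\<nu> \<in> PK" and "\<And>E. E \<in> sets Kbox \<Longrightarrow> f E = emeasure \<nu> E"
  shows "measure_of {-1..1} (sets Kbox) f = \<nu>"
proof -
  have "measure_of {-1..1} (sets Kbox) f = measure_of {-1..1} (sets Kbox) (emeasure \<nu>)"
    using assms(2) sets.space_closed[of Kbox] sets.sigma_sets_eq[of Kbox] by (intro measure_of_eq) auto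
  also have "\<dots> = \<nu>"
    using measure_of_of_measure[of \<nu>] by (simp add: PK_D(2,3)[OF assms(1)])
  finally show ?thesis .
qed

lemma clamp1_abs: "\<bar>y\<bar> \<le> 1 \<Longrightarrow> clamp1 y = y"
  by (auto simp: clamp1_def)

lemma Kbox_bound:
  assumes "E \<in> sets Kbox" "z \<in> E"
  shows "\<bar>z\<bar> \<le> 1"
  using sets.sets_into_space[OF assms(1)] assms(2) by (auto simp: abs_le_iff)

lemma ennreal_divide_divide_cancel:
  fixes a b m :: ennreal
  assumes "a \<noteq> \<top>" "b \<noteq> \<top>" "m \<noteq> \<top>" "b \<noteq> 0" "m \<noteq> 0"
  shows "(a / m) / (b / m) = a / b"
  using assms
  by (cases a; cases b; cases m) (auto simp: divide_ennreal zero_less_iff_neq_zero ennreal_eq_0_iff not_le)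

lemma ennreal_mult_divide_cancel:
  fixes a b c :: ennreal
  assumes "a \<noteq> \<top>" "b \<noteq> \<top>" "c \<noteq> \<top>" "b \<noteq> 0" "c \<noteq> 0"
  shows "(c * a) / (c * b) = a / b"
  using assms
  by (cases a; cases b; cases c) (auto simp: divide_ennreal ennreal_mult[symmetric] zero_less_iff_neq_zero ennreal_eq_0_iff not_le)

context
  fixes \<mu> :: "real measure"
  assumes sets_\<mu> [measurable_cong]: "sets \<mu> = sets borel" and prob_\<mu>: "prob_space \<mu>"
begin

interpretation prob_space \<mu> by (rule prob_\<mu>)

lemma measurable_clamp1_affine: "(\<lambda>y. clamp1 ((y - x) / s)) \<in> \<mu> \<rightarrow>\<^sub>M Kbox"
  by (subst measurable_cong_sets[OF sets_\<mu> refl]) measurable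

lemma space_\<mu>: "space \<mu> = UNIV"
  using sets_eq_imp_space_eq[OF sets_\<mu>] by simp

lemma zoom_PK: "zoom \<mu> x s \<in> PK"
proof (cases "emeasure \<mu> (cball x \<bar>s\<bar>) = 0")
  case True
  then show ?thesis by (simp add: zoom_def PK_iff prob_space_return)
next
  case False
  then interpret U: prob_space "uniform_measure \<mu> (cball x \<bar>s\<bar>)"
    by (intro prob_space_uniform_measure) auto
  have "(\<lambda>y. clamp1 ((y - x) / s)) \<in> uniform_measure \<mu> (cball x \<bar>s\<bar>) \<rightarrow>\<^sub>M Kbox"
    using measurable_clamp1_affine by (simp cong: measurable_cong_sets)
  with False show ?thesis by (simp add: zoom_def PK_iff U.prob_space_distr)
qed

lemma emeasure_zoom_clamp:
  assumes E: "E \<in> sets Kbox"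
  shows "emeasure (zoom \<mu> x s) E = (if emeasure \<mu> (cball x \<bar>s\<bar>) = 0 then indicator E 0
    else emeasure \<mu> (zoom_window x s E) / emeasure \<mu> (cball x \<bar>s\<bar>))"
proof (cases "emeasure \<mu> (cball x \<bar>s\<bar>) = 0")
  case False
  have m [measurable]: "(\<lambda>y. clamp1 ((y - x) / s)) \<in> \<mu> \<rightarrow>\<^sub>M Kbox"
    by (rule measurable_clamp1_affine)
  have "emeasure (zoom \<mu> x s) E
      = emeasure (uniform_measure \<mu> (cball x \<bar>s\<bar>)) ((\<lambda>y. clamp1 ((y - x) / s)) -` E \<inter> space \<mu>)"
    using False E by (simp add: zoom_def emeasure_distr cong: measurable_cong_sets)
  also have "\<dots> = emeasure \<mu> (cball x \<bar>s\<bar> \<inter> ((\<lambda>y. clamp1 ((y - x) / s)) -` E \<inter> space \<mu>)) / emeasure \<mu> (cball x \<bar>s\<bar>)"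
    by (rule emeasure_uniform_measure) (auto simp: sets_\<mu> intro!: measurable_sets[OF m E, unfolded sets_\<mu>])
  also have "cball x \<bar>s\<bar> \<inter> ((\<lambda>y. clamp1 ((y - x) / s)) -` E \<inter> space \<mu>) = zoom_window x s E"
    by (auto simp: space_\<mu>)
  finally show ?thesis using False by simp
qed (use E in \<open>simp add: zoom_def\<close>)

lemma emeasure_zoom:
  assumes E: "E \<in> sets Kbox" and s: "s \<noteq> 0" and pos: "emeasure \<mu> (cball x \<bar>s\<bar>) \<noteq> 0"
  shows "emeasure (zoom \<mu> x s) E = emeasure \<mu> ((\<lambda>z. x + s * z) ` E) / emeasure \<mu> (cball x \<bar>s\<bar>)"
proof -
  have E1: "E \<subseteq> {-1..1}" using sets.sets_into_space[OF E] by simp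
  have "zoom_window x s E = (\<lambda>z. x + s * z) ` E"
  proof (intro subset_antisym subsetI)
    fix y assume y: "y \<in> zoom_window x s E"
    then have "\<bar>(y - x) / s\<bar> \<le> 1" using s by (auto simp: dist_real_def abs_divide divide_le_eq_1)
    then have "clamp1 ((y - x) / s) = (y - x) / s" by (intro clamp1_abs) linarith
    then show "y \<in> (\<lambda>z. x + s * z) ` E" using y s by (intro image_eqI[of _ _ "(y - x) / s"]) auto
  next
    fix y assume "y \<in> (\<lambda>z. x + s * z) ` E"
    then obtain z where z: "z \<in> E" "y = x + s * z" by blast
    then have "\<bar>z\<bar> \<le> 1" using Kbox_bound[OF E] by blast
    then have "\<bar>s\<bar> * \<bar>z\<bar> \<le> \<bar>s\<bar> * 1" by (intro mult_left_mono) auto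
    then show "y \<in> zoom_window x s E"
      using z s clamp1_id[of z] E1 by (auto simp: dist_real_def abs_mult)
  qed
  with emeasure_zoom_clamp[OF E, of x s] pos show ?thesis by simp
qed

lemma cball_msupp_pos:
  assumes "x \<in> msupp \<mu>" "0 < e"
  shows "emeasure \<mu> (cball x e) \<noteq> 0"
proof -
  have "0 < emeasure \<mu> (ball x e)" using assms by (auto simp: msupp_def space_\<mu>)
  also have "\<dots> \<le> emeasure \<mu> (cball x e)" by (intro emeasure_mono) (auto simp: sets_\<mu>)
  finally show ?thesis by simp
qed

lemma blowup_eq_zoom:
  assumes "x \<in> msupp \<mu>"
  shows "blowup \<mu> x = zoom \<mu> x 1"
  unfolding blowup_def
proof (rule measure_of_Kbox_eq[OF zoom_PK])
  have pos: "emeasure \<mu> (cball x \<bar>1\<bar>) \<noteq> 0" using cball_msupp_pos[OF assms, of 1] by simp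
  show "emeasure \<mu> ((\<lambda>y. y + x) ` E) / emeasure \<mu> {x - 1..x + 1} = emeasure (zoom \<mu> x 1) E"
    if "E \<in> sets Kbox" for E
    using emeasure_zoom[OF that _ pos] by (simp add: cball_eq_atLeastAtMost add.commute)
qed

text \<open>Zooming twice multiplies the scales, since the mass of the first window appears in
  numerator and denominator and cancels.\<close>

lemma scaling_zoom:
  assumes x: "x \<in> msupp \<mu>" and s: "s \<noteq> 0" and \<tau>: "0 \<le> \<tau>"
  shows "scaling \<tau> (zoom \<mu> x s) = zoom \<mu> x (s * exp (- \<tau>))"
proof -
  let ?s = "s * exp (- \<tau>)"
  have pos: "emeasure \<mu> (cball x \<bar>s\<bar>) \<noteq> 0" "emeasure \<mu> (cball x \<bar>?s\<bar>) \<noteq> 0"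
    using cball_msupp_pos[OF x] s by auto
  have le1: "exp (- \<tau>) \<le> 1" using \<tau> by simp
  \<comment> \<open>The image under a dilation is the preimage under its inverse, hence
    Borel.\<close>
  have scaled: "(\<lambda>y. exp (- \<tau>) * y) ` E \<in> sets Kbox" if "E \<in> sets Kbox" for E
  proof -
    have E: "E \<in> sets borel" "E \<subseteq> {-1..1}"
      using that by (auto simp: Kbox_def sets_restrict_space_iff)
    have "(\<lambda>y. exp (- \<tau>) * y) ` E = (\<lambda>y. exp \<tau> * y) -` E \<inter> space borel"
      by (auto simp: image_iff exp_minus field_simps intro!: bexI[of _ "exp \<tau> * _"])
    also have "\<dots> \<in> sets borel" by (intro measurable_sets[OF _ E(1)]) measurable
    finally have "(\<lambda>y. exp (- \<tau>) * y) ` E \<in> sets borel" .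
    moreover have "\<bar>exp (- \<tau>) * y\<bar> \<le> 1" if "y \<in> E" for y
    proof -
      have "\<bar>y\<bar> \<le> 1" using Kbox_bound[OF \<open>E \<in> sets Kbox\<close> that] .
      then show ?thesis using le1 by (simp add: abs_mult mult_le_one)
    qed
    ultimately show ?thesis by (auto simp: Kbox_def sets_restrict_space_iff abs_le_iff minus_le_iff)
  qed
  show ?thesis
    unfolding scaling_def
  proof (rule measure_of_Kbox_eq[OF zoom_PK])
    fix E assume E: "E \<in> sets Kbox"
    have img: "(\<lambda>z. x + s * z) ` (\<lambda>y. exp (- \<tau>) * y) ` E = (\<lambda>z. x + ?s * z) ` E"
      by (simp add: image_image mult.assoc)
    have "{-1..1} \<in> sets Kbox" using sets.top[of Kbox] by simp
    then have full: "{- exp (- \<tau>)..exp (- \<tau>)} \<in> sets Kbox"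
      using scaled[of "{-1..1}"] by (simp add: image_mult_atLeastAtMost)
    have img2: "(\<lambda>z. x + s * z) ` {- exp (- \<tau>)..exp (- \<tau>)} = cball x \<bar>?s\<bar>"
    proof (intro subset_antisym subsetI)
      fix y assume "y \<in> cball x \<bar>?s\<bar>"
      then have "\<bar>(y - x) / s\<bar> \<le> exp (- \<tau>)"
        using s by (auto simp: dist_real_def abs_divide abs_mult divide_le_eq mult.commute)
      then show "y \<in> (\<lambda>z. x + s * z) ` {- exp (- \<tau>)..exp (- \<tau>)}"
        using s by (intro image_eqI[of _ _ "(y - x) / s"]) (simp, unfold atLeastAtMost_iff, linarith)
    next
      fix y assume "y \<in> (\<lambda>z. x + s * z) ` {- exp (- \<tau>)..exp (- \<tau>)}"
      then obtain z where "z \<in> {- exp (- \<tau>)..exp (- \<tau>)}" and y: "y = x + s * z" by blast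
      then have "\<bar>z\<bar> \<le> exp (- \<tau>)" by (auto simp: abs_le_iff)
      then have "\<bar>s\<bar> * \<bar>z\<bar> \<le> \<bar>s\<bar> * exp (- \<tau>)" by (intro mult_left_mono) auto
      then show "y \<in> cball x \<bar>?s\<bar>" by (simp add: y dist_real_def abs_mult)
    qed
    show "emeasure (zoom \<mu> x s) ((\<lambda>y. exp (- \<tau>) * y) ` E) / emeasure (zoom \<mu> x s) {- exp (- \<tau>)..exp (- \<tau>)}
      = emeasure (zoom \<mu> x ?s) E"
      unfolding emeasure_zoom[OF scaled[OF E] s pos(1)] emeasure_zoom[OF full s pos(1)] img img2
      using pos s by (subst ennreal_divide_divide_cancel) (auto simp: emeasure_zoom[OF E _ pos(2)])
  qed
qed

lemma zoom_Mbox: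
  assumes x: "x \<in> msupp \<mu>" and s: "s \<noteq> 0"
  shows "zoom \<mu> x s \<in> Mbox"
proof -
  note sp = PK_D(3)[OF zoom_PK[of x s]]
  have pos: "emeasure \<mu> (cball x \<bar>s\<bar>) \<noteq> 0"
    using cball_msupp_pos[OF x] s by auto
  have "0 < emeasure (zoom \<mu> x s) (ball 0 e \<inter> {-1..1})" if e: "0 < e" for e
  proof -
    have E: "ball 0 e \<inter> {-1..1} \<in> sets Kbox"
      by (auto simp: Kbox_def sets_restrict_space)
    \<comment> \<open>The factor \<open>e\<close> brings rescaled points into the small ball; the
      factor 1 keeps them inside the window, where clamping does nothing.\<close>
    define d where "d = min e 1 * \<bar>s\<bar>"
    have "0 < emeasure \<mu> (ball x d)"
      using x e s by (auto simp: msupp_def space_\<mu> d_def)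
    also have "\<dots> \<le> emeasure \<mu> (zoom_window x s (ball 0 e \<inter> {-1..1}))"
    proof (rule emeasure_mono)
      show "ball x d \<subseteq> zoom_window x s (ball 0 e \<inter> {-1..1})"
      proof
        fix y assume "y \<in> ball x d"
        then have "\<bar>y - x\<bar> < min e 1 * \<bar>s\<bar>" by (simp add: d_def dist_real_def abs_minus_commute)
        then have *: "\<bar>(y - x) / s\<bar> < min e 1" using s by (simp only: abs_divide) (simp add: pos_divide_less_eq del: min_less_iff_conj)
        then have **: "\<bar>(y - x) / s\<bar> < e" "\<bar>(y - x) / s\<bar> < 1" by simp_all
        then have "clamp1 ((y - x) / s) = (y - x) / s" by (intro clamp1_abs) linarith
        moreover have "\<bar>x - y\<bar> \<le> \<bar>s\<bar>"
          using **(2) s by (simp add: abs_divide divide_less_eq abs_minus_commute)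
        ultimately show "y \<in> zoom_window x s (ball 0 e \<inter> {-1..1})"
          using ** clamp1_in(1)[of "(y - x) / s"] by (simp only: mem_Collect_eq mem_cball dist_real_def mem_ball Int_iff) simp
      qed
      have "(\<lambda>y. clamp1 ((y - x) / s)) \<in> borel \<rightarrow>\<^sub>M Kbox" by measurable
      from measurable_sets[OF this E]
      have "(\<lambda>y. clamp1 ((y - x) / s)) -` (ball 0 e \<inter> {-1..1}) \<inter> cball x \<bar>s\<bar> \<in> sets borel" by auto
      also have "(\<lambda>y. clamp1 ((y - x) / s)) -` (ball 0 e \<inter> {-1..1}) \<inter> cball x \<bar>s\<bar>
          = zoom_window x s (ball 0 e \<inter> {-1..1})" by auto
      finally show "zoom_window x s (ball 0 e \<inter> {-1..1}) \<in> sets \<mu>"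
        by (simp add: sets_\<mu>)
    qed
    finally show ?thesis
      using pos by (simp add: emeasure_zoom_clamp[OF E] ennreal_zero_less_divide less_top[symmetric])
  qed
  then show ?thesis
    using zoom_PK[of x s] by (auto simp: Mbox_def msupp_def sp)
qed

end

text \<open>Within the window \<open>\<mu>\<close> is \<open>c\<close> times an affine image of
  \<open>\<mu>'\<close>. Normalisation removes \<open>c\<close>, the affine map divides the scale by
  \<open>r\<close>, and a negative \<open>r\<close> ends up in the sign of the scale. Since
  \<open>c\<close> is neither 0 nor infinite, the default case occurs on both sides or on
  neither.\<close>

lemma zoom_affine:
  assumes \<mu>: "sets \<mu> = sets borel" "prob_space \<mu>" and \<mu>': "sets \<mu>' = sets borel" "prob_space \<mu>'"
    and r: "r \<noteq> 0" and s: "s \<noteq> 0" and c: "c \<noteq> 0" "c \<noteq> \<top>"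
    and eq: "\<And>B. B \<in> sets borel \<Longrightarrow> B \<subseteq> cball (r * x' + t) \<bar>s\<bar> \<Longrightarrow>
      emeasure \<mu> B = c * emeasure \<mu>' {z. r * z + t \<in> B}"
  shows "zoom \<mu> (r * x' + t) s = zoom \<mu>' x' (s / r)"
proof (rule measure_eqI)
  interpret \<mu>: prob_space \<mu> by fact
  interpret \<mu>': prob_space \<mu>' by fact
  show "sets (zoom \<mu> (r * x' + t) s) = sets (zoom \<mu>' x' (s / r))"
    using zoom_PK[OF \<mu>] zoom_PK[OF \<mu>'] by (auto simp: PK_iff)
  let ?x = "r * x' + t"
  fix E assume "E \<in> sets (zoom \<mu> ?x s)"
  then have E: "E \<in> sets Kbox" using zoom_PK[OF \<mu>] by (auto simp: PK_iff)
  have dist: "\<bar>r * z + t - ?x\<bar> = \<bar>r\<bar> * \<bar>z - x'\<bar>" for z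
    by (simp add: abs_mult[symmetric] algebra_simps)
  have ball: "{z. r * z + t \<in> cball ?x \<bar>s\<bar>} = cball x' \<bar>s / r\<bar>"
  proof (rule set_eqI)
    fix z
    have "z \<in> {z. r * z + t \<in> cball ?x \<bar>s\<bar>} \<longleftrightarrow> \<bar>r\<bar> * \<bar>z - x'\<bar> \<le> \<bar>s\<bar>"
      by (simp only: mem_Collect_eq mem_cball dist_real_def abs_minus_commute[of ?x] dist)
    also have "\<dots> \<longleftrightarrow> z \<in> cball x' \<bar>s / r\<bar>"
      using r by (simp add: abs_divide le_divide_eq mult.commute dist_real_def abs_minus_commute)
    finally show "z \<in> {z. r * z + t \<in> cball ?x \<bar>s\<bar>} \<longleftrightarrow> z \<in> cball x' \<bar>s / r\<bar>" .
  qed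
  have mass: "emeasure \<mu> (cball ?x \<bar>s\<bar>) = c * emeasure \<mu>' (cball x' \<bar>s / r\<bar>)"
    using eq[of "cball ?x \<bar>s\<bar>"] by (simp only: ball) simp
  let ?B = "zoom_window ?x s E"
  have "(\<lambda>y. clamp1 ((y - ?x) / s)) \<in> borel \<rightarrow>\<^sub>M Kbox" by measurable
  from measurable_sets[OF this E]
  have "cball ?x \<bar>s\<bar> \<inter> (\<lambda>y. clamp1 ((y - ?x) / s)) -` E \<in> sets borel" by auto
  then have B: "?B \<in> sets borel" by (simp add: vimage_def Int_def)
  have quot: "(r * z + t - ?x) / s = (z - x') / (s / r)" for z
    by (simp add: algebra_simps)
  have "{z. r * z + t \<in> ?B} = zoom_window x' (s / r) E"
    using ball by (auto simp only: quot mem_Collect_eq set_eq_iff)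
  moreover have "emeasure \<mu> ?B = c * emeasure \<mu>' {z. r * z + t \<in> ?B}"
    by (rule eq[OF B]) auto
  ultimately have "emeasure \<mu> ?B = c * emeasure \<mu>' (zoom_window x' (s / r) E)"
    by (simp only:)
  then show "emeasure (zoom \<mu> ?x s) E = emeasure (zoom \<mu>' x' (s / r)) E"
    unfolding emeasure_zoom_clamp[OF \<mu> E] emeasure_zoom_clamp[OF \<mu>' E] mass
    using c by (auto simp: ennreal_mult_divide_cancel)
qed

text \<open>Joint measurability in measure, centre and scale. The window is described as a preimage
  under \<open>clamp1\<close>, so it is a section of a measurable set in the product and its mass
  depends measurably on the parameter.\<close>

lemma measurable_zoom [measurable (raw)]:
  assumes L: "L \<in> N \<rightarrow>\<^sub>M prob_algebra borel" and [measurable]: "f \<in> borel_measurable N" "g \<in> borel_measurable N"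
  shows "(\<lambda>a. zoom (L a) (f a) (g a)) \<in> N \<rightarrow>\<^sub>M prob_algebra Kbox"
proof (rule measurable_prob_algebraI)
  have L': "L \<in> N \<rightarrow>\<^sub>M subprob_algebra borel" using L by (rule measurable_prob_algebraD)
  have La: "sets (L a) = sets borel" "prob_space (L a)" if "a \<in> space N" for a
    using measurable_space[OF L that] by (auto simp: space_prob_algebra)
  show "prob_space (zoom (L a) (f a) (g a))" if "a \<in> space N" for a
    using zoom_PK[OF La[OF that]] by (simp add: PK_iff)
  show "(\<lambda>a. zoom (L a) (f a) (g a)) \<in> N \<rightarrow>\<^sub>M subprob_algebra Kbox"
  proof (rule measurable_subprob_algebra)
    show "subprob_space (zoom (L a) (f a) (g a))" "sets (zoom (L a) (f a) (g a)) = sets Kbox"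
      if "a \<in> space N" for a
      using zoom_PK[OF La[OF that], of "f a" "g a"] by (auto simp: PK_iff prob_space_imp_subprob_space)
    fix E assume E [measurable]: "E \<in> sets Kbox"
    have "(SIGMA a:space N. cball (f a) \<bar>g a\<bar>) = {p \<in> space (N \<Otimes>\<^sub>M borel). \<bar>f (fst p) - snd p\<bar> \<le> \<bar>g (fst p)\<bar>}"
      by (auto simp: space_pair_measure dist_real_def)
    also have "\<dots> \<in> sets (N \<Otimes>\<^sub>M borel)" by measurable
    finally have m1 [measurable]: "(\<lambda>a. emeasure (L a) (cball (f a) \<bar>g a\<bar>)) \<in> borel_measurable N"
      by (rule emeasure_measurable_subprob_algebra2[OF _ L'])
    have "(SIGMA a:space N. zoom_window (f a) (g a) E)
      = {p \<in> space (N \<Otimes>\<^sub>M borel). \<bar>f (fst p) - snd p\<bar> \<le> \<bar>g (fst p)\<bar> \<and> clamp1 ((snd p - f (fst p)) / g (fst p)) \<in> E}"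
      by (auto simp: space_pair_measure dist_real_def)
    also have "\<dots> \<in> sets (N \<Otimes>\<^sub>M borel)" by measurable
    finally have m2 [measurable]: "(\<lambda>a. emeasure (L a) (zoom_window (f a) (g a) E)) \<in> borel_measurable N"
      by (rule emeasure_measurable_subprob_algebra2[OF _ L'])
    have "(\<lambda>a. if emeasure (L a) (cball (f a) \<bar>g a\<bar>) = 0 then indicator E 0
        else emeasure (L a) (zoom_window (f a) (g a) E) / emeasure (L a) (cball (f a) \<bar>g a\<bar>))
        \<in> borel_measurable N"
      by measurable
    then show "(\<lambda>a. emeasure (zoom (L a) (f a) (g a)) E) \<in> borel_measurable N"
      by (rule measurable_cong[THEN iffD1, rotated]) (simp add: emeasure_zoom_clamp[OF La E])
  qed
qed

text \<open>Countably many radii suffice, which is what makes supports and \<open>Mbox\<close>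
  measurable.\<close>

lemma msupp_iff_nat:
  assumes "\<And>e. ball x e \<inter> space \<mu> \<in> sets \<mu>" and "x \<in> space \<mu>"
  shows "x \<in> msupp \<mu> \<longleftrightarrow> (\<forall>n. 0 < emeasure \<mu> (ball x (1 / Suc n) \<inter> space \<mu>))"
proof
  assume *: "\<forall>n. 0 < emeasure \<mu> (ball x (1 / Suc n) \<inter> space \<mu>)"
  have "0 < emeasure \<mu> (ball x e \<inter> space \<mu>)" if e: "0 < e" for e
  proof -
    obtain n where "1 / Suc n < e" using nat_approx_posE[OF e] by blast
    then have "emeasure \<mu> (ball x (1 / Suc n) \<inter> space \<mu>) \<le> emeasure \<mu> (ball x e \<inter> space \<mu>)"
      using assms(1) by (intro emeasure_mono) auto
    with * show ?thesis by (metis less_le_trans)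
  qed
  with assms(2) show "x \<in> msupp \<mu>" by (simp add: msupp_def)
qed (simp add: msupp_def)

lemma Mbox_sets: "Mbox \<in> sets (prob_algebra Kbox)"
proof -
  have ball: "ball 0 (1 / Suc n) \<inter> {-1..1} \<in> sets Kbox" for n
    by (auto simp: Kbox_def sets_restrict_space)
  have [measurable]: "(\<lambda>\<nu>. emeasure \<nu> (ball 0 (1 / Suc n) \<inter> {-1..1})) \<in> borel_measurable (prob_algebra Kbox)" for n
    unfolding prob_algebra_def
    by (intro measurable_restrict_space1 measurable_emeasure_subprob_algebra ball)
  have "\<nu> \<in> Mbox \<longleftrightarrow> (\<forall>n. 0 < emeasure \<nu> (ball 0 (1 / Suc n) \<inter> {-1..1}))" if "\<nu> \<in> PK" for \<nu>
  proof -
    have "ball 0 e \<inter> space \<nu> \<in> sets \<nu>" for e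
      unfolding PK_D(2,3)[OF that] by (auto simp: Kbox_def sets_restrict_space)
    from msupp_iff_nat[OF this] show ?thesis
      using that by (simp add: Mbox_def PK_D(3)[OF that])
  qed
  then have "Mbox = {\<nu> \<in> space (prob_algebra Kbox). \<forall>n. 0 < emeasure \<nu> (ball 0 (1 / Suc n) \<inter> {-1..1})}"
    unfolding PK_def[symmetric] by (auto simp: Mbox_def)
  also have "\<dots> \<in> sets (prob_algebra Kbox)" by measurable
  finally show ?thesis .
qed

text \<open>A measure in \<open>Mbox\<close>, moved to the line, is its own zoom at 0 with scale 1,
  so the composition rule for zooms applies. Measurability of \<open>scaling\<close> on
  \<open>Mbox\<close> is then inherited from \<open>zoom\<close>.\<close>

lemma scaling_eq_zoom:
  assumes \<nu>: "\<nu> \<in> Mbox" and \<tau>: "0 \<le> \<tau>"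
  shows "scaling \<tau> \<nu> = zoom (distr \<nu> borel (\<lambda>y. y)) 0 (exp (- \<tau>))"
proof -
  define \<mu> where "\<mu> = distr \<nu> borel (\<lambda>y. y)"
  have PK: "\<nu> \<in> PK" using \<nu> by (simp add: Mbox_def)
  note prob = PK_D(1)[OF PK] and sets [measurable_cong] = PK_D(2)[OF PK] and sp = PK_D(3)[OF PK]
  interpret prob_space \<nu> by (rule prob)
  have \<mu>: "sets \<mu> = sets borel" "prob_space \<mu>"
    unfolding \<mu>_def by (auto intro!: prob_space_distr)
  have em: "emeasure \<mu> A = emeasure \<nu> (A \<inter> {-1..1})" if "A \<in> sets borel" for A
    unfolding \<mu>_def using that by (subst emeasure_distr) (auto simp: sp)
  have supp: "0 \<in> msupp \<mu>"
    using \<nu> sets_eq_imp_space_eq[OF \<mu>(1)] by (auto simp: Mbox_def msupp_def sp em)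
  have "zoom \<mu> 0 1 = \<nu>"
  proof (rule measure_eqI)
    show "sets (zoom \<mu> 0 1) = sets \<nu>" using zoom_PK[OF \<mu>] sets by (simp add: PK_iff)
    fix E assume "E \<in> sets (zoom \<mu> 0 1)"
    then have E: "E \<in> sets Kbox" using zoom_PK[OF \<mu>] by (simp add: PK_iff)
    then have E': "E \<in> sets borel" "E \<inter> {-1..1} = E" by (auto simp: Kbox_def sets_restrict_space_iff)
    have ball: "cball (0::real) 1 = {-1..1}" by (simp add: cball_eq_atLeastAtMost)
    have "emeasure \<mu> {-1..1} = 1" using emeasure_space_1 by (simp add: em sp)
    then show "emeasure (zoom \<mu> 0 1) E = emeasure \<nu> E"
      using emeasure_zoom[OF \<mu> E, of 1 0] E' by (simp add: ball em divide_ennreal_def)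
  qed
  then have "scaling \<tau> \<nu> = scaling \<tau> (zoom \<mu> 0 1)" by simp
  also have "\<dots> = zoom \<mu> 0 (exp (- \<tau>))"
    using scaling_zoom[OF \<mu> supp _ \<tau>, of 1] by simp
  finally show ?thesis by (simp add: \<mu>_def)
qed

lemma scaling_preimage_sets:
  assumes A: "A \<in> sets (prob_algebra Kbox)" and \<tau>: "0 \<le> \<tau>"
  shows "{\<nu> \<in> Mbox. scaling \<tau> \<nu> \<in> A} \<in> sets (prob_algebra Kbox)"
proof -
  have "(\<lambda>\<nu>. distr \<nu> borel (\<lambda>y. y)) \<in> prob_algebra Kbox \<rightarrow>\<^sub>M prob_algebra borel"
    by (rule measurable_distr_prob_space) measurable
  then have "(\<lambda>\<nu>. zoom (distr \<nu> borel (\<lambda>y. y)) 0 (exp (- \<tau>))) \<in> prob_algebra Kbox \<rightarrow>\<^sub>M prob_algebra Kbox"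
    by (rule measurable_zoom) auto
  from measurable_sets[OF this A] Mbox_sets
  have "Mbox \<inter> ((\<lambda>\<nu>. zoom (distr \<nu> borel (\<lambda>y. y)) 0 (exp (- \<tau>))) -` A \<inter> space (prob_algebra Kbox)) \<in> sets (prob_algebra Kbox)"
    by auto
  also have "Mbox \<inter> ((\<lambda>\<nu>. zoom (distr \<nu> borel (\<lambda>y. y)) 0 (exp (- \<tau>))) -` A \<inter> space (prob_algebra Kbox))
    = {\<nu> \<in> Mbox. scaling \<tau> \<nu> \<in> A}"
    using sets.sets_into_space[OF Mbox_sets] scaling_eq_zoom[OF _ \<tau>] by auto
  finally show ?thesis .
qed

section \<open>Homogeneous iterated function systems\<close>

text \<open>Sequences over a finite alphabet form a compact space with cylinders as open sets.
  Finitely many of the given cylinders cover it, and the least of their bounds works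
  everywhere.\<close>

lemma uniform_cylinder_bound:
  fixes \<phi> :: "(nat \<Rightarrow> 'a) \<Rightarrow> real"
  assumes F: "finite F"
    and loc: "\<And>W. range W \<subseteq> F \<Longrightarrow> \<exists>n. \<exists>c>0. \<forall>W'. range W' \<subseteq> F \<longrightarrow> (\<forall>j<n. W' j = W j) \<longrightarrow> c \<le> \<phi> W'"
  shows "\<exists>c>0. \<forall>W. range W \<subseteq> F \<longrightarrow> c \<le> \<phi> W"
proof -
  define X where "X = product_topology (\<lambda>_::nat. discrete_topology F) UNIV"
  have topX: "topspace X = {W. range W \<subseteq> F}"
    by (auto simp: X_def PiE_def Pi_def extensional_def)
  have comp: "compact_space X"
    unfolding X_def using F by (simp add: compact_space_product_topology compact_space_discrete_topology)
  from loc obtain n c where nc: "\<And>W. range W \<subseteq> F \<Longrightarrow> 0 < c W"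
    "\<And>W W'. range W \<subseteq> F \<Longrightarrow> range W' \<subseteq> F \<Longrightarrow> (\<forall>j<n W. W' j = W j) \<Longrightarrow> c W \<le> \<phi> W'"
    by metis
  define U where "U W = {W'. range W' \<subseteq> F \<and> (\<forall>j<n W. W' j = W j)}" for W
  have U_open: "openin X (U W)" if "range W \<subseteq> F" for W
  proof -
    have "U W = (\<Pi>\<^sub>E j\<in>UNIV. if j < n W then {W j} else F)"
      using that by (auto simp: U_def PiE_def Pi_def extensional_def)
    moreover have "{j. (if j < n W then {W j} else F) \<noteq> F} \<subseteq> {..<n W}" by auto
    then have "finite {j. (if j < n W then {W j} else F) \<noteq> F}" by (rule finite_subset) simp
    moreover have "openin (discrete_topology F) (if j < n W then {W j} else F)" for j
      using subsetD[OF that rangeI[of W j]] by simp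
    ultimately show ?thesis
      using product_topology_basis[where X="\<lambda>j. if j < n W then {W j} else F"
          and T="\<lambda>_. discrete_topology F" and I=UNIV]
      unfolding X_def by simp
  qed
  have "\<exists>\<F>. finite \<F> \<and> \<F> \<subseteq> U ` topspace X \<and> topspace X \<subseteq> \<Union>\<F>"
  proof -
    have "\<forall>V\<in>U ` topspace X. openin X V" using U_open by (auto simp: topX)
    moreover have "topspace X \<subseteq> \<Union>(U ` topspace X)" by (auto simp: topX U_def)
    ultimately show ?thesis using comp unfolding compact_space_alt by meson
  qed
  then obtain \<F> where "finite \<F>" "\<F> \<subseteq> U ` topspace X" and cover: "topspace X \<subseteq> \<Union>\<F>" by blast
  then obtain K where K: "finite K" "K \<subseteq> topspace X" "\<F> = U ` K"
    by (meson finite_subset_image)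
  \<comment> \<open>Inserting 1 keeps the minimum meaningful for an empty cover.\<close>
  define d where "d = Min (insert 1 (c ` K))"
  have "0 < d"
    unfolding d_def using K nc(1) by (auto simp: topX)
  moreover have "d \<le> \<phi> W" if W: "range W \<subseteq> F" for W
  proof -
    obtain V where V: "V \<in> K" "W \<in> U V" using cover K(3) W topX by blast
    have "d \<le> c V" unfolding d_def using K(1) V(1) by (intro Min_le) auto
    also have "c V \<le> \<phi> W" using V K(2) by (intro nc(2)) (auto simp: U_def topX)
    finally show ?thesis .
  qed
  ultimately show ?thesis by blast
qed

locale ifs_family =
  fixes k :: "'i::finite \<Rightarrow> nat" and r :: "'i \<Rightarrow> real" and t p :: "'i \<Rightarrow> nat \<Rightarrow> real"
  assumes k_pos: "\<And>i. 1 \<le> k i"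
    and r_ne0: "\<And>i. r i \<noteq> 0"
    and r_lt1: "\<And>i. \<bar>r i\<bar> < 1"
    and p_pos: "\<And>i j. j \<in> {1..k i} \<Longrightarrow> 0 < p i j"
    and p_sum: "\<And>i. (\<Sum>j\<in>{1..k i}. p i j) = 1"
begin

section \<open>Contraction bounds for the coding map\<close>

definition rmax :: real where "rmax = Max (range (\<lambda>i. \<bar>r i\<bar>))"

definition tmax :: real where "tmax = Max ((\<lambda>(i, j). \<bar>t i j\<bar>) ` (SIGMA i:UNIV. {1..k i}))"

lemma rmax: "0 \<le> rmax" "rmax < 1" "\<bar>r i\<bar> \<le> rmax"
proof -
  show *: "\<bar>r i\<bar> \<le> rmax" for i unfolding rmax_def by (intro Max_ge) auto
  show "0 \<le> rmax" using *[of undefined] by linarith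
  show "rmax < 1" unfolding rmax_def using r_lt1 by (subst Max_less_iff) auto
qed

lemma tmax: "j \<in> {1..k i} \<Longrightarrow> \<bar>t i j\<bar> \<le> tmax"
  unfolding tmax_def by (intro Max_ge) (auto intro!: image_eqI[of _ _ "(i, j)"])

lemma coding_term_bound:
  assumes "u \<in> code_space k \<omega>"
  shows "\<bar>(\<Prod>j<n. r (\<omega> j)) * t (\<omega> n) (u n)\<bar> \<le> rmax ^ n * tmax"
proof -
  have "\<bar>\<Prod>j<n. r (\<omega> j)\<bar> \<le> (\<Prod>j<n. rmax)"
    unfolding abs_prod using rmax by (intro prod_mono) auto
  then show ?thesis
    using assms tmax rmax(1) by (auto simp: abs_mult code_space_def intro!: mult_mono)
qed

lemma summable_coding:
  assumes "u \<in> code_space k \<omega>"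
  shows "summable (\<lambda>n. (\<Prod>j<n. r (\<omega> j)) * t (\<omega> n) (u n))"
proof (rule summable_comparison_test'[where N=0])
  show "summable (\<lambda>n. rmax ^ n * tmax)"
    using rmax by (intro summable_mult2 summable_geometric) auto
qed (use coding_term_bound[OF assms] in auto)

lemma shift_code_space: "u \<in> code_space k \<omega> \<Longrightarrow> shift u \<in> code_space k (shift \<omega>)"
  by (auto simp: code_space_def shift_def)

lemma coding_step:
  assumes u: "u \<in> code_space k \<omega>"
  shows "coding r t \<omega> u = r (\<omega> 0) * coding r t (shift \<omega>) (shift u) + t (\<omega> 0) (u 0)"
proof -
  have "coding r t \<omega> u = (\<Sum>n. (\<Prod>j<Suc n. r (\<omega> j)) * t (\<omega> (Suc n)) (u (Suc n))) + t (\<omega> 0) (u 0)"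
    using suminf_split_head[OF summable_coding[OF u]] by (simp add: coding_def del: prod.lessThan_Suc)
  also have "(\<lambda>n. (\<Prod>j<Suc n. r (\<omega> j)) * t (\<omega> (Suc n)) (u (Suc n)))
      = (\<lambda>n. r (\<omega> 0) * ((\<Prod>j<n. r (shift \<omega> j)) * t (shift \<omega> n) (shift u n)))"
    by (auto simp: prod.lessThan_Suc_shift shift_def simp del: prod.lessThan_Suc)
  also have "(\<Sum>n. r (\<omega> 0) * ((\<Prod>j<n. r (shift \<omega> j)) * t (shift \<omega> n) (shift u n)))
      = r (\<omega> 0) * coding r t (shift \<omega>) (shift u)"
    unfolding coding_def by (rule suminf_mult[OF summable_coding[OF shift_code_space[OF u]]])
  finally show ?thesis .
qed

text \<open>Twice the geometric bound \<open>tmax / (1 - rmax)\<close> for coded points. It bounds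
  the distance of any two of them, even over different environments.\<close>

definition diam :: real where "diam = 2 * tmax / (1 - rmax)"

lemma abs_coding_le:
  assumes u: "u \<in> code_space k \<omega>"
  shows "\<bar>coding r t \<omega> u\<bar> \<le> diam / 2"
proof -
  have geo: "(\<lambda>n. rmax ^ n * tmax) sums (1 / (1 - rmax) * tmax)"
    using rmax by (intro sums_mult2 geometric_sums) auto
  have "\<bar>coding r t \<omega> u\<bar> \<le> (\<Sum>n. rmax ^ n * tmax)"
    unfolding coding_def real_norm_def[symmetric]
    using coding_term_bound[OF u] sums_summable[OF geo] by (intro norm_suminf_le) auto
  also have "\<dots> = diam / 2"
    unfolding sums_unique[OF geo, symmetric] diam_def by (metis (no_types) mult.commute nonzero_mult_div_cancel_left times_divide_eq_left times_divide_eq_right mult_1 zero_neq_numeral)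
  finally show ?thesis .
qed

text \<open>Each common place contributes the same contraction by at most \<open>rmax\<close>. The
  environments may differ later, as the compactness argument varies environment and digits
  together.\<close>

lemma coding_agree:
  assumes "u \<in> code_space k \<omega>" "v \<in> code_space k \<omega>'" "\<forall>j<n. u j = v j \<and> \<omega> j = \<omega>' j"
  shows "\<bar>coding r t \<omega> u - coding r t \<omega>' v\<bar> \<le> diam * rmax ^ n"
  using assms
proof (induction n arbitrary: \<omega> \<omega>' u v)
  case 0
  then show ?case using abs_coding_le[of u \<omega>] abs_coding_le[of v \<omega>'] by simp
next
  case (Suc n)
  have "\<bar>coding r t (shift \<omega>) (shift u) - coding r t (shift \<omega>') (shift v)\<bar> \<le> diam * rmax ^ n"
    using Suc.prems by (intro Suc.IH shift_code_space) (auto simp: shift_def)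
  then have "\<bar>r (\<omega> 0)\<bar> * \<bar>coding r t (shift \<omega>) (shift u) - coding r t (shift \<omega>') (shift v)\<bar> \<le> rmax * (diam * rmax ^ n)"
    using rmax by (intro mult_mono) auto
  moreover have "coding r t \<omega> u - coding r t \<omega>' v
      = r (\<omega> 0) * (coding r t (shift \<omega>) (shift u) - coding r t (shift \<omega>') (shift v))"
    using Suc.prems coding_step[of u \<omega>] coding_step[of v \<omega>'] by (simp add: algebra_simps)
  ultimately show ?case by (simp add: abs_mult ac_simps)
qed

lemma ex_rmax_pow_less: "0 < e \<Longrightarrow> \<exists>n. diam * rmax ^ n < e"
proof -
  assume e: "0 < e"
  have "(\<lambda>n. diam * rmax ^ n) \<longlonglongrightarrow> diam * 0"
    using rmax by (intro tendsto_mult tendsto_const LIMSEQ_power_zero) auto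
  then have "eventually (\<lambda>n. diam * rmax ^ n < e) sequentially"
    using e by (intro order_tendstoD(2)) auto
  then show ?thesis by (auto simp: eventually_sequentially)
qed

lemma coding_distinct:
  assumes SSC: "strong_separation k r t"
    and u: "u \<in> code_space k \<omega>" and v: "v \<in> code_space k \<omega>" and ne: "u 0 \<noteq> v 0"
  shows "coding r t \<omega> u \<noteq> coding r t \<omega> v"
proof
  assume eq: "coding r t \<omega> u = coding r t \<omega> v"
  have "coding r t \<omega> w \<in> ifs_map r t (\<omega> 0) (w 0) ` attractor k r t (shift \<omega>)" if "w \<in> code_space k \<omega>" for w
    using coding_step[OF that] shift_code_space[OF that] by (auto simp: ifs_map_def attractor_def)
  from this[OF u] this[OF v] eq
  have "coding r t \<omega> u \<in> ifs_map r t (\<omega> 0) (u 0) ` attractor k r t (shift \<omega>)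
      \<inter> ifs_map r t (\<omega> 0) (v 0) ` attractor k r t (shift \<omega>)" by simp
  moreover have "u 0 \<in> {1..k (\<omega> 0)}" "v 0 \<in> {1..k (\<omega> 0)}"
    using u v by (auto simp: code_space_def)
  ultimately show False using SSC ne unfolding strong_separation_def by blast
qed

text \<open>Strong separation only says that two points with different first digits are distinct.
  Compactness is applied to sequences of triples, a letter with two digits, so that the bound is
  uniform over environments and over both codes.\<close>

lemma uniform_separation:
  assumes SSC: "strong_separation k r t"
  obtains \<delta> where "0 < \<delta>" "\<delta> < 1"
    "\<And>\<omega> u v. u \<in> code_space k \<omega> \<Longrightarrow> v \<in> code_space k \<omega> \<Longrightarrow> u 0 \<noteq> v 0 \<Longrightarrow>
      \<delta> \<le> \<bar>coding r t \<omega> u - coding r t \<omega> v\<bar>"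
proof -
  define F where "F = (SIGMA i:UNIV. {1..k i} \<times> {1..k i})"
  define om where "om W = (\<lambda>n. fst (W (n::nat)))" for W :: "nat \<Rightarrow> 'i \<times> nat \<times> nat"
  define c1 where "c1 W = (\<lambda>n. fst (snd (W (n::nat))))" for W :: "nat \<Rightarrow> 'i \<times> nat \<times> nat"
  define c2 where "c2 W = (\<lambda>n. snd (snd (W (n::nat))))" for W :: "nat \<Rightarrow> 'i \<times> nat \<times> nat"
  \<comment> \<open>The value 1 for equal first digits makes these pairs harmless: only pairs with
    different first digits restrict the bound.\<close>
  define \<phi> where "\<phi> W = (if c1 W 0 = c2 W 0 then 1 else \<bar>coding r t (om W) (c1 W) - coding r t (om W) (c2 W)\<bar>)" for W
  have code: "c1 W \<in> code_space k (om W)" "c2 W \<in> code_space k (om W)" if W: "range W \<subseteq> F" for W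
  proof -
    have "c1 W n \<in> {1..k (om W n)} \<and> c2 W n \<in> {1..k (om W n)}" for n
      using subsetD[OF W rangeI[of W n]] by (cases "W n") (auto simp: F_def om_def c1_def c2_def)
    then show "c1 W \<in> code_space k (om W)" "c2 W \<in> code_space k (om W)"
      by (auto simp: code_space_def)
  qed
  have "finite F" unfolding F_def by auto
  then have "\<exists>c>0. \<forall>W. range W \<subseteq> F \<longrightarrow> c \<le> \<phi> W"
  proof (rule uniform_cylinder_bound)
    fix W :: "nat \<Rightarrow> 'i \<times> nat \<times> nat" assume W: "range W \<subseteq> F"
    show "\<exists>n. \<exists>c>0. \<forall>W'. range W' \<subseteq> F \<longrightarrow> (\<forall>j<n. W' j = W j) \<longrightarrow> c \<le> \<phi> W'"
    proof (cases "c1 W 0 = c2 W 0")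
      case True
      have "1 \<le> \<phi> W'" if "\<forall>j<1. W' j = W j" for W'
        using that True by (simp add: \<phi>_def c1_def c2_def)
      then show ?thesis by (intro exI[of _ 1]) (auto intro!: exI[of _ 1])
    next
      case False
      \<comment> \<open>On a long enough cylinder each of the two points moves by less than
        \<open>e\<close>, so at least \<open>e\<close> remains of the distance
        \<open>3 * e\<close>.\<close>
      define e where "e = \<bar>coding r t (om W) (c1 W) - coding r t (om W) (c2 W)\<bar> / 3"
      have e: "0 < e" using coding_distinct[OF SSC code[OF W] False] by (simp add: e_def)
      obtain n where n: "diam * rmax ^ n < e" using ex_rmax_pow_less[OF e] by blast
      \<comment> \<open>Agreement on \<open>Suc n\<close> places includes place 0 even for
        \<open>n = 0\<close>, so the first digits stay different.\<close>
      have "e \<le> \<phi> W'" if W': "range W' \<subseteq> F" and ag: "\<forall>j<Suc n. W' j = W j" for W'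
      proof -
        have "\<bar>coding r t (om W') (c1 W') - coding r t (om W) (c1 W)\<bar> \<le> diam * rmax ^ n"
          using ag by (intro coding_agree code W W') (auto simp: om_def c1_def)
        moreover have "\<bar>coding r t (om W') (c2 W') - coding r t (om W) (c2 W)\<bar> \<le> diam * rmax ^ n"
          using ag by (intro coding_agree code W W') (auto simp: om_def c2_def)
        moreover have "c1 W' 0 \<noteq> c2 W' 0" using ag False by (simp add: c1_def c2_def)
        moreover have "3 * e = \<bar>coding r t (om W) (c1 W) - coding r t (om W) (c2 W)\<bar>" by (simp add: e_def)
        ultimately show ?thesis using n unfolding \<phi>_def by (simp split: if_split)
      qed
      with e show ?thesis by blast
    qed
  qed
  then obtain c where c: "0 < c" "\<And>W. range W \<subseteq> F \<Longrightarrow> c \<le> \<phi> W" by blast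
  show ?thesis
  proof
    show "0 < min c (1/2)" "min c (1/2) < 1" using c by auto
    fix \<omega> u v assume u: "u \<in> code_space k \<omega>" and v: "v \<in> code_space k \<omega>" and ne: "u 0 \<noteq> v 0"
    have "range (\<lambda>n. (\<omega> n, u n, v n)) \<subseteq> F" using u v by (auto simp: F_def code_space_def)
    from c(2)[OF this] ne show "min c (1/2) \<le> \<bar>coding r t \<omega> u - coding r t \<omega> v\<bar>"
      by (simp add: \<phi>_def om_def c1_def c2_def)
  qed
qed

section \<open>Digit laws over a fixed environment and their projections\<close>

definition digit_pmf :: "'i \<Rightarrow> nat pmf" where
  "digit_pmf i = embed_pmf (\<lambda>j. if j \<in> {1..k i} then p i j else 0)"

lemma pmf_digit_pmf: "pmf (digit_pmf i) j = (if j \<in> {1..k i} then p i j else 0)"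
  unfolding digit_pmf_def
proof (rule pmf_embed_pmf)
  show "0 \<le> (if j \<in> {1..k i} then p i j else 0)" for j using p_pos[of j i] by auto
  have "(\<integral>\<^sup>+j. ennreal (if j \<in> {1..k i} then p i j else 0) \<partial>count_space UNIV)
      = (\<Sum>j\<in>{1..k i}. ennreal (p i j))"
    by (subst nn_integral_count_space'[of "{1..k i}"]) auto
  also have "\<dots> = 1"
    using p_sum[of i] p_pos by (subst sum_ennreal) (auto simp: less_imp_le)
  finally show "(\<integral>\<^sup>+j. ennreal (if j \<in> {1..k i} then p i j else 0) \<partial>count_space UNIV) = 1" .
qed

lemma digit_measure_eq: "digit_measure k p i = measure_pmf (digit_pmf i)"
  unfolding digit_measure_def measure_pmf_eq_density
  by (intro arg_cong2[where f=density] refl ext) (simp add: pmf_digit_pmf)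

lemma set_digit_pmf: "set_pmf (digit_pmf i) = {1..k i}"
  using p_pos by (auto simp: set_pmf_eq pmf_digit_pmf split: if_splits) (force simp: less_le)+

abbreviation sym :: "(nat \<Rightarrow> 'i) \<Rightarrow> (nat \<Rightarrow> nat) measure" where
  "sym \<equiv> sym_measure k p"

abbreviation \<eta> :: "(nat \<Rightarrow> 'i) \<Rightarrow> real measure" where
  "\<eta> \<equiv> proj_measure k r t p"

abbreviation symbols :: "(nat \<Rightarrow> 'i) measure" where
  "symbols \<equiv> PiM UNIV (\<lambda>_. count_space UNIV)"

abbreviation digits :: "(nat \<Rightarrow> nat) measure" where
  "digits \<equiv> PiM UNIV (\<lambda>_. count_space UNIV)"

lemma sym_eq: "sym \<omega> = PiM UNIV (\<lambda>n. measure_pmf (digit_pmf (\<omega> n)))"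
  by (simp add: sym_measure_def digit_measure_eq)

lemma sets_sym [measurable_cong, simp]: "sets (sym \<omega>) = sets digits"
  unfolding sym_eq by (intro sets_PiM_cong) auto

lemma space_sym [simp]: "space (sym \<omega>) = UNIV"
  by (simp add: sym_eq space_PiM)

lemma prob_space_sym: "prob_space (sym \<omega>)"
  unfolding sym_eq by (intro prob_space_PiM prob_space_measure_pmf)

lemma measurable_coding:
  assumes f: "f \<in> N \<rightarrow>\<^sub>M symbols" and g: "g \<in> N \<rightarrow>\<^sub>M digits"
  shows "(\<lambda>x. coding r t (f x) (g x)) \<in> borel_measurable N"
proof -
  have f': "(\<lambda>x. f x n) \<in> N \<rightarrow>\<^sub>M count_space UNIV" and g': "(\<lambda>x. g x n) \<in> N \<rightarrow>\<^sub>M count_space UNIV" for n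
    using measurable_compose[OF f measurable_component_singleton[of n]]
      measurable_compose[OF g measurable_component_singleton[of n]] by simp_all
  have "(\<lambda>x. r (f x n)) \<in> borel_measurable N" for n
    by (rule measurable_compose[OF f']) simp
  moreover have "(\<lambda>x. t (f x n) (g x n)) \<in> borel_measurable N" for n
  proof -
    have "(\<lambda>x. (f x n, g x n)) \<in> N \<rightarrow>\<^sub>M count_space UNIV \<Otimes>\<^sub>M count_space UNIV"
      using f' g' by (rule measurable_Pair)
    then have "(\<lambda>x. (f x n, g x n)) \<in> N \<rightarrow>\<^sub>M count_space UNIV"
      by (simp add: pair_measure_countable)
    from measurable_compose[OF this, of "\<lambda>(i, j). t i j" borel] show ?thesis by simp
  qed
  ultimately show ?thesis
    unfolding coding_def by (intro borel_measurable_suminf borel_measurable_times borel_measurable_prod)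
qed

lemma measurable_coding1 [measurable]: "coding r t \<omega> \<in> borel_measurable digits"
  using measurable_coding[of "\<lambda>_. \<omega>" digits "\<lambda>u. u"] by (simp add: space_PiM)

lemma coding_vimage_sets: "B \<in> sets borel \<Longrightarrow> {u. coding r t \<omega> u \<in> B} \<in> sets digits"
  using measurable_sets[OF measurable_coding1, of B \<omega>] by (simp add: vimage_def space_PiM)

lemma sets_\<eta> [measurable_cong, simp]: "sets (\<eta> \<omega>) = sets borel"
  by (simp add: proj_measure_def)

lemma space_\<eta> [simp]: "space (\<eta> \<omega>) = UNIV"
  by (simp add: proj_measure_def)

lemma prob_space_\<eta>: "prob_space (\<eta> \<omega>)"
  unfolding proj_measure_def
  by (intro prob_space.prob_space_distr[OF prob_space_sym]) measurable

lemma AE_code_space: "AE u in sym \<omega>. u \<in> code_space k \<omega>"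
proof -
  have "AE u in sym \<omega>. u n \<in> {1..k (\<omega> n)}" for n
    unfolding sym_eq
    by (rule AE_PiM_component[of UNIV "\<lambda>n. measure_pmf (digit_pmf (\<omega> n))"])
       (auto simp: prob_space_measure_pmf AE_measure_pmf_iff set_digit_pmf)
  then show ?thesis
    unfolding code_space_def mem_Collect_eq AE_all_countable by blast
qed

lemma emeasure_\<eta>:
  assumes "B \<in> sets borel"
  shows "emeasure (\<eta> \<omega>) B = emeasure (sym \<omega>) {u. coding r t \<omega> u \<in> B}"
  unfolding proj_measure_def using assms by (subst emeasure_distr) (auto simp: vimage_def)

text \<open>All weights are positive, so the cylinder of the first \<open>n\<close> digits of
  \<open>u\<close> has positive mass, and almost all of it is coded within
  \<open>diam * rmax ^ n\<close> of the point.\<close>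

lemma coding_in_msupp:
  assumes u: "u \<in> code_space k \<omega>"
  shows "coding r t \<omega> u \<in> msupp (\<eta> \<omega>)"
proof -
  have "0 < emeasure (\<eta> \<omega>) (ball (coding r t \<omega> u) e)" if e: "0 < e" for e
  proof -
    obtain n where n: "diam * rmax ^ n < e" using ex_rmax_pow_less[OF e] by blast
    interpret S: product_prob_space "\<lambda>n. measure_pmf (digit_pmf (\<omega> n))" UNIV ..
    define C where "C = {v \<in> space (sym \<omega>). \<forall>j\<in>{..<n}. v j \<in> {u j}}"
    have "emeasure (sym \<omega>) C = (\<Prod>j<n. emeasure (measure_pmf (digit_pmf (\<omega> j))) {u j})"
      unfolding C_def sym_eq by (rule S.emeasure_PiM_Collect) auto
    also have "\<dots> = (\<Prod>j<n. ennreal (p (\<omega> j) (u j)))"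
      using u by (intro prod.cong) (auto simp: emeasure_pmf_single pmf_digit_pmf code_space_def)
    also have "\<dots> > 0"
      using u p_pos by (auto simp: code_space_def zero_less_iff_neq_zero[where 'a=ennreal] ennreal_eq_0_iff not_le)
    finally have "0 < emeasure (sym \<omega>) C" .
    also have "\<dots> \<le> emeasure (sym \<omega>) {v. coding r t \<omega> v \<in> ball (coding r t \<omega> u) e}"
    proof (rule emeasure_mono_AE)
      show "AE v in sym \<omega>. v \<in> C \<longrightarrow> v \<in> {v. coding r t \<omega> v \<in> ball (coding r t \<omega> u) e}"
        using AE_code_space
      proof eventually_elim
        case (elim v)
        then show ?case using coding_agree[OF u elim, of n] n by (auto simp: C_def dist_real_def)
      qed
      show "{v. coding r t \<omega> v \<in> ball (coding r t \<omega> u) e} \<in> sets (sym \<omega>)"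
        by (simp only: sets_sym) (intro coding_vimage_sets borel_open open_ball)
    qed
    finally show ?thesis by (simp add: emeasure_\<eta>)
  qed
  then show ?thesis by (simp add: msupp_def)
qed

text \<open>Self-similarity of the projected measure: separating the first digit from the
  independent rest writes it as a weighted sum of affine copies over the shifted environment. The
  condition \<open>first\<close> says that \<open>B\<close> meets only the copy with digit
  \<open>j\<close>, so a single term survives.\<close>

lemma emeasure_\<eta>_first_cylinder:
  assumes B [measurable]: "B \<in> sets borel"
    and first: "\<And>v. v \<in> code_space k \<omega> \<Longrightarrow> coding r t \<omega> v \<in> B \<Longrightarrow> v 0 = j"
  shows "emeasure (\<eta> \<omega>) B = ennreal (pmf (digit_pmf (\<omega> 0)) j) * emeasure (\<eta> (shift \<omega>)) {z. r (\<omega> 0) * z + t (\<omega> 0) j \<in> B}"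
proof -
  interpret S: prob_space "sym (shift \<omega>)" by (rule prob_space_sym)
  define A where "A = {w. r (\<omega> 0) * coding r t (shift \<omega>) w + t (\<omega> 0) j \<in> B}"
  have "{w \<in> space digits. r (\<omega> 0) * coding r t (shift \<omega>) w + t (\<omega> 0) j \<in> B} \<in> sets digits" by measurable
  then have A [measurable]: "A \<in> sets digits" by (simp add: A_def space_PiM)
  have tail: "shift \<in> digits \<rightarrow>\<^sub>M digits"
    unfolding shift_def by (rule measurable_PiM_single') (auto simp: space_PiM)
  have m1: "{v. coding r t \<omega> v \<in> B} \<in> sets digits" by (rule coding_vimage_sets[OF B])
  have "{v \<in> space digits. v 0 = j} \<inter> (shift -` A \<inter> space digits) \<in> sets digits"
    by (intro sets.Int measurable_sets[OF tail A]) measurable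
  then have m2: "{v. v 0 = j \<and> shift v \<in> A} \<in> sets digits"
    by (simp add: space_PiM vimage_def Int_def)
  have case_meas: "(\<lambda>(a, w). case_nat a w) \<in> digit_measure k p (\<omega> 0) \<Otimes>\<^sub>M sym (shift \<omega>) \<rightarrow>\<^sub>M sym \<omega>"
    using measurable_case_nat_PiM[of "\<lambda>n. digit_measure k p (\<omega> n)"] by (simp add: sym_measure_def shift_def)
  have distr: "distr (digit_measure k p (\<omega> 0) \<Otimes>\<^sub>M sym (shift \<omega>)) (sym \<omega>) (\<lambda>(a, w). case_nat a w) = sym \<omega>"
    using distr_case_nat_PiM[of "\<lambda>n. digit_measure k p (\<omega> n)"]
    by (simp add: sym_measure_def shift_def digit_measure_eq prob_space_measure_pmf)
  have "emeasure (\<eta> \<omega>) B = emeasure (sym \<omega>) {v. coding r t \<omega> v \<in> B}"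
    by (rule emeasure_\<eta>[OF B])
  also have "\<dots> = emeasure (sym \<omega>) {v. v 0 = j \<and> shift v \<in> A}"
  proof (rule emeasure_eq_AE)
    show "AE v in sym \<omega>. v \<in> {v. coding r t \<omega> v \<in> B} \<longleftrightarrow> v \<in> {v. v 0 = j \<and> shift v \<in> A}"
      using AE_code_space
    proof eventually_elim
      case (elim v)
      then show ?case using coding_step[OF elim] first[OF elim] by (auto simp: A_def)
    qed
  qed (use m1 m2 in auto)
  also have "\<dots> = emeasure (digit_measure k p (\<omega> 0) \<Otimes>\<^sub>M sym (shift \<omega>)) ({j} \<times> A)"
  proof (subst distr[symmetric], subst emeasure_distr[OF case_meas])
    show "emeasure (digit_measure k p (\<omega> 0) \<Otimes>\<^sub>M sym (shift \<omega>))
       ((\<lambda>(a, w). case_nat a w) -` {v. v 0 = j \<and> shift v \<in> A} \<inter> space (digit_measure k p (\<omega> 0) \<Otimes>\<^sub>M sym (shift \<omega>)))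
      = emeasure (digit_measure k p (\<omega> 0) \<Otimes>\<^sub>M sym (shift \<omega>)) ({j} \<times> A)"
      by (intro arg_cong2[where f=emeasure]) (auto simp: space_pair_measure digit_measure_eq shift_def)
  qed (use m2 in simp)
  also have "\<dots> = emeasure (digit_measure k p (\<omega> 0)) {j} * emeasure (sym (shift \<omega>)) A"
    by (intro S.emeasure_pair_measure_Times) (auto simp: digit_measure_eq)
  also have "emeasure (sym (shift \<omega>)) A = emeasure (\<eta> (shift \<omega>)) {z. r (\<omega> 0) * z + t (\<omega> 0) j \<in> B}"
  proof -
    have "{z \<in> space borel. r (\<omega> 0) * z + t (\<omega> 0) j \<in> B} \<in> sets borel" by measurable
    then show ?thesis by (subst emeasure_\<eta>) (auto simp: A_def)
  qed
  finally show ?thesis by (simp add: digit_measure_eq emeasure_pmf_single)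
qed

text \<open>Makes the digit law a Markov kernel in the environment, as mixing over environments
  requires. Cylinder masses are finite products of measurable factors.\<close>

lemma measurable_sym: "sym \<in> symbols \<rightarrow>\<^sub>M prob_algebra digits"
proof (rule measurable_prob_algebra_generated[OF sets_PiM Int_stable_prod_algebra prod_algebra_sets_into_space])
  show "prob_space (sym \<omega>)" for \<omega> by (rule prob_space_sym)
  fix A assume "A \<in> prod_algebra UNIV (\<lambda>_::nat. count_space (UNIV::nat set))"
  then obtain J E where J: "A = prod_emb UNIV (\<lambda>_. count_space UNIV) J (Pi\<^sub>E J E)" "finite J"
    by (rule prod_algebraE)
  have A_eq: "A = prod_emb UNIV (\<lambda>n. measure_pmf (digit_pmf (\<omega> n))) J (Pi\<^sub>E J E)" for \<omega>
    by (simp add: J prod_emb_def)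
  have "emeasure (sym \<omega>) A = (\<Prod>j\<in>J. emeasure (measure_pmf (digit_pmf (\<omega> j))) (E j))" for \<omega>
    unfolding sym_eq A_eq[of \<omega>] using J(2) by (intro emeasure_PiM_emb prob_space_measure_pmf) auto
  moreover have "(\<lambda>\<omega>. \<Prod>j\<in>J. emeasure (measure_pmf (digit_pmf (\<omega> j))) (E j)) \<in> borel_measurable symbols"
  proof (intro borel_measurable_prod_ennreal)
    fix j
    show "(\<lambda>\<omega>. emeasure (measure_pmf (digit_pmf (\<omega> j))) (E j)) \<in> borel_measurable symbols"
      by (rule measurable_compose[OF measurable_component_singleton[of j]]) auto
  qed
  ultimately show "(\<lambda>\<omega>. emeasure (sym \<omega>) A) \<in> borel_measurable symbols" by (simp only:)
qed (rule sets_sym)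

lemma measurable_\<eta>: "\<eta> \<in> symbols \<rightarrow>\<^sub>M prob_algebra borel"
  unfolding proj_measure_def
  by (rule measurable_distr_prob_space2[OF measurable_sym]) (simp add: split_beta' measurable_coding)

text \<open>Joint law of a system and a digit drawn from its weights; environment and digits
  together become one iid sequence of letters.\<close>

definition letter_pmf :: "'i pmf \<Rightarrow> ('i \<times> nat) pmf" where
  "letter_pmf q = bind_pmf q (\<lambda>i. map_pmf (Pair i) (digit_pmf i))"

lemma emeasure_letter_pmf:
  "emeasure (measure_pmf (letter_pmf q)) A = (\<integral>\<^sup>+i. emeasure (measure_pmf (digit_pmf i)) {a. (i, a) \<in> A} \<partial>measure_pmf q)"
  unfolding letter_pmf_def
  by (simp add: emeasure_bind_pmf emeasure_map_pmf vimage_def)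

text \<open>Disintegration: the iid law of letters is the mixture, over random environments, of the
  digit laws paired with their environment. The two are compared on cylinders, where both are
  products over the constrained places.\<close>

lemma AE_letters:
  assumes "AE x in PiM UNIV (\<lambda>_::nat. measure_pmf (letter_pmf q)). P x"
  shows "AE \<omega> in PiM UNIV (\<lambda>_. measure_pmf q). AE u in sym \<omega>. P (\<lambda>n. (\<omega> n, u n))"
proof -
  let ?P = "PiM UNIV (\<lambda>_::nat. measure_pmf q)" and ?L = "PiM UNIV (\<lambda>_::nat. measure_pmf (letter_pmf q))"
  let ?C = "PiM UNIV (\<lambda>_::nat. count_space (UNIV :: ('i \<times> nat) set))"
  let ?K = "\<lambda>\<omega>. distr (sym \<omega>) ?C (\<lambda>u n. (\<omega> n, u n))"
  interpret Q: product_prob_space "\<lambda>_::nat. measure_pmf q" UNIV ..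
  interpret L: product_prob_space "\<lambda>_::nat. measure_pmf (letter_pmf q)" UNIV ..
  have sets_P: "sets ?P = sets symbols" by (intro sets_PiM_cong) auto
  have sets_L: "sets ?L = sets ?C" by (intro sets_PiM_cong) auto
  have zip: "(\<lambda>(\<omega>, u) n. (\<omega> n, u n)) \<in> symbols \<Otimes>\<^sub>M digits \<rightarrow>\<^sub>M ?C"
  proof (rule measurable_PiM_single')
    fix n
    have "(\<lambda>x. (fst x n, snd x n)) \<in> symbols \<Otimes>\<^sub>M digits \<rightarrow>\<^sub>M count_space UNIV \<Otimes>\<^sub>M count_space UNIV"
      by measurable
    then show "(\<lambda>x. (case x of (\<omega>, u) \<Rightarrow> \<lambda>n. (\<omega> n, u n)) n) \<in> symbols \<Otimes>\<^sub>M digits \<rightarrow>\<^sub>M count_space UNIV"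
      by (simp add: pair_measure_countable split_beta')
  qed (simp add: space_PiM)
  have K0: "?K \<in> symbols \<rightarrow>\<^sub>M prob_algebra ?C"
    by (rule measurable_distr_prob_space2[OF measurable_sym zip])
  then have K: "?K \<in> ?P \<rightarrow>\<^sub>M prob_algebra ?C"
    by (simp only: measurable_cong_sets[OF sets_P refl])
  have zip1: "(\<lambda>u n. (\<omega> n, u n)) \<in> sym \<omega> \<rightarrow>\<^sub>M ?C" for \<omega>
    using measurable_compose[OF measurable_Pair1'[of \<omega> symbols digits] zip]
    by (simp add: space_PiM measurable_cong_sets[OF sets_sym refl])
  have P_prob: "?P \<in> space (prob_algebra ?P)"
    by (simp add: space_prob_algebra Q.prob_space_axioms)
  have L_eq: "?L = ?P \<bind> ?K"
  proof (rule measure_eqI_PiM_infinite[OF refl])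
    have "sets (?P \<bind> ?K) = sets ?C"
      by (rule sets_bind'[OF P_prob K])
    then show "sets (?P \<bind> ?K) = sets ?L" using sets_L by simp
    show "finite_measure ?L" by (rule L.finite_measure_axioms)
    fix A :: "nat \<Rightarrow> ('i \<times> nat) set" and J :: "nat set" assume J: "finite J"
    define g where "g j i = emeasure (measure_pmf (digit_pmf i)) {a. (i, a) \<in> A j}" for j i
    let ?X = "prod_emb UNIV (\<lambda>_. measure_pmf (letter_pmf q)) J (Pi\<^sub>E J A)"
    have X: "?X \<in> sets ?C"
      unfolding sets_L[symmetric] using J by (intro sets_PiM_I) auto
    have "emeasure (?P \<bind> ?K) ?X = (\<integral>\<^sup>+\<omega>. emeasure (?K \<omega>) ?X \<partial>?P)"
      by (rule emeasure_bind_prob_algebra[OF P_prob K X])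
    also have "\<dots> = (\<integral>\<^sup>+\<omega>. (\<Prod>j\<in>J. g j (\<omega> j)) \<partial>?P)"
    proof (rule nn_integral_cong)
      fix \<omega>
      have "emeasure (?K \<omega>) ?X = emeasure (sym \<omega>) ((\<lambda>u n. (\<omega> n, u n)) -` ?X \<inter> space (sym \<omega>))"
        by (rule emeasure_distr[OF zip1 X])
      also have "(\<lambda>u n. (\<omega> n, u n)) -` ?X \<inter> space (sym \<omega>)
          = prod_emb UNIV (\<lambda>n. measure_pmf (digit_pmf (\<omega> n))) J (\<Pi>\<^sub>E j\<in>J. {a. (\<omega> j, a) \<in> A j})"
        by (auto simp: prod_emb_def PiE_iff)
      also have "emeasure (sym \<omega>) \<dots> = (\<Prod>j\<in>J. g j (\<omega> j))"
        unfolding sym_eq g_def using J by (intro emeasure_PiM_emb prob_space_measure_pmf) auto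
      finally show "emeasure (?K \<omega>) ?X = (\<Prod>j\<in>J. g j (\<omega> j))" .
    qed
    also have "\<dots> = (\<integral>\<^sup>+\<omega>. (\<Prod>j\<in>J. g j (\<omega> j))
        \<partial>distr ?P (PiM J (\<lambda>_. measure_pmf q)) (\<lambda>\<omega>. restrict \<omega> J))"
    proof -
      have m: "(\<lambda>\<omega>. restrict \<omega> J) \<in> ?P \<rightarrow>\<^sub>M PiM J (\<lambda>_. measure_pmf q)"
        by (rule measurable_restrict_subset) simp
      have "(\<lambda>\<omega>. g j (\<omega> j)) \<in> borel_measurable (PiM J (\<lambda>_. measure_pmf q))" if "j \<in> J" for j
        using measurable_compose[OF measurable_component_singleton[OF that, of "\<lambda>_. measure_pmf q"], of "g j" borel]
        by simp
      then have "(\<lambda>\<omega>. \<Prod>j\<in>J. g j (\<omega> j)) \<in> borel_measurable (PiM J (\<lambda>_. measure_pmf q))"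
        by (rule borel_measurable_prod_ennreal)
      then show ?thesis
        by (subst nn_integral_distr[OF m]) (auto intro!: nn_integral_cong)
    qed
    also have "distr ?P (PiM J (\<lambda>_. measure_pmf q)) (\<lambda>\<omega>. restrict \<omega> J) = PiM J (\<lambda>_. measure_pmf q)"
      using J by (intro Q.distr_PiM_restrict_finite) auto
    also have "(\<integral>\<^sup>+\<omega>. (\<Prod>j\<in>J. g j (\<omega> j)) \<partial>PiM J (\<lambda>_. measure_pmf q))
        = (\<Prod>j\<in>J. (\<integral>\<^sup>+i. g j i \<partial>measure_pmf q))"
      using J by (intro Q.product_nn_integral_prod) auto
    also have "\<dots> = emeasure ?L ?X"
      using J by (simp add: L.emeasure_PiM_emb emeasure_letter_pmf g_def)
    finally show "emeasure ?L ?X = emeasure (?P \<bind> ?K) ?X" by simp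
  qed
  \<comment> \<open>\<open>P\<close> is arbitrary, so the kernel argument runs on a measurable null
    set containing its failures.\<close>
  obtain N where N: "N \<in> null_sets ?L" "{x \<in> space ?L. \<not> P x} \<subseteq> N"
    using assms by (auto elim: AE_E simp: null_sets_def)
  then have ae: "AE x in ?P \<bind> ?K. x \<notin> N" unfolding L_eq[symmetric] by (intro AE_not_in)
  have pred: "Measurable.pred ?C (\<lambda>x. x \<notin> N)"
    using N(1) sets_L by (auto simp: null_sets_def)
  have "AE \<omega> in ?P. AE x in ?K \<omega>. x \<notin> N"
    by (rule iffD1[OF AE_bind[OF measurable_prob_algebraD[OF K] pred] ae])
  then show ?thesis
  proof eventually_elim
    case (elim \<omega>)
    then have "AE u in sym \<omega>. (\<lambda>n. (\<omega> n, u n)) \<notin> N"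
      by (rule AE_distrD[OF zip1])
    then show ?case
      by eventually_elim (use N(2) in \<open>auto simp: space_PiM\<close>)
  qed
qed

end

section \<open>Generated distributions\<close>

abbreviation moment_monomial :: "nat list \<Rightarrow> real measure \<Rightarrow> real" where
  "moment_monomial l \<nu> \<equiv> prod_list (map (moments \<nu>) l)"

lemma measurable_moments [measurable]: "(\<lambda>\<nu>. moments \<nu> n) \<in> borel_measurable (prob_algebra Kbox)"
proof -
  have "(\<lambda>y::real. y ^ n) \<in> borel_measurable Kbox"
    by (intro continuous_on_measurable_Kbox continuous_intros)
  then show ?thesis
    unfolding moments_def prob_algebra_def
    by (intro measurable_restrict_space1 integral_measurable_subprob_algebra)
qed

lemma measurable_moment_monomial [measurable]:
  "(\<lambda>\<nu>. moment_monomial l \<nu>) \<in> borel_measurable (prob_algebra Kbox)"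
  by (induction l) simp_all

lemma abs_moment_monomial_le:
  assumes "\<nu> \<in> PK"
  shows "\<bar>moment_monomial l \<nu>\<bar> \<le> 1"
proof (induction l)
  case (Cons n l)
  then show ?case using abs_moments_le[OF assms, of n] by (simp add: abs_mult mult_le_one)
qed simp

lemma moment_algebra_bounded:
  assumes "F \<in> moment_algebra"
  shows "\<exists>B. \<forall>\<nu>\<in>PK. \<bar>F (moments \<nu>)\<bar> \<le> B"
  using assms
proof induction
  case (monomial l)
  then show ?case using abs_moment_monomial_le by blast
next
  case (scale F c)
  then obtain B where "\<forall>\<nu>\<in>PK. \<bar>F (moments \<nu>)\<bar> \<le> B" by blast
  then show ?case by (intro exI[of _ "\<bar>c\<bar> * B"]) (auto simp: abs_mult intro!: mult_left_mono)
next
  case (add F G)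
  then obtain B C where "\<forall>\<nu>\<in>PK. \<bar>F (moments \<nu>)\<bar> \<le> B" "\<forall>\<nu>\<in>PK. \<bar>G (moments \<nu>)\<bar> \<le> C" by blast
  then show ?case by (intro exI[of _ "B + C"]) (auto intro: order_trans[OF abs_triangle_ineq] add_mono)
qed

lemma measurable_moment_algebra:
  assumes "F \<in> moment_algebra"
  shows "(\<lambda>\<nu>. F (moments \<nu>)) \<in> borel_measurable (prob_algebra Kbox)"
  using assms by induction simp_all

text \<open>The \<sigma>-algebra is generated by evaluations on sets, not by the weak topology, so a
  continuous \<open>f\<close> needs an argument: it is a limit of measurable polynomials in the
  moments.\<close>

lemma measurable_weak_continuous:
  assumes f: "continuous_map weak_top euclideanreal f"
  shows "f \<in> borel_measurable (prob_algebra Kbox)"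
proof -
  have "\<exists>F\<in>moment_algebra. \<forall>\<nu>\<in>PK. \<bar>f \<nu> - F (moments \<nu>)\<bar> < 1 / Suc n" for n
    by (rule weak_top_approx[OF f, of "1 / Suc n"]) auto
  then obtain F where F: "\<And>n. F n \<in> moment_algebra"
      "\<And>n \<nu>. \<nu> \<in> PK \<Longrightarrow> \<bar>f \<nu> - F n (moments \<nu>)\<bar> < 1 / Suc n"
    by metis
  show ?thesis
  proof (rule borel_measurable_LIMSEQ_real)
    show "(\<lambda>\<nu>. F n (moments \<nu>)) \<in> borel_measurable (prob_algebra Kbox)" for n
      by (rule measurable_moment_algebra[OF F(1)])
    fix \<nu> assume "\<nu> \<in> space (prob_algebra Kbox)"
    then have \<nu>: "\<nu> \<in> PK" by (simp add: PK_def)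
    have "(\<lambda>n. F n (moments \<nu>) - f \<nu>) \<longlonglongrightarrow> 0"
    proof (rule Lim_null_comparison[OF always_eventually LIMSEQ_inverse_real_of_nat], rule allI)
      show "norm (F n (moments \<nu>) - f \<nu>) \<le> inverse (real (Suc n))" for n
        using F(2)[OF \<nu>, of n] by (simp add: abs_minus_commute inverse_eq_divide less_imp_le)
    qed
    then show "(\<lambda>n. F n (moments \<nu>)) \<longlonglongrightarrow> f \<nu>" by (simp add: LIM_zero_iff)
  qed
qed

lemma weak_continuous_bounded:
  assumes f: "continuous_map weak_top euclideanreal f"
  shows "\<exists>B. \<forall>\<nu>\<in>PK. \<bar>f \<nu>\<bar> \<le> B"
proof -
  obtain F where F: "F \<in> moment_algebra" "\<And>\<nu>. \<nu> \<in> PK \<Longrightarrow> \<bar>f \<nu> - F (moments \<nu>)\<bar> < 1"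
    using weak_top_approx[OF f, of 1] by auto
  obtain B where B: "\<forall>\<nu>\<in>PK. \<bar>F (moments \<nu>)\<bar> \<le> B" using moment_algebra_bounded[OF F(1)] by blast
  have "\<bar>f \<nu>\<bar> \<le> B + 1" if "\<nu> \<in> PK" for \<nu>
    using F(2)[OF that] bspec[OF B that] by linarith
  then show ?thesis by blast
qed

text \<open>Bounded integrands allow integer times to stand for real ones, linearity extends the
  limit from monomials to the moment algebra, and uniform approximation reaches every weakly
  continuous function. What remains in \<open>lim\<close> is a countable family of conditions, which
  almost sure convergence can supply.\<close>

lemma generates_atI:
  assumes \<mu>: "sets \<mu> = sets borel" "prob_space \<mu>" and x: "x \<in> msupp \<mu>"
    and Q: "prob_space Q" "sets Q = sets (prob_algebra Kbox)"
    and lim: "\<And>l. (\<lambda>n::nat. integral {0..real n} (\<lambda>s. moment_monomial l (zoom \<mu> x (exp (- s)))) / n)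
      \<longlonglongrightarrow> (\<integral>\<nu>. moment_monomial l \<nu> \<partial>Q)"
  shows "generates_at \<mu> x Q"
proof -
  interpret Q: prob_space Q by (rule Q)
  define Z where "Z s = zoom \<mu> x (exp (- s))" for s
  have Z_PK: "Z s \<in> PK" for s unfolding Z_def by (rule zoom_PK[OF \<mu>])
  have spQ: "space Q = PK" using sets_eq_imp_space_eq[OF Q(2)] by (simp add: PK_def)
  have "\<mu> \<in> space (prob_algebra borel)" using \<mu> by (simp add: space_prob_algebra)
  then have "(\<lambda>s::real. \<mu>) \<in> borel \<rightarrow>\<^sub>M prob_algebra borel" by simp
  then have Z_meas [measurable]: "Z \<in> borel \<rightarrow>\<^sub>M prob_algebra Kbox"
    unfolding Z_def by (rule measurable_zoom) auto
  have comp: "(\<lambda>s. g (Z s)) \<in> borel_measurable borel" if "g \<in> borel_measurable (prob_algebra Kbox)" for g :: "real measure \<Rightarrow> real"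
    by (rule measurable_compose[OF Z_meas that])
  have int: "integrable Q g" if "g \<in> borel_measurable (prob_algebra Kbox)" "\<forall>\<nu>\<in>PK. \<bar>g \<nu>\<bar> \<le> B" for g :: "real measure \<Rightarrow> real" and B
    using that by (intro Q.integrable_const_bound[where B=B]) (auto simp: spQ measurable_cong_sets[OF Q(2) refl])
  define avg where "avg g T = 1 / T * integral {0..T} (\<lambda>s. g (Z s))" for g :: "real measure \<Rightarrow> real" and T
  have F_lim: "(avg (\<lambda>\<nu>. F (moments \<nu>)) \<longlongrightarrow> (\<integral>\<nu>. F (moments \<nu>) \<partial>Q)) at_top" if "F \<in> moment_algebra" for F
    using that
  proof induction
    case (monomial l)
    have "((\<lambda>T. 1 / T * integral {0..0 + T} (\<lambda>s. moment_monomial l (Z s)))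
        \<longlongrightarrow> (\<integral>\<nu>. moment_monomial l \<nu> \<partial>Q)) at_top"
    proof (rule time_average_subsequence[where a=real and B=1 and C=1])
      show "(\<lambda>s. moment_monomial l (Z s)) \<in> borel_measurable borel"
        by (rule comp) measurable
      show "\<bar>moment_monomial l (Z s)\<bar> \<le> 1" for s by (rule abs_moment_monomial_le[OF Z_PK])
      show "\<exists>n. \<bar>real n - T\<bar> \<le> 1" if "0 \<le> T" for T
        using that by (intro exI[of _ "nat \<lfloor>T\<rfloor>"]) linarith
    qed (use lim[of l] in \<open>simp_all add: Z_def\<close>)
    then show ?case by (simp add: avg_def[abs_def])
  next
    case (scale F c)
    have "avg (\<lambda>\<nu>. c * F (moments \<nu>)) = (\<lambda>T. c * avg (\<lambda>\<nu>. F (moments \<nu>)) T)"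
      by (simp add: avg_def[abs_def])
    then show ?case using tendsto_mult[OF tendsto_const scale.IH, of c] by simp
  next
    case (add F G)
    obtain B C where B: "\<forall>\<nu>\<in>PK. \<bar>F (moments \<nu>)\<bar> \<le> B" and C: "\<forall>\<nu>\<in>PK. \<bar>G (moments \<nu>)\<bar> \<le> C"
      using moment_algebra_bounded[OF add.hyps(1)] moment_algebra_bounded[OF add.hyps(2)] by blast
    note mF = measurable_moment_algebra[OF add.hyps(1)] and mG = measurable_moment_algebra[OF add.hyps(2)]
    have "integral {0..T} (\<lambda>s. F (moments (Z s)) + G (moments (Z s)))
        = integral {0..T} (\<lambda>s. F (moments (Z s))) + integral {0..T} (\<lambda>s. G (moments (Z s)))" for T
      by (rule Henstock_Kurzweil_Integration.integral_add)
        (rule integrable_on_bounded_borel(1)[OF comp[OF mF], of B] integrable_on_bounded_borel(1)[OF comp[OF mG], of C],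
          use B C Z_PK in blast)+
    then have "avg (\<lambda>\<nu>. F (moments \<nu>) + G (moments \<nu>)) = (\<lambda>T. avg (\<lambda>\<nu>. F (moments \<nu>)) T + avg (\<lambda>\<nu>. G (moments \<nu>)) T)"
      by (simp add: avg_def[abs_def] add_divide_distrib)
    moreover have "(\<integral>\<nu>. F (moments \<nu>) + G (moments \<nu>) \<partial>Q) = (\<integral>\<nu>. F (moments \<nu>) \<partial>Q) + (\<integral>\<nu>. G (moments \<nu>) \<partial>Q)"
      by (rule Bochner_Integration.integral_add[OF int[OF mF B] int[OF mG C]])
    ultimately show ?case using tendsto_add[OF add.IH] by simp
  qed
  have f_lim: "(avg f \<longlongrightarrow> (\<integral>\<nu>. f \<nu> \<partial>Q)) at_top" if f: "continuous_map weak_top euclideanreal f" for f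
  proof (rule tendstoI)
    fix e :: real assume e: "0 < e"
    obtain F where F: "F \<in> moment_algebra" "\<And>\<nu>. \<nu> \<in> PK \<Longrightarrow> \<bar>f \<nu> - F (moments \<nu>)\<bar> < e / 4"
      using weak_top_approx[OF f, of "e / 4"] e by auto
    obtain B where B: "\<forall>\<nu>\<in>PK. \<bar>F (moments \<nu>)\<bar> \<le> B" using moment_algebra_bounded[OF F(1)] by blast
    obtain C where C: "\<forall>\<nu>\<in>PK. \<bar>f \<nu>\<bar> \<le> C" using weak_continuous_bounded[OF f] by blast
    note mF = measurable_moment_algebra[OF F(1)] and mf = measurable_weak_continuous[OF f]
    have intQ: "\<bar>(\<integral>\<nu>. f \<nu> \<partial>Q) - (\<integral>\<nu>. F (moments \<nu>) \<partial>Q)\<bar> \<le> e / 4"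
    proof -
      have "\<bar>(\<integral>\<nu>. f \<nu> \<partial>Q) - (\<integral>\<nu>. F (moments \<nu>) \<partial>Q)\<bar> = \<bar>\<integral>\<nu>. f \<nu> - F (moments \<nu>) \<partial>Q\<bar>"
        by (simp add: int[OF mF B] int[OF mf C])
      also have "\<dots> \<le> (\<integral>\<nu>. \<bar>f \<nu> - F (moments \<nu>)\<bar> \<partial>Q)" by (rule integral_abs_bound)
      also have "\<dots> \<le> (\<integral>\<nu>. e / 4 \<partial>Q)"
        using F(2) by (intro integral_mono_AE) (auto simp: int[OF mF B] int[OF mf C] spQ less_imp_le)
      finally show ?thesis by (simp add: Q.prob_space)
    qed
    have avg_le: "\<bar>avg f T - avg (\<lambda>\<nu>. F (moments \<nu>)) T\<bar> \<le> e / 4" if T: "0 < T" for T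
    proof -
      have "integral {0..T} (\<lambda>s. f (Z s)) - integral {0..T} (\<lambda>s. F (moments (Z s)))
          = integral {0..T} (\<lambda>s. f (Z s) - F (moments (Z s)))"
        by (rule Henstock_Kurzweil_Integration.integral_diff[symmetric])
          (rule integrable_on_bounded_borel(1)[OF comp[OF mF], of B] integrable_on_bounded_borel(1)[OF comp[OF mf], of C],
            use B C Z_PK in blast)+
      moreover have "\<bar>integral {0..T} (\<lambda>s. f (Z s) - F (moments (Z s)))\<bar> \<le> e / 4 * (T - 0)"
        using F(2)[OF Z_PK] T by (intro integral_bounded_le borel_measurable_diff comp[OF mF] comp[OF mf]) (auto simp: less_imp_le)
      ultimately have "\<bar>integral {0..T} (\<lambda>s. f (Z s)) - integral {0..T} (\<lambda>s. F (moments (Z s)))\<bar> \<le> e / 4 * T"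
        by simp
      moreover have "avg f T - avg (\<lambda>\<nu>. F (moments \<nu>)) T
          = (integral {0..T} (\<lambda>s. f (Z s)) - integral {0..T} (\<lambda>s. F (moments (Z s)))) / T"
        by (simp add: avg_def diff_divide_distrib)
      ultimately show ?thesis using T by (simp add: abs_divide divide_le_eq)
    qed
    show "\<forall>\<^sub>F T in at_top. dist (avg f T) (\<integral>\<nu>. f \<nu> \<partial>Q) < e"
      \<comment> \<open>The numeral spelled out is 4. Three errors of at most \<open>e / 4\<close>
        are added: replacing \<open>f\<close> in the average, the convergence for \<open>F\<close>,
        and replacing \<open>f\<close> in the integral.\<close>
      using tendstoD[OF F_lim[OF F(1)] divide_pos_pos[OF e zero_less_numeral[of "num.Bit0 (num.Bit0 num.One)"]]] eventually_gt_at_top[of 0]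
    proof (eventually_elim, goal_cases)
      case (1 T)
      have tri: "\<bar>a - d\<bar> < e" if "\<bar>a - b\<bar> \<le> e / 4" "\<bar>b - c\<bar> < e / 4" "\<bar>d - c\<bar> \<le> e / 4" for a b c d :: real
        using that e by linarith
      show ?case using tri[OF avg_le _ intQ] 1 by (simp add: dist_real_def)
    qed
  qed
  have "scaling s (blowup \<mu> x) = Z s" if "0 \<le> s" for s
    unfolding blowup_eq_zoom[OF \<mu> x] Z_def using scaling_zoom[OF \<mu> x _ that, of 1] by simp
  then have "(\<lambda>T. (1 / T) * integral {0..T} (\<lambda>s. f (scaling s (blowup \<mu> x)))) = avg f" for f
    unfolding avg_def by (intro ext arg_cong2[where f="(*)"] refl Henstock_Kurzweil_Integration.integral_cong) simp
  then show ?thesis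
    unfolding generates_at_def using x f_lim by simp
qed

section \<open>The scenery distribution of a Bernoulli model\<close>

locale bernoulli_model = ifs_family k r t p
  for k :: "'i::finite \<Rightarrow> nat" and r :: "'i \<Rightarrow> real" and t p :: "'i \<Rightarrow> nat \<Rightarrow> real" +
  fixes q :: "'i pmf" and \<delta> :: real
  assumes \<delta>_pos: "0 < \<delta>" and \<delta>_lt1: "\<delta> < 1"
    and separation: "\<And>\<omega> u v. u \<in> code_space k \<omega> \<Longrightarrow> v \<in> code_space k \<omega> \<Longrightarrow> u 0 \<noteq> v 0 \<Longrightarrow>
      \<delta> \<le> \<bar>coding r t \<omega> u - coding r t \<omega> v\<bar>"
    and nontrivial: "AE \<omega> in PiM UNIV (\<lambda>_::nat. measure_pmf q). \<forall>x. emeasure (\<eta> \<omega>) {x} = 0"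
begin

sublocale signed_iid "letter_pmf q" "\<lambda>a. r (fst a) < 0" .

abbreviation env :: "(nat \<Rightarrow> 'i \<times> nat) \<Rightarrow> nat \<Rightarrow> 'i" where
  "env x \<equiv> \<lambda>n. fst (x n)"

abbreviation dig :: "(nat \<Rightarrow> 'i \<times> nat) \<Rightarrow> nat \<Rightarrow> nat" where
  "dig x \<equiv> \<lambda>n. snd (x n)"

abbreviation admissible :: "(nat \<Rightarrow> 'i \<times> nat) \<Rightarrow> bool" where
  "admissible x \<equiv> dig x \<in> code_space k (env x)"

abbreviation pt :: "(nat \<Rightarrow> 'i \<times> nat) \<Rightarrow> real" where
  "pt x \<equiv> coding r t (env x) (dig x)"

definition orientation :: "bool \<Rightarrow> real" where
  "orientation b = (if b then -1 else 1)"

text \<open>Below scale \<open>\<delta>\<close> the window around a point only meets the first-level cylinder of that point,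
  so zooming in by \<open>r\<close> of the first letter amounts to shifting the letters, up to a reflection.\<close>
definition scenery :: "bool \<times> (nat \<Rightarrow> 'i \<times> nat) \<Rightarrow> real \<Rightarrow> real measure" where
  "scenery y \<tau> = zoom (\<eta> (env (snd y))) (pt (snd y)) (orientation (fst y) * \<delta> * exp (- \<tau>))"

definition roof :: "bool \<times> (nat \<Rightarrow> 'i \<times> nat) \<Rightarrow> real" where
  "roof y = - ln \<bar>r (fst (snd y 0))\<bar>"

lemma rmax_pos: "0 < rmax"
proof -
  have "0 < \<bar>r undefined\<bar>" using r_ne0 by simp
  also have "\<dots> \<le> rmax" by (rule rmax(3))
  finally show ?thesis .
qed

lemma measurable_env: "env \<in> iid \<rightarrow>\<^sub>M symbols"
  by (rule measurable_PiM_single') (auto simp: space_PiM intro!: measurable_compose[OF measurable_component_singleton])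

lemma measurable_dig: "dig \<in> iid \<rightarrow>\<^sub>M digits"
  by (rule measurable_PiM_single') (auto simp: space_PiM intro!: measurable_compose[OF measurable_component_singleton])

lemma measurable_fst_skew: "(\<lambda>y. orientation (fst y)) \<in> borel_measurable skew_measure"
  by (subst measurable_cong_sets[OF sets_skew_measure refl]) (rule measurable_compose[OF measurable_fst], simp)

lemma measurable_roof: "roof \<in> borel_measurable skew_measure"
  unfolding roof_def
  by (rule measurable_compose[OF measurable_snd_skew measurable_coordinate])

sublocale suspension skew_measure skew roof "- ln rmax" "Max (range (\<lambda>i. - ln \<bar>r i\<bar>))"
proof
  show "roof \<in> borel_measurable skew_measure" by (rule measurable_roof)
  show "0 < - ln rmax" using rmax(2) rmax_pos by simp
  show "- ln rmax \<le> roof y" for y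
    unfolding roof_def using rmax(3) r_ne0 rmax_pos by simp
  show "roof y \<le> Max (range (\<lambda>i. - ln \<bar>r i\<bar>))" for y
    unfolding roof_def by (intro Max_ge) auto
qed

lemma AE_dig: "AE x in iid. admissible x"
proof -
  have "AE x in iid. snd (x n) \<in> {1..k (fst (x n))}" for n
  proof (rule AE_PiM_component[of UNIV "\<lambda>_. measure_pmf (letter_pmf q)" n "\<lambda>a. snd a \<in> {1..k (fst a)}"])
    show "AE a in measure_pmf (letter_pmf q). snd a \<in> {1..k (fst a)}"
      by (auto simp: AE_measure_pmf_iff letter_pmf_def set_digit_pmf)
  qed (auto simp: prob_space_measure_pmf)
  then show ?thesis
    unfolding code_space_def mem_Collect_eq AE_all_countable by blast
qed

lemma measurable_pred_dig: "Measurable.pred skew_measure (\<lambda>y. admissible (snd y))"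
proof -
  have "Measurable.pred iid (\<lambda>x. snd (x n) \<in> {1..k (fst (x n))})" for n
    by (rule measurable_compose[OF measurable_component_singleton]) auto
  then have "Measurable.pred iid (\<lambda>x. admissible x)"
    unfolding code_space_def by simp
  then show ?thesis by (rule measurable_compose[OF measurable_snd_skew])
qed

lemma AE_skew_dig: "AE y in skew_measure. admissible (snd y)"
  by (rule AE_skewI[OF measurable_pred_dig]) (simp add: AE_dig)

section \<open>Covariance of sceneries under scaling and under the skew product\<close>

lemma scenery_scale_ne0: "orientation b * \<delta> * exp (- \<tau>) \<noteq> 0"
  using \<delta>_pos by (simp add: orientation_def)

lemma scenery_PK: "scenery y \<tau> \<in> PK"
  unfolding scenery_def by (rule zoom_PK[OF sets_\<eta> prob_space_\<eta>])

lemma scenery_Mbox: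
  assumes "admissible (snd y)"
  shows "scenery y \<tau> \<in> Mbox"
  unfolding scenery_def
  by (rule zoom_Mbox[OF sets_\<eta> prob_space_\<eta> coding_in_msupp[OF assms] scenery_scale_ne0])

lemma scaling_scenery:
  assumes "admissible (snd y)" and "0 \<le> s"
  shows "scaling s (scenery y \<tau>) = scenery y (\<tau> + s)"
  unfolding scenery_def
  using scaling_zoom[OF sets_\<eta> prob_space_\<eta> coding_in_msupp[OF assms(1)] scenery_scale_ne0 assms(2)]
  by (simp add: exp_add[symmetric] mult.assoc)

text \<open>At time \<open>\<tau> + roof y\<close> the radius is at most \<open>\<delta>\<close>
  times the modulus of the first ratio. This is strictly below \<delta> already at
  \<open>\<tau> = 0\<close>, so any point coded in the window has the same first digit.
  Self-similarity and \<open>zoom_affine\<close> then pass to the shifted letters.\<close>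

lemma scenery_roof:
  assumes y: "admissible (snd y)" and \<tau>: "0 \<le> \<tau>"
  shows "scenery y (\<tau> + roof y) = scenery (skew y) \<tau>"
proof -
  obtain b x where bx: "y = (b, x)" by (cases y)
  define \<omega> where "\<omega> = env x"
  define u where "u = dig x"
  define \<rho> where "\<rho> = r (\<omega> 0)"
  define s where "s = orientation b * \<delta> * exp (- \<tau>) * \<bar>\<rho>\<bar>"
  have u: "u \<in> code_space k \<omega>" using y by (simp add: bx u_def \<omega>_def)
  have \<rho>: "\<rho> \<noteq> 0" "\<bar>\<rho>\<bar> < 1" using r_ne0 r_lt1 by (auto simp: \<rho>_def)
  have s_ne0: "s \<noteq> 0" using scenery_scale_ne0 \<rho> by (simp add: s_def)
  have "\<bar>s\<bar> = \<delta> * (exp (- \<tau>) * \<bar>\<rho>\<bar>)"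
    using \<delta>_pos by (simp add: s_def orientation_def abs_mult)
  also have "\<dots> < \<delta> * 1"
    using \<delta>_pos \<rho> \<tau> by (intro mult_strict_left_mono) (auto intro: le_less_trans[OF mult_left_le_one_le])
  finally have s_lt: "\<bar>s\<bar> < \<delta>" by simp
  have pt: "coding r t \<omega> u = \<rho> * coding r t (shift \<omega>) (shift u) + t (\<omega> 0) (u 0)"
    unfolding \<rho>_def by (rule coding_step[OF u])
  have "zoom (\<eta> \<omega>) (\<rho> * coding r t (shift \<omega>) (shift u) + t (\<omega> 0) (u 0)) s
      = zoom (\<eta> (shift \<omega>)) (coding r t (shift \<omega>) (shift u)) (s / \<rho>)"
  proof (rule zoom_affine[OF sets_\<eta> prob_space_\<eta> sets_\<eta> prob_space_\<eta> \<rho>(1) s_ne0])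
    show "ennreal (pmf (digit_pmf (\<omega> 0)) (u 0)) \<noteq> 0"
      using u p_pos[of "u 0" "\<omega> 0"] by (auto simp: pmf_digit_pmf code_space_def ennreal_eq_0_iff not_le)
    fix B assume B: "B \<in> sets borel" "B \<subseteq> cball (\<rho> * coding r t (shift \<omega>) (shift u) + t (\<omega> 0) (u 0)) \<bar>s\<bar>"
    show "emeasure (\<eta> \<omega>) B = ennreal (pmf (digit_pmf (\<omega> 0)) (u 0)) * emeasure (\<eta> (shift \<omega>)) {z. \<rho> * z + t (\<omega> 0) (u 0) \<in> B}"
      unfolding \<rho>_def
    proof (rule emeasure_\<eta>_first_cylinder[OF B(1)])
      fix v assume v: "v \<in> code_space k \<omega>" "coding r t \<omega> v \<in> B"
      have "\<bar>coding r t \<omega> u - coding r t \<omega> v\<bar> \<le> \<bar>s\<bar>"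
        using B(2) v(2) unfolding pt[symmetric] by (auto simp: dist_real_def)
      with s_lt separation[OF u v(1)] show "v 0 = u 0" by fastforce
    qed
  qed simp
  then have main: "zoom (\<eta> \<omega>) (coding r t \<omega> u) s = zoom (\<eta> (shift \<omega>)) (coding r t (shift \<omega>) (shift u)) (s / \<rho>)"
    by (simp only: pt)
  have "exp (- roof y) = \<bar>\<rho>\<bar>"
    using \<rho> by (simp add: roof_def bx \<rho>_def \<omega>_def)
  then have ex: "exp (- (\<tau> + roof y)) = exp (- \<tau>) * \<bar>\<rho>\<bar>"
    by (metis exp_add minus_add_distrib)
  have fy: "fst y = b" "snd y = x" by (simp_all add: bx)
  have "scenery y (\<tau> + roof y) = zoom (\<eta> \<omega>) (coding r t \<omega> u) s"
    unfolding scenery_def ex fy s_def \<omega>_def u_def by (simp only: mult.assoc)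
  also have "\<dots> = scenery (skew y) \<tau>"
  proof -
    \<comment> \<open>The quotient of \<open>\<bar>\<rho>\<bar>\<close> by \<open>\<rho>\<close> is
      the sign of the ratio, and \<open>skew\<close> applies precisely this sign to the bit.\<close>
    have "s / \<rho> = orientation (b \<noteq> (\<rho> < 0)) * \<delta> * exp (- \<tau>)"
      using \<rho> by (auto simp: s_def orientation_def abs_if)
    then show ?thesis
      unfolding main by (simp add: scenery_def skew_def bx \<omega>_def u_def \<rho>_def shift_def)
  qed
  finally show ?thesis .
qed

lemma measurable_scenery: "case_prod scenery \<in> skew_measure \<Otimes>\<^sub>M borel \<rightarrow>\<^sub>M prob_algebra Kbox"
  unfolding scenery_def split_beta'
proof (rule measurable_zoom)
  have x: "(\<lambda>z. snd (fst z)) \<in> skew_measure \<Otimes>\<^sub>M borel \<rightarrow>\<^sub>M iid"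
    by (rule measurable_compose[OF measurable_fst measurable_snd_skew])
  note env = measurable_compose[OF x measurable_env] and dig = measurable_compose[OF x measurable_dig]
  show "(\<lambda>z. \<eta> (env (snd (fst z)))) \<in> skew_measure \<Otimes>\<^sub>M borel \<rightarrow>\<^sub>M prob_algebra borel"
    by (rule measurable_compose[OF env measurable_\<eta>])
  show "(\<lambda>z. pt (snd (fst z))) \<in> borel_measurable (skew_measure \<Otimes>\<^sub>M borel)"
    by (rule measurable_coding[OF env dig])
  have "(\<lambda>z. orientation (fst (fst z))) \<in> borel_measurable (skew_measure \<Otimes>\<^sub>M borel)"
    by (rule measurable_compose[OF measurable_fst measurable_fst_skew])
  then show "(\<lambda>z. orientation (fst (fst z)) * \<delta> * exp (- snd z)) \<in> borel_measurable (skew_measure \<Otimes>\<^sub>M borel)"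
    by measurable
qed

section \<open>Invariance, ergodicity and non-triviality of the scenery distribution\<close>

definition scenery_distribution :: "real measure measure" where
  "scenery_distribution = distr suspension_measure (prob_algebra Kbox) (case_prod scenery)"

lemma measurable_scenery_suspension: "case_prod scenery \<in> suspension_measure \<rightarrow>\<^sub>M prob_algebra Kbox"
  by (subst measurable_cong_sets[OF sets_suspension refl]) (rule measurable_scenery)

lemma prob_space_scenery_distribution: "prob_space scenery_distribution"
  unfolding scenery_distribution_def
  by (rule prob_space.prob_space_distr[OF prob_space_suspension measurable_scenery_suspension])

lemma sets_scenery_distribution: "sets scenery_distribution = sets (prob_algebra Kbox)"
  by (simp add: scenery_distribution_def)

lemma AE_scenery_distribution:
  assumes A: "A \<in> sets (prob_algebra Kbox)" and ae: "AE y in skew_measure. \<forall>\<tau>. scenery y \<tau> \<in> A"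
  shows "AE \<nu> in scenery_distribution. \<nu> \<in> A"
proof -
  have "Measurable.pred (prob_algebra Kbox) (\<lambda>\<nu>. \<nu> \<in> A)" using A by simp
  from measurable_compose[OF measurable_scenery this]
  have "Measurable.pred (skew_measure \<Otimes>\<^sub>M borel) (case_prod (\<lambda>y \<tau>. scenery y \<tau> \<in> A))"
    by (simp add: split_beta')
  from AE_suspension[OF ae this]
  have "AE y in suspension_measure. case_prod scenery y \<in> A" by (simp add: split_beta')
  then show ?thesis
    unfolding scenery_distribution_def
    using sets.sets_into_space[OF A] A
    by (subst AE_distr_iff[OF measurable_scenery_suspension]) auto
qed

lemma scenery_distribution_on_Mbox: "distribution_on_Mbox scenery_distribution"
  unfolding distribution_on_Mbox_def
proof (intro conjI prob_space_scenery_distribution sets_scenery_distribution AE_scenery_distribution Mbox_sets)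
  show "AE y in skew_measure. \<forall>\<tau>. scenery y \<tau> \<in> Mbox"
    using AE_skew_dig by eventually_elim (simp add: scenery_Mbox)
qed

lemma emeasure_scenery_distribution:
  assumes A: "A \<in> sets (prob_algebra Kbox)"
  shows "emeasure scenery_distribution A = (\<integral>\<^sup>+(y, \<tau>). indicator A (scenery y \<tau>) \<partial>suspension_measure)"
proof -
  have "emeasure scenery_distribution A = (\<integral>\<^sup>+\<nu>. indicator A \<nu> \<partial>scenery_distribution)"
    using A by (simp add: sets_scenery_distribution)
  also have "\<dots> = (\<integral>\<^sup>+z. indicator A (case_prod scenery z) \<partial>suspension_measure)"
    unfolding scenery_distribution_def using A by (intro nn_integral_distr[OF measurable_scenery_suspension]) simp
  finally show ?thesis by (simp add: split_beta')
qed

lemma measurable_indicator_scenery: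
  assumes "A \<in> sets (prob_algebra Kbox)"
  shows "(\<lambda>(y, \<tau>). indicator A (scenery y \<tau>) :: ennreal) \<in> borel_measurable (skew_measure \<Otimes>\<^sub>M borel)"
  using measurable_compose[OF measurable_scenery borel_measurable_indicator[OF assms]] by (simp add: split_beta')

text \<open>On sceneries, scaling is translation of time, and the suspension measure is invariant
  under it for functions obeying the roof identity.\<close>

lemma S_invariant_scenery_distribution: "S_invariant scenery_distribution"
  unfolding S_invariant_def
proof (intro allI impI ballI)
  fix s :: real and A assume s: "0 \<le> s" and "A \<in> sets scenery_distribution"
  then have A: "A \<in> sets (prob_algebra Kbox)" by (simp add: sets_scenery_distribution)
  let ?B = "{\<nu> \<in> Mbox. scaling s \<nu> \<in> A}"
  have B: "?B \<in> sets (prob_algebra Kbox)" by (rule scaling_preimage_sets[OF A s])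
  note mA = measurable_indicator_scenery[OF A] and mB = measurable_indicator_scenery[OF B]
  have "(\<lambda>z. (fst z, snd z + s)) \<in> skew_measure \<Otimes>\<^sub>M borel \<rightarrow>\<^sub>M skew_measure \<Otimes>\<^sub>M borel"
    by measurable
  from measurable_compose[OF this mA]
  have mA': "(\<lambda>(y, \<tau>). indicator A (scenery y (\<tau> + s)) :: ennreal) \<in> borel_measurable (skew_measure \<Otimes>\<^sub>M borel)"
    by (simp add: split_beta')
  have "emeasure scenery_distribution ?B = (\<integral>\<^sup>+(y, \<tau>). indicator ?B (scenery y \<tau>) \<partial>suspension_measure)"
    by (rule emeasure_scenery_distribution[OF B])
  also have "\<dots> = (\<integral>\<^sup>+(y, \<tau>). indicator A (scenery y (\<tau> + s)) \<partial>suspension_measure)"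
    unfolding nn_integral_suspension[OF mB] nn_integral_suspension[OF mA']
  proof (intro arg_cong2[where f="(/)"] refl nn_integral_cong_AE)
    show "AE y in skew_measure. (\<integral>\<^sup>+\<tau>. indicator ?B (scenery y \<tau>) * indicator {0..<roof y} \<tau> \<partial>lborel)
      = (\<integral>\<^sup>+\<tau>. indicator A (scenery y (\<tau> + s)) * indicator {0..<roof y} \<tau> \<partial>lborel)"
      using AE_skew_dig
    proof eventually_elim
      case (elim y)
      have "indicator ?B (scenery y \<tau>) = (indicator A (scenery y (\<tau> + s)) :: ennreal)" for \<tau>
        using scenery_Mbox[OF elim] scaling_scenery[OF elim s] by (simp add: indicator_def)
      then show ?case by simp
    qed
  qed
  also have "\<dots> = (\<integral>\<^sup>+(y, \<tau>). indicator A (scenery y \<tau>) \<partial>suspension_measure)"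
  proof (rule nn_integral_suspension_shift[OF mA _ _ s])
    show "AE y in skew_measure. \<forall>\<tau>\<ge>0. indicator A (scenery y (\<tau> + roof y)) = (indicator A (scenery (skew y) \<tau>) :: ennreal)"
      using AE_skew_dig by eventually_elim (simp add: scenery_roof)
    show "indicator A (scenery y \<tau>) \<le> (1 :: ennreal)" for y \<tau>
      by (simp split: split_indicator)
  qed
  also have "\<dots> = emeasure scenery_distribution A"
    by (rule emeasure_scenery_distribution[OF A, symmetric])
  finally show "emeasure scenery_distribution ?B = emeasure scenery_distribution A" .
qed

text \<open>For an invariant \<open>A\<close>, membership of \<open>scenery y \<tau>\<close> does
  not depend on \<open>\<tau>\<close>. It is therefore a property of the base point, and the roof
  identity makes it invariant under \<open>skew\<close>, whose ergodicity decides it.\<close>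

lemma S_ergodic_scenery_distribution: "S_ergodic scenery_distribution"
  unfolding S_ergodic_def
proof (intro conjI ballI impI S_invariant_scenery_distribution)
  interpret Q: prob_space scenery_distribution by (rule prob_space_scenery_distribution)
  fix A assume "A \<in> sets scenery_distribution" and inv: "\<forall>s\<ge>0. {\<nu> \<in> Mbox. scaling s \<nu> \<in> A} = A \<inter> Mbox"
  then have A: "A \<in> sets (prob_algebra Kbox)" by (simp add: sets_scenery_distribution)
  have inv': "scaling s \<nu> \<in> A \<longleftrightarrow> \<nu> \<in> A" if "\<nu> \<in> Mbox" "0 \<le> s" for \<nu> s
    using inv that by blast
  \<comment> \<open>Scaling only moves forward in time: for negative \<open>\<tau>\<close> the
    scenery at \<open>\<tau>\<close> is scaled up to time 0, otherwise the one at 0 is scaled to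
    \<open>\<tau>\<close>.\<close>
  have zero: "scenery y \<tau> \<in> A \<longleftrightarrow> scenery y 0 \<in> A" if y: "admissible (snd y)" for y \<tau>
  proof (cases "0 \<le> \<tau>")
    case True
    then show ?thesis using inv'[OF scenery_Mbox[OF y] True, of 0] scaling_scenery[OF y True, of 0] by simp
  next
    case False
    then show ?thesis using inv'[OF scenery_Mbox[OF y], of "- \<tau>" \<tau>] scaling_scenery[OF y, of "- \<tau>" \<tau>] by simp
  qed
  define A' where "A' = {y \<in> space skew_measure. scenery y 0 \<in> A}"
  have "(\<lambda>y. scenery y 0) \<in> skew_measure \<rightarrow>\<^sub>M prob_algebra Kbox"
    using measurable_compose[OF measurable_Pair2'[of 0 borel skew_measure] measurable_scenery] by simp
  from measurable_sets[OF this A] have A'_sets: "A' \<in> sets skew_measure"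
    by (simp add: A'_def vimage_def Int_def conj_commute)
  have A'_inv: "AE y in skew_measure. y \<in> A' \<longleftrightarrow> skew y \<in> A'"
    using AE_skew_dig AE_space
  proof eventually_elim
    case (elim y)
    have "skew y \<in> space skew_measure" using measurable_space[OF measurable_skew elim(2)] .
    moreover have "scenery (skew y) 0 \<in> A \<longleftrightarrow> scenery y 0 \<in> A"
      using scenery_roof[OF elim(1) order_refl] zero[OF elim(1), of "0 + roof y"] by (simp only:)
    ultimately show ?case using elim(2) by (simp only: A'_def mem_Collect_eq)
  qed
  from skew_trivial[OF A'_sets A'_inv]
  show "emeasure scenery_distribution A = 0 \<or> emeasure scenery_distribution A = 1"
  proof
    assume "AE y in skew_measure. y \<in> A'"
    with AE_skew_dig have "AE y in skew_measure. \<forall>\<tau>. scenery y \<tau> \<in> A"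
    proof eventually_elim
      case (elim y)
      then have "scenery y 0 \<in> A" by (simp add: A'_def)
      with zero[OF elim(1)] show ?case by blast
    qed
    from AE_scenery_distribution[OF A this] have "emeasure scenery_distribution A = 1"
      using A by (intro Q.emeasure_eq_1_AE) (auto simp: sets_scenery_distribution)
    then show ?thesis ..
  next
    assume "AE y in skew_measure. y \<notin> A'"
    with AE_skew_dig AE_space have "AE y in skew_measure. \<forall>\<tau>. scenery y \<tau> \<in> space (prob_algebra Kbox) - A"
    proof eventually_elim
      case (elim y)
      then have "scenery y 0 \<notin> A" by (simp add: A'_def)
      with zero[OF elim(1)] have "scenery y \<tau> \<notin> A" for \<tau> by blast
      then show ?case using scenery_PK[of y] by (simp add: PK_def)
    qed
    from AE_scenery_distribution[OF sets.compl_sets[OF A] this]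
    have ae: "AE \<nu> in scenery_distribution. \<nu> \<notin> A" by eventually_elim simp
    have SA: "A \<in> sets scenery_distribution" using A by (simp add: sets_scenery_distribution)
    have "{\<nu> \<in> space scenery_distribution. \<not> \<nu> \<notin> A} = A"
      using sets.sets_into_space[OF SA] by auto
    from iffD1[OF AE_iff_measurable[OF SA this] ae] have "emeasure scenery_distribution A = 0" .
    then show ?thesis ..
  qed
qed

text \<open>Forgetting the digit of each letter maps the iid letter law to the law of the
  environment, since the first marginal of \<open>letter_pmf q\<close> is \<open>q\<close>.\<close>

lemma AE_env:
  assumes "AE \<omega> in PiM UNIV (\<lambda>_::nat. measure_pmf q). P \<omega>"
  shows "AE x in iid. P (env x)"
proof -
  let ?P = "PiM UNIV (\<lambda>_::nat. measure_pmf q)"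
  interpret Q: product_prob_space "\<lambda>_::nat. measure_pmf q" UNIV ..
  interpret L: product_prob_space "\<lambda>_::nat. measure_pmf (letter_pmf q)" UNIV ..
  have env: "env \<in> iid \<rightarrow>\<^sub>M ?P"
    using measurable_env by (simp cong: measurable_cong_sets sets_PiM_cong)
  have marginal: "map_pmf fst (letter_pmf q) = q"
    by (simp add: letter_pmf_def map_bind_pmf pmf.map_comp o_def bind_return_pmf')
  have "distr iid ?P env = ?P"
  proof (rule Q.PiM_eq)
    fix J :: "nat set" and F assume J: "finite J"
    let ?X = "prod_emb UNIV (\<lambda>_. measure_pmf q) J (Pi\<^sub>E J F)"
    have "?X \<in> sets ?P"
      using J by (intro sets_PiM_I) auto
    then have "emeasure (distr iid ?P env) (?X)
        = emeasure iid (env -` ?X \<inter> space iid)"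
      by (rule emeasure_distr[OF env])
    also have "env -` ?X \<inter> space iid
        = prod_emb UNIV (\<lambda>_. measure_pmf (letter_pmf q)) J (\<Pi>\<^sub>E j\<in>J. fst -` F j)"
      by (auto simp: prod_emb_def PiE_iff space_PiM)
    also have "emeasure iid \<dots> = (\<Prod>j\<in>J. emeasure (measure_pmf (letter_pmf q)) (fst -` F j))"
      using J by (intro L.emeasure_PiM_emb) auto
    also have "\<dots> = (\<Prod>j\<in>J. emeasure (measure_pmf q) (F j))"
      using emeasure_map_pmf[of fst "letter_pmf q"] unfolding marginal by simp
    finally show "emeasure (distr iid ?P env) (?X)
        = (\<Prod>j\<in>J. emeasure (measure_pmf q) (F j))" .
  qed simp
  with assms show ?thesis by (intro AE_distrD[OF env]) metis
qed

text \<open>Zooms of a non-atomic measure give the point 0 mass zero, whereas the point mass at 0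
  gives it mass one.\<close>

lemma scenery_distribution_nontrivial: "scenery_distribution \<noteq> trivial_distribution"
proof
  assume eq: "scenery_distribution = trivial_distribution"
  have zero_set: "{0} \<in> sets Kbox" by (auto simp: Kbox_def sets_restrict_space)
  define Z where "Z = {\<nu> \<in> space (prob_algebra Kbox). emeasure \<nu> {0} = 0}"
  have "(\<lambda>\<nu>. emeasure \<nu> {0}) \<in> borel_measurable (prob_algebra Kbox)"
    unfolding prob_algebra_def
    by (intro measurable_restrict_space1 measurable_emeasure_subprob_algebra zero_set)
  then have Z: "Z \<in> sets (prob_algebra Kbox)" unfolding Z_def by measurable
  have "AE y in skew_measure. \<forall>z. emeasure (\<eta> (env (snd y))) {z} = 0"
    by (rule AE_skew_snd[OF AE_env[OF nontrivial]])
  with AE_skew_dig have "AE y in skew_measure. \<forall>\<tau>. scenery y \<tau> \<in> Z"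
  proof eventually_elim
    case (elim y)
    show ?case
    proof
      fix \<tau>
      let ?s = "orientation (fst y) * \<delta> * exp (- \<tau>)"
      have pos: "emeasure (\<eta> (env (snd y))) (cball (pt (snd y)) \<bar>?s\<bar>) \<noteq> 0"
        using scenery_scale_ne0
        by (intro cball_msupp_pos[OF sets_\<eta> prob_space_\<eta> coding_in_msupp[OF elim(1)]]) simp
      have "emeasure (scenery y \<tau>) {0} = 0"
        unfolding scenery_def emeasure_zoom[OF sets_\<eta> prob_space_\<eta> zero_set scenery_scale_ne0 pos]
        using elim(2) by simp
      then show "scenery y \<tau> \<in> Z" using scenery_PK by (simp add: Z_def PK_def)
    qed
  qed
  from AE_scenery_distribution[OF Z this] have "AE \<nu> in trivial_distribution. \<nu> \<in> Z"
    unfolding eq .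
  moreover have "return Kbox 0 \<in> space (prob_algebra Kbox)"
    by (auto simp: space_prob_algebra intro!: prob_space_return)
  ultimately have "return Kbox 0 \<in> Z"
    unfolding trivial_distribution_def using Z by (subst (asm) AE_return) auto
  then show False using zero_set by (simp add: Z_def)
qed

text \<open>The window starts at \<open>ln \<delta>\<close> because there the scenery has the scale
  of \<open>blowup\<close>. Monomials are indexed by lists of naturals, so a single null set serves
  them all.\<close>

lemma time_average_scenery:
  "AE y in skew_measure. \<forall>l. ((\<lambda>T. 1 / T * integral {ln \<delta>..ln \<delta> + T} (\<lambda>\<tau>. moment_monomial l (scenery y \<tau>)))
    \<longlongrightarrow> (\<integral>\<nu>. moment_monomial l \<nu> \<partial>scenery_distribution)) at_top"
  unfolding AE_all_countable
proof
  fix l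
  let ?m = "\<lambda>\<nu>. moment_monomial l \<nu>"
  let ?h = "\<lambda>y \<tau>. ?m (scenery y \<tau>)"
  have h: "case_prod ?h \<in> borel_measurable (skew_measure \<Otimes>\<^sub>M borel)"
    using measurable_compose[OF measurable_scenery measurable_moment_monomial] by (simp add: split_beta')
  have bd: "\<bar>?h y \<tau>\<bar> \<le> 1" for y \<tau> by (rule abs_moment_monomial_le[OF scenery_PK])
  have "(\<integral>\<nu>. ?m \<nu> \<partial>scenery_distribution) = (\<integral>z. case_prod ?h z \<partial>suspension_measure)"
    unfolding scenery_distribution_def
    by (subst integral_distr[OF measurable_scenery_suspension measurable_moment_monomial]) (simp add: split_beta')
  also have "\<dots> = (\<integral>y. integral {0..roof y} (?h y) \<partial>skew_measure) / mean_roof"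
    by (rule integral_suspension[OF h bd])
  finally have eq: "(\<integral>\<nu>. ?m \<nu> \<partial>scenery_distribution) = (\<integral>y. integral {0..roof y} (?h y) \<partial>skew_measure) / mean_roof" .
  have "AE y in skew_measure. \<forall>\<tau>\<ge>0. ?h y (\<tau> + roof y) = ?h (skew y) \<tau>"
    using AE_skew_dig by eventually_elim (simp add: scenery_roof)
  from time_average[OF h bd this, of "ln \<delta>"]
  show "AE y in skew_measure. ((\<lambda>T. 1 / T * integral {ln \<delta>..ln \<delta> + T} (?h y)) \<longlongrightarrow> (\<integral>\<nu>. ?m \<nu> \<partial>scenery_distribution)) at_top"
    by (simp only: eq)
qed

text \<open>The almost sure limits on the skew product are read at the bit \<open>False\<close>,
  transferred from letters to environments and digits, and then projected to the line.\<close>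

lemma generates_scenery_distribution:
  "AE \<omega> in PiM UNIV (\<lambda>_::nat. measure_pmf q). generates (\<eta> \<omega>) scenery_distribution"
proof -
  define c where "c l = (\<integral>\<nu>. moment_monomial l \<nu> \<partial>scenery_distribution)" for l
  define avg where "avg \<omega> l T x = integral {0..T} (\<lambda>s. moment_monomial l (zoom (\<eta> \<omega>) x (exp (- s)))) / T"
    for \<omega> l T x
  define good where "good \<omega> x \<longleftrightarrow> x \<in> msupp (\<eta> \<omega>) \<and> (\<forall>l. (\<lambda>n::nat. avg \<omega> l n x) \<longlonglongrightarrow> c l)" for \<omega> x
  have shift_avg: "1 / T * integral {ln \<delta>..ln \<delta> + T} (\<lambda>\<tau>. moment_monomial l (scenery (False, x) \<tau>))
      = avg (env x) l T (pt x)" for T l x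
  proof -
    \<comment> \<open>The bit \<open>False\<close> means positive orientation, and
      \<open>\<delta> * exp (- ln \<delta>)\<close> is 1.\<close>
    have "scenery (False, x) (s + ln \<delta>) = zoom (\<eta> (env x)) (pt x) (exp (- s))" for s
      using \<delta>_pos by (simp add: scenery_def orientation_def exp_diff)
    then show ?thesis
      unfolding avg_def using integral_translate[of 0 T "\<lambda>\<tau>. moment_monomial l (scenery (False, x) \<tau>)" "ln \<delta>"]
      by (simp add: add.commute)
  qed
  have "AE x in iid. \<forall>l. ((\<lambda>T. avg (env x) l T (pt x)) \<longlongrightarrow> c l) at_top"
    using AE_skew[OF time_average_scenery False_in_sign_pmf] by (simp only: shift_avg c_def)
  with AE_dig have "AE x in iid. good (env x) (pt x)"
  proof eventually_elim
    case (elim x)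
    then show ?case
      using filterlim_compose[OF _ filterlim_real_sequentially] coding_in_msupp[OF elim(1)]
      unfolding good_def by blast
  qed
  from AE_letters[OF this]
  have ae: "AE \<omega> in PiM UNIV (\<lambda>_::nat. measure_pmf q). AE u in sym \<omega>. good \<omega> (coding r t \<omega> u)"
    by simp
  \<comment> \<open>Projecting an almost sure statement with \<open>AE_distr_iff\<close> requires a
    measurable property. For this reason support and convergence in \<open>good\<close> are
    rewritten with countable quantifiers and integer times.\<close>
  have good_sets: "{x \<in> space borel. good \<omega> x} \<in> sets borel" for \<omega>
  proof -
    have "\<eta> \<omega> \<in> space (prob_algebra borel)"
      by (simp add: space_prob_algebra prob_space_\<eta>)
    then have const: "(\<lambda>x. \<eta> \<omega>) \<in> N \<rightarrow>\<^sub>M prob_algebra borel" for N :: "'z measure" by simp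
    have "(SIGMA x:space borel. ball x e) = {z \<in> space (borel \<Otimes>\<^sub>M borel). \<bar>fst z - snd z\<bar> < e}" for e :: real
      by (auto simp: space_pair_measure dist_real_def)
    moreover have "{z \<in> space (borel \<Otimes>\<^sub>M borel). \<bar>fst z - snd z\<bar> < (e::real)} \<in> sets (borel \<Otimes>\<^sub>M borel)" for e
      by measurable
    ultimately have [measurable]: "(\<lambda>x. emeasure (\<eta> \<omega>) (ball x e)) \<in> borel_measurable borel" for e
      by (intro emeasure_measurable_subprob_algebra2[OF _ measurable_prob_algebraD[OF const]]) simp
    have supp: "x \<in> msupp (\<eta> \<omega>) \<longleftrightarrow> (\<forall>n. 0 < emeasure (\<eta> \<omega>) (ball x (1 / Suc n)))" for x
      using msupp_iff_nat[of x "\<eta> \<omega>"] by simp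
    have avg_meas [measurable]: "avg \<omega> l T \<in> borel_measurable borel" for l T
    proof -
      have "(\<lambda>z::real \<times> real. zoom (\<eta> \<omega>) (fst z) (exp (- snd z))) \<in> borel \<Otimes>\<^sub>M borel \<rightarrow>\<^sub>M prob_algebra Kbox"
        by (rule measurable_zoom[OF const]) measurable
      from measurable_compose[OF this measurable_moment_monomial]
      have m: "(\<lambda>z. moment_monomial l (zoom (\<eta> \<omega>) (fst z) (exp (- snd z)))) \<in> borel_measurable (borel \<Otimes>\<^sub>M borel)" .
      have "avg \<omega> l T x = (\<integral>s. indicator {0..T} s * moment_monomial l (zoom (\<eta> \<omega>) x (exp (- s))) \<partial>lborel) / T" for x
        unfolding avg_def
      proof (subst integrable_on_bounded_borel(2)[where B=1])
        show "(\<lambda>s. moment_monomial l (zoom (\<eta> \<omega>) x (exp (- s)))) \<in> borel_measurable borel"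
          using measurable_compose[OF measurable_Pair1'[of x borel borel] m] by simp
      qed (auto intro!: abs_moment_monomial_le zoom_PK[OF sets_\<eta> prob_space_\<eta>])
      moreover have "(\<lambda>x. \<integral>s. indicator {0..T} s * moment_monomial l (zoom (\<eta> \<omega>) x (exp (- s))) \<partial>lborel) \<in> borel_measurable borel"
      proof (rule lborel.borel_measurable_lebesgue_integral)
        have "(\<lambda>z. indicator {0..T} (snd z) * moment_monomial l (zoom (\<eta> \<omega>) (fst z) (exp (- snd z)))) \<in> borel_measurable (borel \<Otimes>\<^sub>M borel)"
          using m by measurable
        then show "(\<lambda>(x, s). indicator {0..T} s * moment_monomial l (zoom (\<eta> \<omega>) x (exp (- s)))) \<in> borel_measurable (borel \<Otimes>\<^sub>M lborel)"
          by (subst measurable_cong_sets[OF sets_pair_measure_cong[OF refl sets_lborel] refl]) (simp add: split_beta')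
      qed
      ultimately show ?thesis by (simp add: borel_measurable_divide cong: measurable_cong_simp)
    qed
    have lim: "(\<lambda>n::nat. avg \<omega> l n x) \<longlonglongrightarrow> c l \<longleftrightarrow> (\<forall>m. \<exists>N. \<forall>n\<ge>N. \<bar>avg \<omega> l (real n) x - c l\<bar> < 1 / Suc m)" for l x
    proof
      assume *: "\<forall>m. \<exists>N. \<forall>n\<ge>N. \<bar>avg \<omega> l (real n) x - c l\<bar> < 1 / Suc m"
      show "(\<lambda>n::nat. avg \<omega> l n x) \<longlonglongrightarrow> c l"
      proof (rule LIMSEQ_I)
        fix e :: real assume e: "0 < e"
        obtain m where m: "1 / Suc m < e" using nat_approx_posE[OF e] by blast
        obtain N where "\<forall>n\<ge>N. \<bar>avg \<omega> l (real n) x - c l\<bar> < 1 / Suc m" using * by blast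
        with m show "\<exists>N. \<forall>n\<ge>N. norm (avg \<omega> l (real n) x - c l) < e"
          by (intro exI[of _ N]) (auto intro: less_trans)
      qed
    next
      assume *: "(\<lambda>n::nat. avg \<omega> l n x) \<longlonglongrightarrow> c l"
      show "\<forall>m. \<exists>N. \<forall>n\<ge>N. \<bar>avg \<omega> l (real n) x - c l\<bar> < 1 / Suc m"
      proof
        fix m
        have "0 < 1 / real (Suc m)" by simp
        from LIMSEQ_D[OF * this] show "\<exists>N. \<forall>n\<ge>N. \<bar>avg \<omega> l (real n) x - c l\<bar> < 1 / Suc m"
          unfolding real_norm_def .
      qed
    qed
    show ?thesis unfolding good_def supp lim by measurable
  qed
  show ?thesis
    using ae
  proof eventually_elim
    case (elim \<omega>)
    have "AE x in \<eta> \<omega>. good \<omega> x"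
      unfolding proj_measure_def
    proof (subst AE_distr_iff)
      show "coding r t \<omega> \<in> borel_measurable (sym \<omega>)"
        by (subst measurable_cong_sets[OF sets_sym refl]) (rule measurable_coding1)
    qed (use elim good_sets[of \<omega>] in auto)
    then show ?case
      unfolding generates_def
    proof eventually_elim
      case (elim x)
      show ?case
        by (rule generates_atI[OF sets_\<eta> prob_space_\<eta> _ prob_space_scenery_distribution sets_scenery_distribution])
           (use elim in \<open>simp_all add: good_def avg_def c_def\<close>)
    qed
  qed
qed

end

theorem theorem1p3:
  fixes k :: "'i::finite \<Rightarrow> nat"
    and r :: "'i \<Rightarrow> real"
    and t :: "'i \<Rightarrow> nat \<Rightarrow> real"
    and p :: "'i \<Rightarrow> nat \<Rightarrow> real"
    and q :: "'i pmf"
  defines "\<PP> \<equiv> PiM UNIV (\<lambda>_::nat. measure_pmf q)"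
  assumes k_pos: "\<And>i. 1 \<le> k i"
    and r_ne0: "\<And>i. r i \<noteq> 0"
    and r_lt1: "\<And>i. \<bar>r i\<bar> < 1"
    and p_pos: "\<And>i j. j \<in> {1..k i} \<Longrightarrow> 0 < p i j"
    and p_sum: "\<And>i. (\<Sum>j\<in>{1..k i}. p i j) = 1"
    and nontrivial: "AE \<omega> in \<PP>. \<forall>x. emeasure (proj_measure k r t p \<omega>) {x} = 0"
    and SSC: "strong_separation k r t"
  shows "\<exists>Q. distribution_on_Mbox Q \<and> Q \<noteq> trivial_distribution \<and> S_ergodic Q \<and>
           (AE \<omega> in \<PP>. generates (proj_measure k r t p \<omega>) Q)"
proof -
  interpret ifs_family k r t p
    by standard (use k_pos r_ne0 r_lt1 p_pos p_sum in auto)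
  obtain \<delta> where \<delta>: "0 < \<delta>" "\<delta> < 1"
    "\<And>\<omega> u v. u \<in> code_space k \<omega> \<Longrightarrow> v \<in> code_space k \<omega> \<Longrightarrow> u 0 \<noteq> v 0 \<Longrightarrow>
      \<delta> \<le> \<bar>coding r t \<omega> u - coding r t \<omega> v\<bar>"
    using uniform_separation[OF SSC] by blast
  interpret bernoulli_model k r t p q \<delta>
    by standard (rule \<delta> nontrivial[unfolded \<PP>_def] | assumption)+
  show ?thesis
    unfolding \<PP>_def
    using scenery_distribution_on_Mbox scenery_distribution_nontrivial S_ergodic_scenery_distribution
      generates_scenery_distribution by blast
qed

end
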